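(* Let $p\ge0$, $r\ge0$ be integers, $H\in(0,1)$, and let $S_n^{H,p,r}$ be the centered mixed power variation defined in the context. Let $\varepsilon>0$ be arbitrary. Then the following hold almost surely as $n\to\infty$. (1) If $r=0$, then $S_n^{H,p,r}=o(n^{1/2+\varepsilon})$. (2) If $p$ and $r\ge2$ are even, then $S_n^{H,p,r}=o(n^{1/2+\varepsilon})$ for $H\in(0,3/4]$, and $S_n^{H,p,r}=o(n^{2H-1+\varepsilon})$ for $H\in(3/4,1)$. (3) If $p$ is odd, then for any $H\in(0,1)$, $S_n^{H,p,r}=o(n^{1/2+\varepsilon})$. (4) If $p$ is even and $r$ is odd, then $S_n^{H,p,r}=o(n^{1/2+\varepsilon})$ for $H\in(0,1/2]$, and $S_n^{H,p,r}=o(n^{H+\varepsilon})$ for $H\in(1/2,1)$.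
   Context: $W=\{W_t,t\ge0\}$ is a standard Wiener process and $B^H=\{B^H_t,t\ge 0\}$ is a fractional Brownian motion with Hurst parameter $H$, independent of $W$, on a complete probability space; that is, $B^H$ is a centered Gaussian process with $\mathsf{E}[B^H_tB^H_s]=\frac12(t^{2H}+s^{2H}-|t-s|^{2H})$. For a function $X$ on $[0,1]$ put $\Delta_i^nX=X_{(i+1)/n}-X_{i/n}$, $i=0,\dots,n-1$. The centered mixed power variation is $$S_n^{H,p,r}=\sum_{i=0}^{n-1}\left(n^{rH+p/2}(\Delta_i^nW)^p(\Delta_i^nB^H)^r-\mu_p\mu_r\right),$$ where $\mu_m$ is the $m$th moment of the standard Gaussian law: $\mu_m=(m-1)!!$ for $m$ even (with $(-1)!!=1$), $\mu_m=0$ for $m$ odd. *)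

theory Defs
  imports "HOL-Probability.Probability" "HOL-Library.Landau_Symbols"
begin

context prob_space
begin

definition standard_wiener_process :: "(real \<Rightarrow> 'a \<Rightarrow> real) \<Rightarrow> bool" where
  "standard_wiener_process W \<longleftrightarrow>
     (\<forall>t\<ge>0. random_variable borel (W t)) \<and>
     (AE \<omega> in M. W 0 \<omega> = 0) \<and>
     (\<forall>(k::nat) t. 0 \<le> t 0 \<and> (\<forall>i<k. t i < t (Suc i)) \<longrightarrow>
        indep_vars (\<lambda>_. borel) (\<lambda>i \<omega>. W (t (Suc i)) \<omega> - W (t i) \<omega>) {..<k}) \<and>
     (\<forall>s t. 0 \<le> s \<and> s < t \<longrightarrow>
        distributed M lborel (\<lambda>\<omega>. W t \<omega> - W s \<omega>) (normal_density 0 (sqrt (t - s)))) \<and>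
     (AE \<omega> in M. continuous_on {0..} (\<lambda>t. W t \<omega>))"

(* Degenerate (almost surely constant) variables count as Gaussian; they have no
   Lebesgue density, so they need a separate disjunct. *)
definition gaussian_variable :: "('a \<Rightarrow> real) \<Rightarrow> bool" where
  "gaussian_variable X \<longleftrightarrow> random_variable borel X \<and>
     ((\<exists>m. AE \<omega> in M. X \<omega> = m) \<or>
      (\<exists>m s. 0 < s \<and> distributed M lborel X (normal_density m s)))"

definition gaussian_process :: "'i set \<Rightarrow> ('i \<Rightarrow> 'a \<Rightarrow> real) \<Rightarrow> bool" where
  "gaussian_process T X \<longleftrightarrow>
     (\<forall>F c. finite F \<and> F \<subseteq> T \<longrightarrow> gaussian_variable (\<lambda>\<omega>. \<Sum>t\<in>F. c t * X t \<omega>))"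

(* The library convention 0 powr a = 0 gives the intended values at s = 0, t = 0
   and s = t. *)
definition fractional_brownian_motion :: "real \<Rightarrow> (real \<Rightarrow> 'a \<Rightarrow> real) \<Rightarrow> bool" where
  "fractional_brownian_motion H B \<longleftrightarrow>
     gaussian_process {0..} B \<and>
     (\<forall>t\<ge>0. expectation (B t) = 0) \<and>
     (\<forall>s\<ge>0. \<forall>t\<ge>0. expectation (\<lambda>\<omega>. B t \<omega> * B s \<omega>) =
        (t powr (2 * H) + s powr (2 * H) - \<bar>t - s\<bar> powr (2 * H)) / 2)"

definition indep_processes ::
    "'i set \<Rightarrow> ('i \<Rightarrow> 'a \<Rightarrow> real) \<Rightarrow> ('i \<Rightarrow> 'a \<Rightarrow> real) \<Rightarrow> bool" where
  "indep_processes T X Y \<longleftrightarrow>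
     indep_var (PiM T (\<lambda>_. borel)) (\<lambda>\<omega>. \<lambda>t\<in>T. X t \<omega>) (PiM T (\<lambda>_. borel)) (\<lambda>\<omega>. \<lambda>t\<in>T. Y t \<omega>)"

end

definition std_normal_moment :: "nat \<Rightarrow> real" where
  "std_normal_moment m = (\<integral>x. std_normal_density x * x ^ m \<partial>lborel)"

lemma std_normal_moment_odd: "odd m \<Longrightarrow> std_normal_moment m = 0"
  by (metis oddE std_normal_moment_def integral_std_normal_moment_odd)

(* The product is the double factorial (2k - 1)!!. *)
lemma std_normal_moment_even: "std_normal_moment (2 * k) = (\<Prod>i<k. 2 * real i + 1)"
proof -
  have "fact (2 * k) = 2 ^ k * fact k * (\<Prod>i<k. 2 * real i + 1)"
    by (induction k) (simp_all add: algebra_simps)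
  then show ?thesis
    by (simp add: std_normal_moment_def integral_std_normal_moment_even)
qed

definition grid_increment :: "nat \<Rightarrow> nat \<Rightarrow> (real \<Rightarrow> real) \<Rightarrow> real" where
  "grid_increment n i X = X (real (i + 1) / real n) - X (real i / real n)"

definition mixed_power_variation ::
    "real \<Rightarrow> nat \<Rightarrow> nat \<Rightarrow> (real \<Rightarrow> real) \<Rightarrow> (real \<Rightarrow> real) \<Rightarrow> nat \<Rightarrow> real" where
  "mixed_power_variation H p r w b n =
     (\<Sum>i<n. real n powr (real r * H + real p / 2) *
        grid_increment n i w ^ p * grid_increment n i b ^ r
        - std_normal_moment p * std_normal_moment r)"

end

theory Submission
  imports Defs "HOL-Computational_Algebra.Polynomial"
begin

text \<open>
  The variation \<open>S\<^sub>n\<close> is a polynomial of fixed degree in the increments of \<open>W\<close> and \<open>B\<close>, which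
  span a Gaussian space. Hypercontractivity of Gaussian polynomials bounds every even moment
  of \<open>S\<^sub>n\<close> by a power of its variance, so a variance bound of order \<open>n powr (2 * \<gamma> + \<epsilon>)\<close> and
  summation of sufficiently high moments give \<open>S\<^sub>n = o(n powr (\<gamma> + \<epsilon>))\<close> almost surely.

  The off-diagonal terms of the variance carry the factor \<open>(mu p)\<^sup>2 (E Y\<^sub>i\<^sup>r Y\<^sub>j\<^sup>r - (mu r)\<^sup>2)\<close>, where
  \<open>Y\<^sub>i\<close> are the normalized increments of \<open>B\<close>. It vanishes for odd \<open>p\<close> and for \<open>r = 0\<close>; otherwise
  it is of the order of the squared correlation for even \<open>r\<close> and of the correlation for odd \<open>r\<close>,
  the correlation being \<open>O(k powr (2 * H - 2))\<close> at distance \<open>k\<close>.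

  Gaussian families are accessed only through moments: the moments of all linear combinations
  determine the joint moments, so no multivariate distribution is needed. The fourth moment
  inequality is proved by adding one orthogonal variable at a time.
\<close>

section \<open>Moments of the standard normal law\<close>

text \<open>The increments at level \<open>n\<close> span a space whose dimension grows with
  \<open>n\<close>, so the constant in the fourth moment inequality may depend on the degree only.
  An induction over the variables that multiplies the constant at each step would be useless: the
  constant of \<open>V\<close> has to be reproduced exactly for \<open>extend V Y\<close>. This is
  possible because the part of a polynomial that really involves the new variable \<open>Y\<close>
  has coefficients of lower degree. Its fourth moment is governed by the constant of that lower
  degree, and the constant of degree \<open>Suc d\<close> is chosen so large that the cross terms
  fit into a complete square. Variances alone do not give almost sure convergence here: after
  division by \<open>n powr (\<gamma> + \<epsilon>)\<close> the second moment bound is only of order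
  \<open>n powr - \<epsilon>\<close>, which need not be summable, but a power \<open>2 ^ j\<close>
  of it is. The variance bound itself already spends one \<open>\<epsilon>\<close>, which absorbs
  the logarithm at borderline rates such as \<open>H = 3/4\<close> for even
  \<open>r\<close>.\<close>

abbreviation mu :: "nat \<Rightarrow> real" where "mu \<equiv> std_normal_moment"

lemma mu_even_fact: "mu (2 * k) = fact (2 * k) / (2 ^ k * fact k)"
  by (simp add: std_normal_moment_def integral_std_normal_moment_even)

lemma mu_0 [simp]: "mu 0 = 1"
  using std_normal_moment_even[of 0] by simp

lemma mu_Suc_0 [simp]: "mu (Suc 0) = 0"
  using std_normal_moment_odd[of 1] by simp

lemma mu_2 [simp]: "mu 2 = 1"
  using std_normal_moment_even[of 1] by simp

lemma mu_nonneg: "0 \<le> mu k"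
proof (cases "even k")
  case True
  then obtain j where "k = 2 * j" by (elim evenE)
  then show ?thesis by (simp add: mu_even_fact)
qed (simp add: std_normal_moment_odd)

lemma mu_rec: "mu (Suc (Suc k)) = real (Suc k) * mu k"
proof (cases "even k")
  case True
  then obtain j where k: "k = 2 * j" by (elim evenE)
  have "mu (2 * Suc j) = (2 * real j + 1) * mu (2 * j)"
    unfolding std_normal_moment_even by (simp add: mult.commute)
  then show ?thesis by (simp add: k)
qed (simp add: std_normal_moment_odd)

lemma sum_even_atMost:
  fixes f :: "nat \<Rightarrow> 'b::comm_monoid_add"
  assumes "\<And>k. odd k \<Longrightarrow> f k = 0"
  shows "(\<Sum>k\<le>2*n. f k) = (\<Sum>j\<le>n. f (2 * j))"
  by (induction n) (simp_all add: assms)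

text \<open>The moments of the law of \<open>a X + b Y\<close> for independent standard normal \<open>X\<close>, \<open>Y\<close>.\<close>

lemma mu_binomial:
  "(\<Sum>k\<le>m. real (m choose k) * (mu k * a ^ k) * (mu (m - k) * b ^ (m - k)))
     = mu m * sqrt (a\<^sup>2 + b\<^sup>2) ^ m"
proof (cases "even m")
  case True
  then obtain n where m: "m = 2 * n" by (elim evenE)
  \<comment> \<open>At an even index the factorial quotients turn the binomial coefficient of
    \<open>2 * n\<close> into \<open>mu (2 * n)\<close> times that of \<open>n\<close>, so the
    ordinary binomial theorem in the squares of \<open>a\<close> and \<open>b\<close>
    remains.\<close>
  have *: "real (2 * n choose (2 * j)) * (mu (2 * j) * a ^ (2 * j)) * (mu (2 * n - 2 * j) * b ^ (2 * n - 2 * j))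
     = mu (2 * n) * (real (n choose j) * (a\<^sup>2) ^ j * (b\<^sup>2) ^ (n - j))" if "j \<le> n" for j
  proof -
    have e: "2 * n - 2 * j = 2 * (n - j)" by simp
    have 1: "real (2 * n choose (2 * j)) = fact (2 * n) / (fact (2 * j) * fact (2 * (n - j)))"
      using that by (simp add: binomial_fact e)
    have 2: "real (n choose j) = fact n / (fact j * fact (n - j))"
      using that by (simp add: binomial_fact)
    have 3: "(2::real) ^ n = 2 ^ j * 2 ^ (n - j)"
      using that by (simp flip: power_add)
    \<comment> \<open>Factorials and powers are abstracted to nonzero reals, so that
      \<open>field_simps\<close> faces a plain rational identity.\<close>
    have "F / (J * K) * (J / (p * f) * A) * (K / (q * g) * B) = F / (p * q * h) * (h / (f * g) * A * B)"
      if "J \<noteq> 0" "K \<noteq> 0" "p \<noteq> 0" "q \<noteq> 0" "h \<noteq> 0" "f \<noteq> 0" "g \<noteq> 0" for F J K p q h f g A B :: real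
      using that by (simp add: field_simps)
    then show ?thesis
      unfolding e mu_even_fact power_mult 1 2 3 by simp
  qed
  have "(\<Sum>k\<le>2*n. real (2 * n choose k) * (mu k * a ^ k) * (mu (2 * n - k) * b ^ (2 * n - k)))
     = (\<Sum>j\<le>n. real (2 * n choose (2 * j)) * (mu (2 * j) * a ^ (2 * j)) * (mu (2 * n - 2 * j) * b ^ (2 * n - 2 * j)))"
    by (rule sum_even_atMost) (simp add: std_normal_moment_odd)
  also have "\<dots> = (\<Sum>j\<le>n. mu (2 * n) * (real (n choose j) * (a\<^sup>2) ^ j * (b\<^sup>2) ^ (n - j)))"
    using * by (intro sum.cong) auto
  also have "\<dots> = mu (2 * n) * (a\<^sup>2 + b\<^sup>2) ^ n"
    unfolding sum_distrib_left[symmetric] binomial_ring by simp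
  also have "(a\<^sup>2 + b\<^sup>2) ^ n = sqrt (a\<^sup>2 + b\<^sup>2) ^ (2 * n)"
    by (simp add: power_mult)
  finally show ?thesis by (simp only: m)
next
  case False
  then have "mu k * a ^ k = 0 \<or> mu (m - k) * b ^ (m - k) = 0" if "k \<le> m" for k
    using that by (cases "even k") (auto simp: std_normal_moment_odd)
  then show ?thesis
    using False by (auto simp: std_normal_moment_odd intro!: sum.neutral)
qed

text \<open>The polarisation device: a moment identity for \<open>X + s * Y\<close> that holds for
  every real \<open>s\<close> splits into identities between mixed moments.\<close>

lemma polyfun_coeff_eq:
  fixes c d :: "nat \<Rightarrow> real"
  assumes "\<And>s. (\<Sum>j\<le>n. c j * s ^ j) = (\<Sum>j\<le>n. d j * s ^ j)" and "j \<le> n"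
  shows "c j = d j"
  using assms polyfun_eq_coeffs[of c n d] by blast

context prob_space
begin

section \<open>Random variables with all moments\<close>

text \<open>These variables form an algebra, so later integrability obligations reduce to closure
  rules. Plain powers suffice in the definition, since even powers dominate all products through
  \<open>abs_mult_le_sum_squares\<close>.\<close>

definition finite_moments :: "('a \<Rightarrow> real) \<Rightarrow> bool" where
  "finite_moments f \<longleftrightarrow> random_variable borel f \<and> (\<forall>k. integrable M (\<lambda>\<omega>. f \<omega> ^ k))"

lemma finite_moments_measurable [measurable_dest]: "finite_moments f \<Longrightarrow> random_variable borel f"
  by (simp add: finite_moments_def)

lemma finite_moments_integrable: "finite_moments f \<Longrightarrow> integrable M f"
  using finite_moments_def power_one_right by (metis (no_types, lifting) ext)

lemma abs_mult_le_sum_squares: "\<bar>x * y\<bar> \<le> x\<^sup>2 + (y::real)\<^sup>2"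
proof -
  have "0 \<le> (\<bar>x\<bar> - \<bar>y\<bar>)\<^sup>2" "0 \<le> \<bar>x\<bar> * \<bar>y\<bar>" by auto
  then show ?thesis unfolding power2_diff abs_mult power2_abs by linarith
qed

lemma integrable_power_mult:
  assumes "finite_moments f" "finite_moments g"
  shows "integrable M (\<lambda>\<omega>. f \<omega> ^ i * g \<omega> ^ j)"
proof (rule Bochner_Integration.integrable_bound)
  show "integrable M (\<lambda>\<omega>. f \<omega> ^ (i * 2) + g \<omega> ^ (j * 2))"
    using assms by (auto simp: finite_moments_def)
  show "(\<lambda>\<omega>. f \<omega> ^ i * g \<omega> ^ j) \<in> borel_measurable M"
    using assms by (auto simp: finite_moments_def)
  show "AE \<omega> in M. norm (f \<omega> ^ i * g \<omega> ^ j) \<le> norm (f \<omega> ^ (i * 2) + g \<omega> ^ (j * 2))"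
    using abs_mult_le_sum_squares by (auto simp: power_mult)
qed

lemma finite_moments_const [intro!, simp]: "finite_moments (\<lambda>_. c)"
  by (simp add: finite_moments_def)

lemma finite_moments_mult [intro!]:
  "finite_moments f \<Longrightarrow> finite_moments g \<Longrightarrow> finite_moments (\<lambda>\<omega>. f \<omega> * g \<omega>)"
  unfolding finite_moments_def[of "\<lambda>\<omega>. f \<omega> * g \<omega>"] power_mult_distrib
  by (intro conjI allI integrable_power_mult borel_measurable_times finite_moments_measurable)

lemma finite_moments_add [intro!]:
  assumes "finite_moments f" "finite_moments g"
  shows "finite_moments (\<lambda>\<omega>. f \<omega> + g \<omega>)"
proof -
  have "random_variable borel (\<lambda>\<omega>. f \<omega> + g \<omega>)" using assms by measurable
  moreover have "integrable M (\<lambda>\<omega>. (f \<omega> + g \<omega>) ^ k)" for k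
    unfolding binomial_ring using integrable_power_mult[OF assms] by (simp add: mult.assoc)
  ultimately show ?thesis by (simp add: finite_moments_def)
qed

lemma finite_moments_power [intro!]: "finite_moments f \<Longrightarrow> finite_moments (\<lambda>\<omega>. f \<omega> ^ k)"
  unfolding finite_moments_def[of "\<lambda>\<omega>. f \<omega> ^ k"] power_mult[symmetric]
  by (auto simp: finite_moments_def)

lemma finite_moments_diff [intro!]:
  assumes "finite_moments f" "finite_moments g"
  shows "finite_moments (\<lambda>\<omega>. f \<omega> - g \<omega>)"
  using finite_moments_add[OF assms(1) finite_moments_mult[OF finite_moments_const[of "-1"] assms(2)]]
  by simp

lemma finite_moments_sum [intro!]:
  "(\<And>i. i \<in> I \<Longrightarrow> finite_moments (f i)) \<Longrightarrow> finite_moments (\<lambda>\<omega>. \<Sum>i\<in>I. f i \<omega>)"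
  by (induction I rule: infinite_finite_induct) auto

lemma Cauchy_Schwarz_expectation:
  assumes "finite_moments f" "finite_moments g"
  shows "(expectation (\<lambda>\<omega>. f \<omega> * g \<omega>))\<^sup>2 \<le> expectation (\<lambda>\<omega>. (f \<omega>)\<^sup>2) * expectation (\<lambda>\<omega>. (g \<omega>)\<^sup>2)"
proof -
  let ?a = "expectation (\<lambda>\<omega>. (f \<omega>)\<^sup>2)" and ?b = "expectation (\<lambda>\<omega>. f \<omega> * g \<omega>)"
    and ?c = "expectation (\<lambda>\<omega>. (g \<omega>)\<^sup>2)"
  have int: "integrable M (\<lambda>\<omega>. (f \<omega>)\<^sup>2)" "integrable M (\<lambda>\<omega>. f \<omega> * g \<omega>)" "integrable M (\<lambda>\<omega>. (g \<omega>)\<^sup>2)"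
    using assms by (auto intro!: finite_moments_integrable)
  have q: "0 \<le> s\<^sup>2 * ?a - 2 * s * t * ?b + t\<^sup>2 * ?c" for s t
  proof -
    have "0 \<le> expectation (\<lambda>\<omega>. (s * f \<omega> - t * g \<omega>)\<^sup>2)" by simp
    also have "\<dots> = expectation (\<lambda>\<omega>. s\<^sup>2 * (f \<omega>)\<^sup>2 - (2 * s * t) * (f \<omega> * g \<omega>) + t\<^sup>2 * (g \<omega>)\<^sup>2)"
      by (intro Bochner_Integration.integral_cong) (auto simp: power2_eq_square algebra_simps)
    also have "\<dots> = s\<^sup>2 * ?a - 2 * s * t * ?b + t\<^sup>2 * ?c"
      using int by simp
    finally show ?thesis .
  qed
  have "0 \<le> ?a" "0 \<le> ?c" by simp_all
  show ?thesis
  proof (cases "?c = 0")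
    case True
    have "0 \<le> 1 * ?a - 2 * 1 * t * ?b" for t using q[of 1 t] True by simp
    \<comment> \<open>With \<open>?c = 0\<close> the form is affine in \<open>t\<close>; unless
      \<open>?b = 0\<close>, this \<open>t\<close> would give it the negative value
      \<open>?a - 2 * (?a + 1)\<close>.\<close>
    from this[of "(?a + 1) / ?b"] have "?b \<noteq> 0 \<Longrightarrow> 0 \<le> ?a - 2 * (?a + 1)" by simp
    moreover have "\<not> 0 \<le> a - 2 * (a + 1)" if "0 \<le> a" for a :: real using that by simp
    ultimately have "?b = 0" using \<open>0 \<le> ?a\<close> by blast
    with True show ?thesis by simp
  next
    case False
    have "0 < ?c" using \<open>0 \<le> ?c\<close> False by (metis less_eq_real_def)
    \<comment> \<open>The choice \<open>s = ?c\<close>, \<open>t = ?b\<close> turns the form into a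
      multiple of the discriminant.\<close>
    moreover have "0 \<le> ?c * (?a * ?c - ?b\<^sup>2)"
      using q[of ?c ?b] by (simp add: power2_eq_square algebra_simps)
    ultimately show ?thesis by (simp add: zero_le_mult_iff)
  qed
qed

section \<open>Gaussian spaces\<close>

text \<open>The moment formula at \<open>k = 1\<close> forces mean zero because
  \<open>mu 1 = 0\<close>, and at \<open>k = 2\<close> it is a tautology, so the variance is free
  and may be zero. Degenerate elements therefore belong to the space without a separate
  clause.\<close>

definition gaussian_space :: "('a \<Rightarrow> real) set \<Rightarrow> bool" where
  "gaussian_space G \<longleftrightarrow> (\<lambda>_. 0) \<in> G \<and>
     (\<forall>X\<in>G. \<forall>Y\<in>G. \<forall>a b. (\<lambda>\<omega>. a * X \<omega> + b * Y \<omega>) \<in> G) \<and>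
     (\<forall>X\<in>G. finite_moments X) \<and>
     (\<forall>X\<in>G. \<forall>k. expectation (\<lambda>\<omega>. X \<omega> ^ k) = mu k * sqrt (expectation (\<lambda>\<omega>. (X \<omega>)\<^sup>2)) ^ k)"

definition linear_space :: "('a \<Rightarrow> real) set \<Rightarrow> bool" where
  "linear_space V \<longleftrightarrow> (\<lambda>_. 0) \<in> V \<and> (\<forall>X\<in>V. \<forall>Y\<in>V. \<forall>a b. (\<lambda>\<omega>. a * X \<omega> + b * Y \<omega>) \<in> V)"

lemma linear_spaceD: "linear_space V \<Longrightarrow> X \<in> V \<Longrightarrow> Y \<in> V \<Longrightarrow> (\<lambda>\<omega>. a * X \<omega> + b * Y \<omega>) \<in> V"
  by (simp add: linear_space_def)

lemma linear_space_0: "linear_space V \<Longrightarrow> (\<lambda>_. 0) \<in> V"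
  by (simp add: linear_space_def)

lemma linear_space_scale: "linear_space V \<Longrightarrow> X \<in> V \<Longrightarrow> (\<lambda>\<omega>. a * X \<omega>) \<in> V"
  using linear_spaceD[of V X X a 0] by simp

lemma gaussian_space_linear: "gaussian_space G \<Longrightarrow> linear_space G"
  by (simp add: gaussian_space_def linear_space_def)

lemma gaussian_space_finite_moments: "gaussian_space G \<Longrightarrow> X \<in> G \<Longrightarrow> finite_moments X"
  by (simp add: gaussian_space_def)

lemma gaussian_space_moment:
  "gaussian_space G \<Longrightarrow> X \<in> G \<Longrightarrow>
     expectation (\<lambda>\<omega>. X \<omega> ^ k) = mu k * sqrt (expectation (\<lambda>\<omega>. (X \<omega>)\<^sup>2)) ^ k"
  unfolding gaussian_space_def by blast

lemma expectation_power2_add: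
  assumes "finite_moments X" "finite_moments Y"
  shows "expectation (\<lambda>\<omega>. (a * X \<omega> + b * Y \<omega>)\<^sup>2) =
    a\<^sup>2 * expectation (\<lambda>\<omega>. (X \<omega>)\<^sup>2) + 2 * a * b * expectation (\<lambda>\<omega>. X \<omega> * Y \<omega>) + b\<^sup>2 * expectation (\<lambda>\<omega>. (Y \<omega>)\<^sup>2)"
proof -
  have int: "integrable M (\<lambda>\<omega>. (X \<omega>)\<^sup>2)" "integrable M (\<lambda>\<omega>. X \<omega> * Y \<omega>)" "integrable M (\<lambda>\<omega>. (Y \<omega>)\<^sup>2)"
    using assms by (auto intro!: finite_moments_integrable)
  have "expectation (\<lambda>\<omega>. (a * X \<omega> + b * Y \<omega>)\<^sup>2)
     = expectation (\<lambda>\<omega>. a\<^sup>2 * (X \<omega>)\<^sup>2 + (2 * a * b) * (X \<omega> * Y \<omega>) + b\<^sup>2 * (Y \<omega>)\<^sup>2)"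
    by (intro Bochner_Integration.integral_cong) (auto simp: power2_eq_square algebra_simps)
  then show ?thesis using int by simp
qed

lemma expectation_power_mult_add:
  assumes "finite_moments A" "finite_moments X" "finite_moments Y"
  shows "expectation (\<lambda>\<omega>. A \<omega> * (X \<omega> + s * Y \<omega>) ^ m) =
    (\<Sum>j\<le>m. (real (m choose j) * expectation (\<lambda>\<omega>. A \<omega> * (Y \<omega> ^ j * X \<omega> ^ (m - j)))) * s ^ j)"
proof -
  have "integrable M (\<lambda>\<omega>. A \<omega> * (Y \<omega> ^ j * X \<omega> ^ (m - j)))" for j
    using assms by (intro finite_moments_integrable finite_moments_mult finite_moments_power)
  then have int: "integrable M (\<lambda>\<omega>. (real (m choose j) * s ^ j) * (A \<omega> * (Y \<omega> ^ j * X \<omega> ^ (m - j))))" for j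
    by simp
  have "A \<omega> * (X \<omega> + s * Y \<omega>) ^ m =
      (\<Sum>j\<le>m. (real (m choose j) * s ^ j) * (A \<omega> * (Y \<omega> ^ j * X \<omega> ^ (m - j))))" for \<omega>
    unfolding add.commute[of "X \<omega>"] binomial_ring sum_distrib_left
    by (intro sum.cong) (auto simp: power_mult_distrib)
  then have "expectation (\<lambda>\<omega>. A \<omega> * (X \<omega> + s * Y \<omega>) ^ m) =
      (\<Sum>j\<le>m. expectation (\<lambda>\<omega>. (real (m choose j) * s ^ j) * (A \<omega> * (Y \<omega> ^ j * X \<omega> ^ (m - j)))))"
    using int by (simp only: Bochner_Integration.integral_sum)
  also have "\<dots> = (\<Sum>j\<le>m. (real (m choose j) * expectation (\<lambda>\<omega>. A \<omega> * (Y \<omega> ^ j * X \<omega> ^ (m - j)))) * s ^ j)"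
    by (intro sum.cong) (auto simp: integral_mult_right_zero)
  finally show ?thesis .
qed

text \<open>Comparing the coefficients of \<open>s ^ l\<close> in the moments of \<open>X + s Y\<close>.\<close>

lemma expectation_orthogonal_powers:
  assumes G: "gaussian_space G" and X: "X \<in> G" and Y: "Y \<in> G"
    and orth: "expectation (\<lambda>\<omega>. X \<omega> * Y \<omega>) = 0"
  shows "expectation (\<lambda>\<omega>. X \<omega> ^ k * Y \<omega> ^ l)
       = expectation (\<lambda>\<omega>. X \<omega> ^ k) * expectation (\<lambda>\<omega>. Y \<omega> ^ l)"
proof -
  let ?x = "sqrt (expectation (\<lambda>\<omega>. (X \<omega>)\<^sup>2))" and ?y = "sqrt (expectation (\<lambda>\<omega>. (Y \<omega>)\<^sup>2))"
  define m where "m = k + l"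
  note fm = gaussian_space_finite_moments[OF G X] gaussian_space_finite_moments[OF G Y]
  have "(\<Sum>j\<le>m. (real (m choose j) * expectation (\<lambda>\<omega>. 1 * (Y \<omega> ^ j * X \<omega> ^ (m - j)))) * s ^ j)
     = (\<Sum>j\<le>m. (real (m choose j) * (mu j * ?y ^ j * (mu (m - j) * ?x ^ (m - j)))) * s ^ j)" for s
  proof -
    have "(\<lambda>\<omega>. X \<omega> + s * Y \<omega>) \<in> G"
      using linear_spaceD[OF gaussian_space_linear[OF G] X Y, of 1 s] by simp
    then have "expectation (\<lambda>\<omega>. (X \<omega> + s * Y \<omega>) ^ m) = mu m * sqrt (expectation (\<lambda>\<omega>. (X \<omega> + s * Y \<omega>)\<^sup>2)) ^ m"
      by (rule gaussian_space_moment[OF G])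
    also have "expectation (\<lambda>\<omega>. (X \<omega> + s * Y \<omega>)\<^sup>2) = (s * ?y)\<^sup>2 + ?x\<^sup>2"
      using expectation_power2_add[OF fm, of 1 s] orth by (simp add: power_mult_distrib)
    \<comment> \<open>\<open>mu_binomial\<close> read backwards expands the moment of the sum
      exactly as for independent summands.\<close>
    also have "mu m * sqrt ((s * ?y)\<^sup>2 + ?x\<^sup>2) ^ m =
       (\<Sum>j\<le>m. (real (m choose j) * (mu j * ?y ^ j * (mu (m - j) * ?x ^ (m - j)))) * s ^ j)"
      unfolding mu_binomial[symmetric] by (intro sum.cong) (auto simp: power_mult_distrib)
    finally show ?thesis
      using expectation_power_mult_add[OF finite_moments_const[of 1] fm, of s m] by simp
  qed
  from polyfun_coeff_eq[OF this, of l]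
  have "real (m choose l) * expectation (\<lambda>\<omega>. 1 * (Y \<omega> ^ l * X \<omega> ^ (m - l)))
     = real (m choose l) * (mu l * ?y ^ l * (mu (m - l) * ?x ^ (m - l)))"
    by (simp only: m_def le_add2)
  moreover have "real (m choose l) \<noteq> 0" by (simp add: m_def)
  ultimately show ?thesis
    unfolding gaussian_space_moment[OF G X, of k] gaussian_space_moment[OF G Y, of l]
    by (simp add: m_def mult.commute)
qed

section \<open>Polynomials in a family of random variables\<close>

text \<open>The index is an upper bound for the degree, and \<open>V\<close> may be infinite and
  linearly dependent. Products are built one variable at a time, so an induction only has to treat
  multiplication by a single variable.\<close>

inductive poly_rv :: "('a \<Rightarrow> real) set \<Rightarrow> nat \<Rightarrow> ('a \<Rightarrow> real) \<Rightarrow> bool" for V where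
  const: "poly_rv V d (\<lambda>_. c)"
| var: "v \<in> V \<Longrightarrow> poly_rv V d f \<Longrightarrow> poly_rv V (Suc d) (\<lambda>\<omega>. v \<omega> * f \<omega>)"
| add: "poly_rv V d f \<Longrightarrow> poly_rv V d g \<Longrightarrow> poly_rv V d (\<lambda>\<omega>. f \<omega> + g \<omega>)"

lemma poly_rv_Suc: "poly_rv V d f \<Longrightarrow> poly_rv V (Suc d) f"
  by (induction rule: poly_rv.induct) (auto intro: poly_rv.intros)

lemma poly_rv_mono_degree: "d \<le> e \<Longrightarrow> poly_rv V d f \<Longrightarrow> poly_rv V e f"
  by (induction rule: dec_induct) (auto intro: poly_rv_Suc)

lemma poly_rv_mono: "poly_rv V d f \<Longrightarrow> V \<subseteq> V' \<Longrightarrow> poly_rv V' d f"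
  by (induction rule: poly_rv.induct) (auto intro: poly_rv.intros)

lemma poly_rv_scale: "poly_rv V d f \<Longrightarrow> poly_rv V d (\<lambda>\<omega>. c * f \<omega>)"
proof (induction rule: poly_rv.induct)
  case (var v d f)
  have "poly_rv V (Suc d) (\<lambda>\<omega>. v \<omega> * (c * f \<omega>))" using var by (intro poly_rv.var)
  then show ?case by (simp add: mult.left_commute)
qed (auto simp: distrib_left intro: poly_rv.intros)

lemma poly_rv_mult: "poly_rv V d f \<Longrightarrow> poly_rv V e g \<Longrightarrow> poly_rv V (d + e) (\<lambda>\<omega>. f \<omega> * g \<omega>)"
proof (induction rule: poly_rv.induct)
  case (const d c)
  then show ?case using poly_rv_mono_degree[of e "d + e"] by (auto intro: poly_rv_scale)
next
  case (var v d f)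
  then have "poly_rv V (Suc (d + e)) (\<lambda>\<omega>. v \<omega> * (f \<omega> * g \<omega>))" by (intro poly_rv.var)
  then show ?case by (simp add: mult.assoc)
qed (auto simp: distrib_right intro: poly_rv.intros)

lemma poly_rv_var: "v \<in> V \<Longrightarrow> poly_rv V 1 v"
  using poly_rv.var[OF _ poly_rv.const[of V 0 1]] by simp

lemma poly_rv_power: "poly_rv V d f \<Longrightarrow> poly_rv V (d * k) (\<lambda>\<omega>. f \<omega> ^ k)"
proof (induction k)
  case (Suc k)
  then show ?case using poly_rv_mult[of V d f "d * k" "\<lambda>\<omega>. f \<omega> ^ k"] by simp
qed (auto intro: poly_rv.intros)

lemma poly_rv_sum: "(\<And>i. i \<in> I \<Longrightarrow> poly_rv V d (f i)) \<Longrightarrow> poly_rv V d (\<lambda>\<omega>. \<Sum>i\<in>I. f i \<omega>)"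
  by (induction I rule: infinite_finite_induct) (auto intro: poly_rv.intros)

lemma poly_rv_finite_moments:
  "poly_rv V d f \<Longrightarrow> (\<And>v. v \<in> V \<Longrightarrow> finite_moments v) \<Longrightarrow> finite_moments f"
  by (induction rule: poly_rv.induct) auto

text \<open>For a variable \<open>v\<close>, compare the coefficients of \<open>s\<close> in the identity for \<open>L + s v\<close>;
  this is why the claim carries the power of \<open>L\<close>.\<close>

lemma expectation_orthogonal_poly_power:
  assumes G: "gaussian_space G" and V: "linear_space V" "V \<subseteq> G" and Y: "Y \<in> G"
    and orth: "\<And>v. v \<in> V \<Longrightarrow> expectation (\<lambda>\<omega>. Y \<omega> * v \<omega>) = 0"
    and f: "poly_rv V d f" and L: "L \<in> V"
  shows "expectation (\<lambda>\<omega>. (Y \<omega> ^ k * f \<omega>) * L \<omega> ^ m)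
       = expectation (\<lambda>\<omega>. Y \<omega> ^ k) * expectation (\<lambda>\<omega>. f \<omega> * L \<omega> ^ m)"
  using f L
proof (induction arbitrary: L m rule: poly_rv.induct)
  case (const d c)
  then have "expectation (\<lambda>\<omega>. Y \<omega> ^ k * L \<omega> ^ m)
       = expectation (\<lambda>\<omega>. Y \<omega> ^ k) * expectation (\<lambda>\<omega>. L \<omega> ^ m)"
    using G V Y orth by (intro expectation_orthogonal_powers[of G]) auto
  moreover have "(\<lambda>\<omega>. (Y \<omega> ^ k * c) * L \<omega> ^ m) = (\<lambda>\<omega>. c * (Y \<omega> ^ k * L \<omega> ^ m))"
    by (simp add: mult_ac)
  ultimately show ?case by simp
next
  case (var v d f)
  have fmV: "finite_moments w" if "w \<in> V" for w
    using that V G by (auto intro: gaussian_space_finite_moments)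
  have fm: "finite_moments f" "finite_moments Y" "finite_moments v" "finite_moments L"
    using poly_rv_finite_moments[OF var(2) fmV] gaussian_space_finite_moments[OF G Y] fmV var by auto
  \<comment> \<open>One power more than \<open>m\<close>: the coefficient of \<open>s\<close> in
    \<open>(L + s * v) ^ Suc m\<close> is \<open>Suc m * v * L ^ m\<close>.\<close>
  let ?m = "Suc m"
  let ?c = "\<lambda>j. expectation (\<lambda>\<omega>. (Y \<omega> ^ k * f \<omega>) * (v \<omega> ^ j * L \<omega> ^ (?m - j)))"
  let ?d = "\<lambda>j. expectation (\<lambda>\<omega>. Y \<omega> ^ k) * expectation (\<lambda>\<omega>. f \<omega> * (v \<omega> ^ j * L \<omega> ^ (?m - j)))"
  have "(\<Sum>j\<le>?m. (real (?m choose j) * ?c j) * s ^ j) = (\<Sum>j\<le>?m. (real (?m choose j) * ?d j) * s ^ j)" for s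
  proof -
    have "(\<lambda>\<omega>. L \<omega> + s * v \<omega>) \<in> V"
      using linear_spaceD[OF V(1) var.prems var.hyps(1), of 1 s] by simp
    from var.IH[OF this, of ?m]
    have "(\<Sum>j\<le>?m. (real (?m choose j) * ?c j) * s ^ j) = expectation (\<lambda>\<omega>. Y \<omega> ^ k) *
        (\<Sum>j\<le>?m. (real (?m choose j) * expectation (\<lambda>\<omega>. f \<omega> * (v \<omega> ^ j * L \<omega> ^ (?m - j)))) * s ^ j)"
      using expectation_power_mult_add[OF finite_moments_mult[OF finite_moments_power[OF fm(2), of k] fm(1)] fm(4,3), of s ?m]
        expectation_power_mult_add[OF fm(1) fm(4,3), of s ?m] by metis
    then show ?thesis
      unfolding sum_distrib_left by (simp only: mult_ac)
  qed
  from polyfun_coeff_eq[OF this, of 1] have "?c 1 = ?d 1" by (simp del: binomial_Suc_Suc)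
  then show ?case by (simp add: mult_ac)
next
  case (add d f g)
  have fmV: "finite_moments w" if "w \<in> V" for w
    using that V G by (auto intro: gaussian_space_finite_moments)
  have fm: "finite_moments f" "finite_moments g" "finite_moments Y" "finite_moments L"
    using poly_rv_finite_moments[OF add(1) fmV] poly_rv_finite_moments[OF add(2) fmV]
      gaussian_space_finite_moments[OF G Y] fmV add by auto
  have "integrable M (\<lambda>\<omega>. (Y \<omega> ^ k * f \<omega>) * L \<omega> ^ m)" "integrable M (\<lambda>\<omega>. (Y \<omega> ^ k * g \<omega>) * L \<omega> ^ m)"
    "integrable M (\<lambda>\<omega>. f \<omega> * L \<omega> ^ m)" "integrable M (\<lambda>\<omega>. g \<omega> * L \<omega> ^ m)"
    using fm by (auto intro!: finite_moments_integrable finite_moments_mult finite_moments_power)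
  then show ?case using add by (simp add: distrib_left distrib_right)
qed

text \<open>At the level of moments, \<open>Y\<close> is independent of the algebra generated by
  \<open>V\<close>. The auxiliary variable disappears at exponent \<open>0\<close>.\<close>

lemma expectation_orthogonal_poly:
  assumes "gaussian_space G" "linear_space V" "V \<subseteq> G" "Y \<in> G"
    and "\<And>v. v \<in> V \<Longrightarrow> expectation (\<lambda>\<omega>. Y \<omega> * v \<omega>) = 0" and "poly_rv V d f"
  shows "expectation (\<lambda>\<omega>. Y \<omega> ^ k * f \<omega>) = expectation (\<lambda>\<omega>. Y \<omega> ^ k) * expectation f"
  using expectation_orthogonal_poly_power[OF assms linear_space_0[OF assms(2)], of k 0] by simp

end

section \<open>Hermite polynomials\<close>

text \<open>The probabilists' normalisation: the recursion applies the operator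
  \<open>x - d/dx\<close>, which is adjoint to differentiation under the standard normal
  law.\<close>

primrec hermite :: "nat \<Rightarrow> real poly" where
  "hermite 0 = 1"
| "hermite (Suc k) = pCons 0 (hermite k) - pderiv (hermite k)"

text \<open>This is \<open>E p(N)\<close> for a standard normal \<open>N\<close>, taken as a linear
  functional of the coefficients so that the Hermite calculus is purely algebraic.\<close>

definition gauss_mean :: "real poly \<Rightarrow> real" where
  "gauss_mean p = (\<Sum>i\<le>degree p. coeff p i * mu i)"

lemma gauss_mean_altdef: "degree p \<le> n \<Longrightarrow> gauss_mean p = (\<Sum>i\<le>n. coeff p i * mu i)"
  unfolding gauss_mean_def by (intro sum.mono_neutral_left) (auto simp: coeff_eq_0)

lemma gauss_mean_add: "gauss_mean (p + q) = gauss_mean p + gauss_mean q"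
proof -
  have "degree (p + q) \<le> max (degree p) (degree q)" by (rule degree_add_le) auto
  then show ?thesis
    by (simp add: gauss_mean_altdef[of _ "max (degree p) (degree q)"] distrib_right sum.distrib)
qed

lemma gauss_mean_diff: "gauss_mean (p - q) = gauss_mean p - gauss_mean q"
  using gauss_mean_add[of "p - q" q] by simp

text \<open>Gaussian integration by parts, \<open>E (X p(X)) = E p'(X)\<close>.\<close>

lemma gauss_mean_pderiv: "gauss_mean (pCons 0 p) = gauss_mean (pderiv p)"
proof -
  let ?n = "degree p"
  have "gauss_mean (pCons 0 p) = (\<Sum>i\<le>Suc ?n. coeff (pCons 0 p) i * mu i)"
    by (rule gauss_mean_altdef) (simp add: degree_pCons_le)
  also have "\<dots> = (\<Sum>i\<le>?n. coeff p i * mu (Suc i))"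
    by (subst sum.atMost_Suc_shift) simp
  also have "\<dots> = (\<Sum>i\<le>Suc ?n. coeff p i * mu (Suc i))"
    by (simp add: coeff_eq_0)
  also have "\<dots> = (\<Sum>i\<le>?n. coeff (pderiv p) i * mu i)"
    by (subst sum.atMost_Suc_shift) (simp add: mu_rec coeff_pderiv mult_ac)
  also have "\<dots> = gauss_mean (pderiv p)"
    by (rule gauss_mean_altdef[symmetric]) (simp add: degree_pderiv)
  finally show ?thesis .
qed

text \<open>Adjointness, iterated: integration by parts differentiates \<open>hermite k * q\<close>,
  the recursion cancels the term with \<open>pderiv (hermite k)\<close>, and the derivative is left
  on \<open>q\<close>.\<close>

lemma gauss_mean_hermite: "gauss_mean (hermite k * q) = gauss_mean ((pderiv ^^ k) q)"
proof (induction k arbitrary: q)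
  case (Suc k)
  have "hermite (Suc k) * q = pCons 0 (hermite k * q) - pderiv (hermite k) * q"
    by (simp add: left_diff_distrib)
  then have "gauss_mean (hermite (Suc k) * q) = gauss_mean (hermite k * pderiv q)"
    by (simp add: gauss_mean_diff gauss_mean_pderiv pderiv_mult gauss_mean_add mult.commute)
  then show ?case by (simp add: Suc funpow_swap1)
qed simp

lemma gauss_mean_const: "gauss_mean [:c:] = c"
  by (simp add: gauss_mean_def)

lemma higher_pderiv_monom_le:
  "j \<le> k \<Longrightarrow> (pderiv ^^ k) (monom c j) = (if j = k then [:fact k * c:] else 0)" for c :: real
proof (induction k arbitrary: j c)
  case 0
  then show ?case by (simp add: monom_0)
next
  case (Suc k)
  then show ?case
  proof (cases j)
    case 0
    then show ?thesis by (simp add: monom_0 funpow_swap1 pderiv_pCons)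
  next
    case (Suc i)
    with Suc.IH[of i "real (Suc i) * c"] Suc.prems show ?thesis
      by (simp add: pderiv_monom funpow_swap1 algebra_simps del: of_nat_Suc)
  qed
qed

lemma gauss_mean_hermite_monom:
  "j \<le> k \<Longrightarrow> gauss_mean (hermite k * monom 1 j) = (if j = k then fact k else 0)"
  by (simp add: gauss_mean_hermite higher_pderiv_monom_le gauss_mean_const) (simp add: gauss_mean_def)

section \<open>Polynomials in one additional independent variable\<close>

context prob_space
begin

text \<open>\<open>Y\<close> stands for a standard normal variable independent of \<open>V\<close>.
  Orthogonality inside a common Gaussian space expresses this, by
  \<open>expectation_orthogonal_poly\<close>.\<close>

definition normal_complement :: "('a \<Rightarrow> real) set \<Rightarrow> ('a \<Rightarrow> real) set \<Rightarrow> ('a \<Rightarrow> real) \<Rightarrow> bool" where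
  "normal_complement G V Y \<longleftrightarrow> gaussian_space G \<and> linear_space V \<and> V \<subseteq> G \<and> Y \<in> G \<and>
     expectation (\<lambda>\<omega>. (Y \<omega>)\<^sup>2) = 1 \<and> (\<forall>v\<in>V. expectation (\<lambda>\<omega>. Y \<omega> * v \<omega>) = 0)"

lemma normal_complement_finite_moments:
  assumes "normal_complement G V Y"
  shows "finite_moments Y" and "poly_rv V d f \<Longrightarrow> finite_moments f"
  using assms gaussian_space_finite_moments poly_rv_finite_moments[of V d f]
  unfolding normal_complement_def by blast+

lemma expectation_power_normal_complement:
  assumes "normal_complement G V Y" "poly_rv V d u"
  shows "expectation (\<lambda>\<omega>. Y \<omega> ^ k * u \<omega>) = mu k * expectation u"
proof -
  have "expectation (\<lambda>\<omega>. Y \<omega> ^ k) = mu k"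
    using assms(1) gaussian_space_moment[of G Y k] by (simp add: normal_complement_def)
  moreover have "expectation (\<lambda>\<omega>. Y \<omega> ^ k * u \<omega>) = expectation (\<lambda>\<omega>. Y \<omega> ^ k) * expectation u"
    using assms unfolding normal_complement_def by (intro expectation_orthogonal_poly[of G V Y d u k]) auto
  ultimately show ?thesis by simp
qed

lemma expectation_poly_normal_complement:
  assumes Y: "normal_complement G V Y" and u: "poly_rv V d u"
  shows "expectation (\<lambda>\<omega>. poly p (Y \<omega>) * u \<omega>) = gauss_mean p * expectation u"
proof -
  note fm = normal_complement_finite_moments[OF Y]
  have "integrable M (\<lambda>\<omega>. Y \<omega> ^ i * u \<omega>)" for i
    using fm u by (intro finite_moments_integrable finite_moments_mult finite_moments_power) auto
  then have int: "integrable M (\<lambda>\<omega>. coeff p i * (Y \<omega> ^ i * u \<omega>))" for i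
    by simp
  have "(\<lambda>\<omega>. poly p (Y \<omega>) * u \<omega>) = (\<lambda>\<omega>. \<Sum>i\<le>degree p. coeff p i * (Y \<omega> ^ i * u \<omega>))"
    by (simp add: poly_altdef sum_distrib_right mult.assoc)
  then have "expectation (\<lambda>\<omega>. poly p (Y \<omega>) * u \<omega>)
      = (\<Sum>i\<le>degree p. expectation (\<lambda>\<omega>. coeff p i * (Y \<omega> ^ i * u \<omega>)))"
    using int by (simp only: Bochner_Integration.integral_sum)
  also have "\<dots> = (\<Sum>i\<le>degree p. coeff p i * mu i * expectation u)"
    by (simp add: expectation_power_normal_complement[OF Y u] mult.assoc)
  finally show ?thesis by (simp add: gauss_mean_def sum_distrib_right)
qed

lemma finite_moments_poly: "finite_moments Y \<Longrightarrow> finite_moments (\<lambda>\<omega>. poly p (Y \<omega>))"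
  unfolding poly_altdef by (intro finite_moments_sum finite_moments_mult finite_moments_power) auto

text \<open>Makes a Cauchy-Schwarz estimate linear by cancelling one factor \<open>x\<close>. The
  absolute value in the result avoids any discussion of the sign of \<open>C\<close>.\<close>

lemma le_of_square_le:
  fixes x y :: real
  assumes "(D * x)\<^sup>2 \<le> (C * x) * y" "0 \<le> x" "0 \<le> y" "0 < D"
  shows "x \<le> \<bar>C\<bar> / D\<^sup>2 * y"
proof (cases "x = 0")
  case False
  with assms(2) have "0 < x" by simp
  from assms(1) have "x * (D\<^sup>2 * x) \<le> x * (C * y)"
    by (simp add: power2_eq_square mult_ac)
  with \<open>0 < x\<close> have "D\<^sup>2 * x \<le> C * y" by simp
  also have "\<dots> \<le> \<bar>C\<bar> * y" using assms(3) by (intro mult_right_mono) auto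
  finally show ?thesis using assms(4) by (simp add: field_simps)
qed (use assms in auto)

text \<open>Multiplying by the Hermite polynomial of degree \<open>d\<close> isolates the top coefficient.\<close>

lemma top_coefficient_bound:
  assumes Y: "normal_complement G V Y" and g: "\<And>k. k \<le> d \<Longrightarrow> poly_rv V e (g k)"
  shows "expectation (\<lambda>\<omega>. (g d \<omega>)\<^sup>2) \<le>
    \<bar>gauss_mean (hermite d * hermite d)\<bar> / (fact d)\<^sup>2 * expectation (\<lambda>\<omega>. (\<Sum>k\<le>d. Y \<omega> ^ k * g k \<omega>)\<^sup>2)"
proof (rule le_of_square_le)
  let ?f = "\<lambda>\<omega>. \<Sum>k\<le>d. Y \<omega> ^ k * g k \<omega>" and ?h = "\<lambda>\<omega>. poly (hermite d) (Y \<omega>)"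
  note fmY = normal_complement_finite_moments(1)[OF Y]
  have fmg: "finite_moments (g k)" if "k \<le> d" for k
    using normal_complement_finite_moments(2)[OF Y g[OF that]] .
  have fmf: "finite_moments ?f"
    using fmY fmg by (intro finite_moments_sum finite_moments_mult finite_moments_power) auto
  have fmh: "finite_moments (\<lambda>\<omega>. ?h \<omega> * g d \<omega>)"
    using fmY fmg by (intro finite_moments_mult finite_moments_poly) auto
  have gg: "poly_rv V (e + e) (\<lambda>\<omega>. g k \<omega> * g d \<omega>)" if "k \<le> d" for k
    using g that by (intro poly_rv_mult) auto
  have "integrable M (\<lambda>\<omega>. poly (hermite d * monom 1 k) (Y \<omega>) * (g k \<omega> * g d \<omega>))" if "k \<le> d" for k
    using fmY fmg that by (intro finite_moments_integrable finite_moments_mult finite_moments_poly) auto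
  moreover have "(\<lambda>\<omega>. (?h \<omega> * g d \<omega>) * ?f \<omega>)
      = (\<lambda>\<omega>. \<Sum>k\<le>d. poly (hermite d * monom 1 k) (Y \<omega>) * (g k \<omega> * g d \<omega>))"
    by (simp add: sum_distrib_left poly_monom mult_ac)
  ultimately have "expectation (\<lambda>\<omega>. (?h \<omega> * g d \<omega>) * ?f \<omega>)
      = (\<Sum>k\<le>d. expectation (\<lambda>\<omega>. poly (hermite d * monom 1 k) (Y \<omega>) * (g k \<omega> * g d \<omega>)))"
    by simp
  also have "\<dots> = (\<Sum>k\<le>d. (if k = d then fact d else 0) * expectation (\<lambda>\<omega>. g k \<omega> * g d \<omega>))"
    by (intro sum.cong refl) (simp only: expectation_poly_normal_complement[OF Y gg] atMost_iff gauss_mean_hermite_monom)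
  also have "\<dots> = fact d * expectation (\<lambda>\<omega>. (g d \<omega>)\<^sup>2)"
    by (simp add: if_distrib[of "\<lambda>x. x * _"] power2_eq_square cong: if_cong)
  finally have 1: "expectation (\<lambda>\<omega>. (?h \<omega> * g d \<omega>) * ?f \<omega>) = fact d * expectation (\<lambda>\<omega>. (g d \<omega>)\<^sup>2)" .
  have "expectation (\<lambda>\<omega>. (?h \<omega> * g d \<omega>)\<^sup>2)
      = expectation (\<lambda>\<omega>. poly (hermite d * hermite d) (Y \<omega>) * (g d \<omega> * g d \<omega>))"
    by (simp add: power2_eq_square mult_ac)
  also have "\<dots> = gauss_mean (hermite d * hermite d) * expectation (\<lambda>\<omega>. (g d \<omega>)\<^sup>2)"
    unfolding power2_eq_square by (rule expectation_poly_normal_complement[OF Y gg]) simp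
  finally have 2: "expectation (\<lambda>\<omega>. (?h \<omega> * g d \<omega>)\<^sup>2)
      = gauss_mean (hermite d * hermite d) * expectation (\<lambda>\<omega>. (g d \<omega>)\<^sup>2)" .
  show "(fact d * expectation (\<lambda>\<omega>. (g d \<omega>)\<^sup>2))\<^sup>2
      \<le> (gauss_mean (hermite d * hermite d) * expectation (\<lambda>\<omega>. (g d \<omega>)\<^sup>2)) * expectation (\<lambda>\<omega>. (?f \<omega>)\<^sup>2)"
    using Cauchy_Schwarz_expectation[OF fmh fmf] unfolding 1 2 .
qed auto

text \<open>Induction on \<open>d\<close>: the top coefficient is controlled by the whole sum, and
  subtracting its term leaves a sum of lower degree with a comparable second moment. The constant
  stands outside all quantifiers over spaces and variables because it is reused for every new
  variable.\<close>

lemma coefficient_bound: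
  obtains c :: real where "0 \<le> c"
    and "\<And>G V Y e g k. normal_complement G V Y \<Longrightarrow> (\<And>k. k \<le> d \<Longrightarrow> poly_rv V e (g k)) \<Longrightarrow> k \<le> d \<Longrightarrow>
      expectation (\<lambda>\<omega>. (g k \<omega>)\<^sup>2) \<le> c * expectation (\<lambda>\<omega>. (\<Sum>k\<le>d. Y \<omega> ^ k * g k \<omega>)\<^sup>2)"
proof (induction d arbitrary: thesis)
  case 0
  show ?case by (rule 0[of 1]) auto
next
  case (Suc d)
  obtain c where c: "0 \<le> c" and bound: "\<And>G V Y e g k. normal_complement G V Y \<Longrightarrow>
      (\<And>k. k \<le> d \<Longrightarrow> poly_rv V e (g k)) \<Longrightarrow> k \<le> d \<Longrightarrow>
      expectation (\<lambda>\<omega>. (g k \<omega>)\<^sup>2) \<le> c * expectation (\<lambda>\<omega>. (\<Sum>k\<le>d. Y \<omega> ^ k * g k \<omega>)\<^sup>2)"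
    using Suc.IH by blast
  let ?D = "Suc d"
  define t where "t = \<bar>gauss_mean (hermite ?D * hermite ?D)\<bar> / (fact ?D)\<^sup>2"
  have t: "0 \<le> t" by (simp add: t_def)
  \<comment> \<open>\<open>t\<close> serves the top coefficient. The bracket bounds the truncated
    sum: \<open>(a - b)\<^sup>2 \<le> 2 * a\<^sup>2 + 2 * b\<^sup>2\<close>, with
    \<open>mu (?D * 2)\<close> being the second moment of \<open>Y ^ ?D\<close>.\<close>
  define c' where "c' = t + c * (2 + 2 * mu (?D * 2) * t)"
  show ?case
  proof (rule Suc.prems)
    show "0 \<le> c'" using t c mu_nonneg by (simp add: c'_def)
    fix G V Y e g k
    assume Y: "normal_complement G V Y" and g: "\<And>k. k \<le> ?D \<Longrightarrow> poly_rv V e (g k)" and k: "k \<le> ?D"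
    let ?f = "\<lambda>\<omega>. \<Sum>k\<le>?D. Y \<omega> ^ k * g k \<omega>" and ?f' = "\<lambda>\<omega>. \<Sum>k\<le>d. Y \<omega> ^ k * g k \<omega>"
    let ?Q = "expectation (\<lambda>\<omega>. (?f \<omega>)\<^sup>2)"
    have top: "expectation (\<lambda>\<omega>. (g ?D \<omega>)\<^sup>2) \<le> t * ?Q"
      unfolding t_def using Y g by (rule top_coefficient_bound)
    have Q: "0 \<le> ?Q" by simp
    show "expectation (\<lambda>\<omega>. (g k \<omega>)\<^sup>2) \<le> c' * ?Q"
    proof (cases "k = ?D")
      case True
      have "t * ?Q \<le> c' * ?Q"
        using Q t c mu_nonneg unfolding c'_def by (intro mult_right_mono) auto
      with top show ?thesis unfolding True by linarith
    next
      case False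
      note fmY = normal_complement_finite_moments(1)[OF Y]
      have fmg: "finite_moments (g k)" if "k \<le> ?D" for k
        using normal_complement_finite_moments(2)[OF Y g[OF that]] .
      have fmf: "finite_moments ?f" "finite_moments ?f'" "finite_moments (\<lambda>\<omega>. Y \<omega> ^ ?D * g ?D \<omega>)"
        using fmY fmg by (auto intro!: finite_moments_sum finite_moments_mult finite_moments_power simp del: power_Suc sum.atMost_Suc)
      have int: "integrable M (\<lambda>\<omega>. (?f \<omega>)\<^sup>2)" "integrable M (\<lambda>\<omega>. (?f' \<omega>)\<^sup>2)"
          "integrable M (\<lambda>\<omega>. (Y \<omega> ^ ?D * g ?D \<omega>)\<^sup>2)"
        using fmf by (auto intro!: finite_moments_integrable finite_moments_power simp del: power_Suc sum.atMost_Suc)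
      have "expectation (\<lambda>\<omega>. (Y \<omega> ^ ?D * g ?D \<omega>)\<^sup>2) = expectation (\<lambda>\<omega>. Y \<omega> ^ (?D * 2) * (g ?D \<omega> * g ?D \<omega>))"
        by (simp add: power_mult_distrib power_mult power2_eq_square mult_ac)
      also have "\<dots> = mu (?D * 2) * expectation (\<lambda>\<omega>. (g ?D \<omega>)\<^sup>2)"
        unfolding power2_eq_square using g
        by (intro expectation_power_normal_complement[OF Y, of "e + e"] poly_rv_mult) auto
      also have "\<dots> \<le> mu (?D * 2) * (t * ?Q)"
        using top mu_nonneg by (intro mult_left_mono) auto
      finally have top': "expectation (\<lambda>\<omega>. (Y \<omega> ^ ?D * g ?D \<omega>)\<^sup>2) \<le> mu (?D * 2) * (t * ?Q)" .
      have "expectation (\<lambda>\<omega>. (?f' \<omega>)\<^sup>2) \<le> expectation (\<lambda>\<omega>. 2 * (?f \<omega>)\<^sup>2 + 2 * (Y \<omega> ^ ?D * g ?D \<omega>)\<^sup>2)"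
      proof (rule integral_mono)
        fix \<omega>
        have "(a - b)\<^sup>2 \<le> 2 * a\<^sup>2 + 2 * b\<^sup>2" for a b :: real
        proof -
          have "2 * a\<^sup>2 + 2 * b\<^sup>2 = (a - b)\<^sup>2 + (a + b)\<^sup>2" by (simp add: power2_eq_square algebra_simps)
          then show ?thesis by simp
        qed
        from this[of "?f \<omega>" "Y \<omega> ^ ?D * g ?D \<omega>"]
        show "(?f' \<omega>)\<^sup>2 \<le> 2 * (?f \<omega>)\<^sup>2 + 2 * (Y \<omega> ^ ?D * g ?D \<omega>)\<^sup>2"
          by simp
      qed (use int in auto)
      also have "\<dots> = 2 * ?Q + 2 * expectation (\<lambda>\<omega>. (Y \<omega> ^ ?D * g ?D \<omega>)\<^sup>2)"
        using int by (simp del: power_Suc sum.atMost_Suc)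
      also have "\<dots> \<le> 2 * ?Q + 2 * (mu (?D * 2) * (t * ?Q))"
        using top' by simp
      also have "\<dots> = (2 + 2 * mu (?D * 2) * t) * ?Q"
        by (simp add: algebra_simps del: power_Suc sum.atMost_Suc)
      finally have f': "expectation (\<lambda>\<omega>. (?f' \<omega>)\<^sup>2) \<le> (2 + 2 * mu (?D * 2) * t) * ?Q" .
      have "expectation (\<lambda>\<omega>. (g k \<omega>)\<^sup>2) \<le> c * expectation (\<lambda>\<omega>. (?f' \<omega>)\<^sup>2)"
        using False k g by (intro bound[OF Y, of e]) auto
      also have "\<dots> \<le> c * ((2 + 2 * mu (?D * 2) * t) * ?Q)"
        using f' c by (rule mult_left_mono)
      also have "\<dots> \<le> c' * ?Q"
        using mult_nonneg_nonneg[OF t Q] unfolding c'_def distrib_right mult.assoc by simp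
      finally show ?thesis .
    qed
  qed
qed

end

section \<open>Hypercontractivity\<close>

text \<open>Cauchy-Schwarz for the sum and again for the sum of squares. The number of summands will
  be the degree, not the number of variables.\<close>

lemma power4_sum_le:
  fixes x :: "'i \<Rightarrow> real"
  shows "(\<Sum>i\<in>I. x i) ^ 4 \<le> real (card I) ^ 3 * (\<Sum>i\<in>I. x i ^ 4)"
proof -
  have "(\<Sum>i\<in>I. x i) ^ 4 = ((\<Sum>i\<in>I. x i)\<^sup>2)\<^sup>2"
    by (simp flip: power_mult)
  also have "\<dots> \<le> ((\<Sum>i\<in>I. (x i)\<^sup>2) * real (card I))\<^sup>2"
    by (intro power_mono sum_squared_le_sum_of_squares) auto
  also have "\<dots> = (\<Sum>i\<in>I. (x i)\<^sup>2)\<^sup>2 * (real (card I))\<^sup>2"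
    by (simp add: power_mult_distrib)
  also have "\<dots> \<le> ((\<Sum>i\<in>I. ((x i)\<^sup>2)\<^sup>2) * real (card I)) * (real (card I))\<^sup>2"
    by (intro mult_right_mono sum_squared_le_sum_of_squares) auto
  also have "\<dots> = real (card I) ^ 3 * (\<Sum>i\<in>I. x i ^ 4)"
    by (simp add: power3_eq_cube power2_eq_square power4_eq_xxxx mult_ac)
  finally show ?thesis .
qed

context prob_space
begin

definition extend :: "('a \<Rightarrow> real) set \<Rightarrow> ('a \<Rightarrow> real) \<Rightarrow> ('a \<Rightarrow> real) set" where
  "extend V X = {f. \<exists>a. \<exists>z\<in>V. f = (\<lambda>\<omega>. a * X \<omega> + z \<omega>)}"

text \<open>A reverse Jensen inequality, the L4-L2 form of Nelson's estimate. \<open>K\<close> is a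
  parameter because it must survive the passage from \<open>V\<close> to \<open>extend V Y\<close>
  unchanged.\<close>

definition hypercontractive :: "('a \<Rightarrow> real) set \<Rightarrow> nat \<Rightarrow> real \<Rightarrow> bool" where
  "hypercontractive V d K \<longleftrightarrow>
     (\<forall>f. poly_rv V d f \<longrightarrow> expectation (\<lambda>\<omega>. f \<omega> ^ 4) \<le> K * (expectation (\<lambda>\<omega>. (f \<omega>)\<^sup>2))\<^sup>2)"

text \<open>The coefficient of \<open>Y ^ k\<close> loses \<open>k\<close> degrees, which is what
  drives \<open>hypercontractive_extend\<close>. Beyond \<open>d\<close> truncated subtraction would
  still admit constants, hence the separate clause that those coefficients vanish.\<close>

lemma poly_rv_extend:
  assumes "poly_rv (extend V Y) d f"
  obtains g where "\<And>k. poly_rv V (d - k) (g k)" and "\<And>k \<omega>. k > d \<Longrightarrow> g k \<omega> = 0"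
    and "\<And>\<omega>. f \<omega> = (\<Sum>k\<le>d. Y \<omega> ^ k * g k \<omega>)"
  using assms
proof (induction arbitrary: thesis rule: poly_rv.induct)
  case (const d c)
  show ?case
    by (rule const[of "\<lambda>k _. if k = 0 then c else 0"])
      (auto intro: poly_rv.const simp: if_distrib[of "\<lambda>x. _ * x"] cong: if_cong)
next
  case (var v d f)
  obtain g where g: "\<And>k. poly_rv V (d - k) (g k)" and g0: "\<And>k \<omega>. k > d \<Longrightarrow> g k \<omega> = 0"
    and f: "\<And>\<omega>. f \<omega> = (\<Sum>k\<le>d. Y \<omega> ^ k * g k \<omega>)"
    using var.IH by blast
  obtain a z where z: "z \<in> V" and v: "v = (\<lambda>\<omega>. a * Y \<omega> + z \<omega>)"
    using var.hyps(1) by (auto simp: extend_def)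
  \<comment> \<open>Multiplication by \<open>a * Y + z\<close> shifts the coefficients by one and
    scales by \<open>a\<close>, and adds \<open>z\<close> times the old ones.\<close>
  let ?g = "\<lambda>k \<omega>. (case k of 0 \<Rightarrow> 0 | Suc j \<Rightarrow> a * g j \<omega>) + z \<omega> * g k \<omega>"
  show ?case
  proof (rule var.prems)
    fix k
    have zg: "poly_rv V (Suc d - k) (\<lambda>\<omega>. z \<omega> * g k \<omega>)"
    proof (cases "k \<le> d")
      case True
      then show ?thesis using poly_rv.var[OF z g[of k]] by (simp add: Suc_diff_le)
    next
      case False
      then have "(\<lambda>\<omega>. z \<omega> * g k \<omega>) = (\<lambda>_. 0)" by (auto simp: g0)
      then show ?thesis by (auto intro: poly_rv.const)
    qed
    have "poly_rv V (Suc d - k) (\<lambda>\<omega>. case k of 0 \<Rightarrow> 0 | Suc j \<Rightarrow> a * g j \<omega>)"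
      by (cases k) (auto intro: poly_rv.const poly_rv_scale g)
    then show "poly_rv V (Suc d - k) (?g k)" using zg by (rule poly_rv.add)
    show "?g k \<omega> = 0" if "k > Suc d" for \<omega>
      using that by (cases k) (auto simp: g0)
  next
    fix \<omega>
    have "(\<Sum>k\<le>Suc d. Y \<omega> ^ k * ?g k \<omega>)
        = (\<Sum>k\<le>Suc d. Y \<omega> ^ k * (case k of 0 \<Rightarrow> 0 | Suc j \<Rightarrow> a * g j \<omega>)) + (\<Sum>k\<le>Suc d. Y \<omega> ^ k * (z \<omega> * g k \<omega>))"
      by (simp add: distrib_left sum.distrib)
    also have "(\<Sum>k\<le>Suc d. Y \<omega> ^ k * (case k of 0 \<Rightarrow> 0 | Suc j \<Rightarrow> a * g j \<omega>)) = a * Y \<omega> * f \<omega>"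
      by (subst sum.atMost_Suc_shift) (simp add: f sum_distrib_left mult_ac)
    also have "(\<Sum>k\<le>Suc d. Y \<omega> ^ k * (z \<omega> * g k \<omega>)) = z \<omega> * f \<omega>"
      by (simp add: g0 f sum_distrib_left mult_ac)
    finally show "v \<omega> * f \<omega> = (\<Sum>k\<le>Suc d. Y \<omega> ^ k * ?g k \<omega>)"
      by (simp add: v distrib_right)
  qed
next
  case (add d f1 f2)
  obtain g where g: "\<And>k. poly_rv V (d - k) (g k)" "\<And>k \<omega>. k > d \<Longrightarrow> g k \<omega> = 0"
    "\<And>\<omega>. f1 \<omega> = (\<Sum>k\<le>d. Y \<omega> ^ k * g k \<omega>)"
    using add.IH(1) by blast
  obtain h where h: "\<And>k. poly_rv V (d - k) (h k)" "\<And>k \<omega>. k > d \<Longrightarrow> h k \<omega> = 0"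
    "\<And>\<omega>. f2 \<omega> = (\<Sum>k\<le>d. Y \<omega> ^ k * h k \<omega>)"
    using add.IH(2) by blast
  show ?case
    by (rule add.prems[of "\<lambda>k \<omega>. g k \<omega> + h k \<omega>"])
      (auto simp: g h distrib_left sum.distrib intro: poly_rv.add)
qed

text \<open>The factor in \<open>E R^4 \<le> hc_factor d c * K' * (E R^2)^2\<close> for a centered
  remainder \<open>R\<close>: the cube comes from \<open>power4_sum_le\<close>, the sum collects the
  fourth central moments of \<open>Y ^ k\<close>, and \<open>c\<^sup>2\<close> comes from squaring
  the coefficient bound.\<close>

definition hc_factor :: "nat \<Rightarrow> real \<Rightarrow> real" where
  "hc_factor d c = real d ^ 3 * (\<Sum>k\<in>{1..d}. \<bar>gauss_mean ((monom 1 k - [:mu k:]) ^ 4)\<bar>) * c\<^sup>2"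

text \<open>With \<open>Y\<close> averaged out of \<open>f\<close>, the remainder \<open>R\<close> only involves coefficients of lower
  degree, so its fourth moment is small compared with \<open>K\<close>.\<close>

lemma hypercontractive_extend:
  assumes Y: "normal_complement G V Y"
    and HC': "hypercontractive V d K'" and HC: "hypercontractive V (Suc d) K"
    and K': "0 \<le> K'" and K: "16 * (hc_factor (Suc d) c * K') \<le> K" and c: "0 \<le> c"
    and bound: "\<And>g k. (\<And>k. k \<le> Suc d \<Longrightarrow> poly_rv V (Suc d) (g k)) \<Longrightarrow> k \<le> Suc d \<Longrightarrow>
      expectation (\<lambda>\<omega>. (g k \<omega>)\<^sup>2) \<le> c * expectation (\<lambda>\<omega>. (\<Sum>k\<le>Suc d. Y \<omega> ^ k * g k \<omega>)\<^sup>2)"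
  shows "hypercontractive (extend V Y) (Suc d) K"
  unfolding hypercontractive_def
proof (intro allI impI)
  fix f
  assume "poly_rv (extend V Y) (Suc d) f"
  then obtain g where g: "\<And>k. poly_rv V (Suc d - k) (g k)"
    and f: "\<And>\<omega>. f \<omega> = (\<Sum>k\<le>Suc d. Y \<omega> ^ k * g k \<omega>)"
    by (rule poly_rv_extend) blast
  let ?D = "Suc d"
  define I where "I = {1..?D}"
  have I: "finite I" "0 \<notin> I" "{..?D} = insert 0 I" "card I = ?D" by (auto simp: I_def)
  define R where "R = (\<lambda>\<omega>. \<Sum>k\<in>I. (Y \<omega> ^ k - mu k) * g k \<omega>)"
  define u where "u = (\<lambda>\<omega>. g 0 \<omega> + (\<Sum>k\<in>I. mu k * g k \<omega>))"
  define A where "A = hc_factor ?D c * K'"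
  note fmY = normal_complement_finite_moments(1)[OF Y]
  note fmV = normal_complement_finite_moments(2)[OF Y]
  have gD: "poly_rv V ?D (g k)" for k
    using g[of k] by (rule poly_rv_mono_degree[rotated]) simp
  have u: "poly_rv V ?D u"
    unfolding u_def using gD by (intro poly_rv.add poly_rv_sum poly_rv_scale) auto
  have fm: "finite_moments u" "finite_moments R" "\<And>k. finite_moments (g k)"
    using fmV[OF u] fmV[OF gD] fmY unfolding R_def
    by (intro finite_moments_sum finite_moments_mult finite_moments_diff finite_moments_power finite_moments_const | simp)+
  have f_eq: "f \<omega> = u \<omega> + R \<omega>" for \<omega>
  proof -
    have "f \<omega> = g 0 \<omega> + (\<Sum>k\<in>I. Y \<omega> ^ k * g k \<omega>)"
      unfolding f I(3) using I by (subst sum.insert) auto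
    also have "(\<Sum>k\<in>I. Y \<omega> ^ k * g k \<omega>) = R \<omega> + (\<Sum>k\<in>I. mu k * g k \<omega>)"
      by (simp add: R_def left_diff_distrib sum_subtractf)
    finally show ?thesis by (simp add: u_def)
  qed
  \<comment> \<open>\<open>R\<close> has mean zero given \<open>V\<close>. This is used for
    \<open>w = u\<close>, which splits the variance, and for \<open>w = u ^ 3\<close>, which removes
    a cross term from the fourth moment.\<close>
  have orth: "expectation (\<lambda>\<omega>. w \<omega> * R \<omega>) = 0" if w: "poly_rv V e w" for e w
  proof -
    have "integrable M (\<lambda>\<omega>. (Y \<omega> ^ k - mu k) * (g k \<omega> * w \<omega>))" for k
      using fm fmV[OF w] fmY by (intro finite_moments_integrable) auto
    moreover have "(\<lambda>\<omega>. w \<omega> * R \<omega>) = (\<lambda>\<omega>. \<Sum>k\<in>I. (Y \<omega> ^ k - mu k) * (g k \<omega> * w \<omega>))"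
      by (simp add: R_def sum_distrib_left mult_ac)
    ultimately have "expectation (\<lambda>\<omega>. w \<omega> * R \<omega>)
        = (\<Sum>k\<in>I. expectation (\<lambda>\<omega>. (Y \<omega> ^ k - mu k) * (g k \<omega> * w \<omega>)))"
      by (simp only: Bochner_Integration.integral_sum)
    also have "\<dots> = 0"
    proof (rule sum.neutral, rule ballI)
      fix k
      have gw: "poly_rv V (?D + e) (\<lambda>\<omega>. g k \<omega> * w \<omega>)" by (rule poly_rv_mult[OF gD w])
      have "integrable M (\<lambda>\<omega>. Y \<omega> ^ k * (g k \<omega> * w \<omega>))" "integrable M (\<lambda>\<omega>. mu k * (g k \<omega> * w \<omega>))"
        using fm fmV[OF w] fmY by (auto intro!: finite_moments_integrable simp del: integrable_mult_right_iff)
      then show "expectation (\<lambda>\<omega>. (Y \<omega> ^ k - mu k) * (g k \<omega> * w \<omega>)) = 0"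
        using expectation_power_normal_complement[OF Y gw, of k] by (simp add: left_diff_distrib)
    qed
    finally show ?thesis .
  qed
  let ?a = "expectation (\<lambda>\<omega>. (u \<omega>)\<^sup>2)" and ?b = "expectation (\<lambda>\<omega>. (R \<omega>)\<^sup>2)"
  have a: "0 \<le> ?a" and b: "0 \<le> ?b" by simp_all
  have g_bound: "expectation (\<lambda>\<omega>. g k \<omega> ^ 4) \<le> K' * (c * ?b)\<^sup>2" if k: "k \<in> I" for k
  proof -
    have "poly_rv V d (g k)"
    proof (rule poly_rv_mono_degree[OF _ g[of k]])
      have "1 \<le> k" using k by (simp add: I_def)
      then show "?D - k \<le> d" by linarith
    qed
    then have "expectation (\<lambda>\<omega>. g k \<omega> ^ 4) \<le> K' * (expectation (\<lambda>\<omega>. (g k \<omega>)\<^sup>2))\<^sup>2"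
      using HC' by (simp add: hypercontractive_def)
    also have "\<dots> \<le> K' * (c * ?b)\<^sup>2"
    proof (intro mult_left_mono power_mono K')
      \<comment> \<open>The coefficient bound is applied to \<open>R\<close> instead of
        \<open>f\<close>, so that \<open>?b\<close> stands on the right; centering only replaces the
        coefficient at \<open>0\<close>.\<close>
      let ?g = "\<lambda>k. if k = 0 then (\<lambda>\<omega>. \<Sum>k\<in>I. - mu k * g k \<omega>) else g k"
      have "R \<omega> = (\<Sum>k\<le>?D. Y \<omega> ^ k * ?g k \<omega>)" for \<omega>
      proof -
        have "(\<Sum>k\<le>?D. Y \<omega> ^ k * ?g k \<omega>) = (\<Sum>k\<in>I. - mu k * g k \<omega>) + (\<Sum>k\<in>I. Y \<omega> ^ k * ?g k \<omega>)"
          unfolding I(3) using I by (subst sum.insert) auto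
        also have "\<dots> = (\<Sum>k\<in>I. - mu k * g k \<omega> + Y \<omega> ^ k * g k \<omega>)"
          unfolding sum.distrib using I(2) by (intro arg_cong2[of _ _ _ _ "(+)"] sum.cong) auto
        also have "\<dots> = R \<omega>"
          unfolding R_def by (intro sum.cong) (auto simp: algebra_simps)
        finally show ?thesis ..
      qed
      moreover have "poly_rv V ?D (?g k)" for k
      proof (cases "k = 0")
        case True
        have "poly_rv V ?D (\<lambda>\<omega>. \<Sum>k\<in>I. - mu k * g k \<omega>)"
          by (intro poly_rv_sum poly_rv_scale gD)
        with True show ?thesis by (simp only: refl if_True)
      qed (use gD in simp)
      ultimately show "expectation (\<lambda>\<omega>. (g k \<omega>)\<^sup>2) \<le> c * ?b"
        using bound[of ?g k] k by (simp add: I_def)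
    qed simp
    finally show ?thesis .
  qed
  have R4: "expectation (\<lambda>\<omega>. R \<omega> ^ 4) \<le> A * ?b\<^sup>2"
  proof -
    let ?p = "\<lambda>k. (monom 1 k - [:mu k:]) ^ 4"
    have g4: "poly_rv V (?D * 4) (\<lambda>\<omega>. g k \<omega> ^ 4)" for k by (rule poly_rv_power[OF gD])
    have int: "integrable M (\<lambda>\<omega>. poly (?p k) (Y \<omega>) * g k \<omega> ^ 4)" for k
      using fm fmY by (intro finite_moments_integrable finite_moments_mult finite_moments_poly finite_moments_power)
    have "expectation (\<lambda>\<omega>. R \<omega> ^ 4) \<le> expectation (\<lambda>\<omega>. real ?D ^ 3 * (\<Sum>k\<in>I. poly (?p k) (Y \<omega>) * g k \<omega> ^ 4))"
    proof (rule integral_mono)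
      show "integrable M (\<lambda>\<omega>. R \<omega> ^ 4)" using fm by (intro finite_moments_integrable) auto
      show "integrable M (\<lambda>\<omega>. real ?D ^ 3 * (\<Sum>k\<in>I. poly (?p k) (Y \<omega>) * g k \<omega> ^ 4))"
        using int by (intro integrable_mult_right Bochner_Integration.integrable_sum)
      show "R \<omega> ^ 4 \<le> real ?D ^ 3 * (\<Sum>k\<in>I. poly (?p k) (Y \<omega>) * g k \<omega> ^ 4)" for \<omega>
        using power4_sum_le[of "\<lambda>k. (Y \<omega> ^ k - mu k) * g k \<omega>" I]
        by (simp add: I(4) R_def poly_monom power_mult_distrib)
    qed
    also have "\<dots> = real ?D ^ 3 * (\<Sum>k\<in>I. expectation (\<lambda>\<omega>. poly (?p k) (Y \<omega>) * g k \<omega> ^ 4))"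
      using int by (simp only: Bochner_Integration.integral_sum integral_mult_right_zero)
    also have "\<dots> = real ?D ^ 3 * (\<Sum>k\<in>I. gauss_mean (?p k) * expectation (\<lambda>\<omega>. g k \<omega> ^ 4))"
      by (simp only: expectation_poly_normal_complement[OF Y g4])
    also have "\<dots> \<le> real ?D ^ 3 * (\<Sum>k\<in>I. \<bar>gauss_mean (?p k)\<bar> * (K' * (c * ?b)\<^sup>2))"
    proof (intro mult_left_mono sum_mono)
      fix k assume k: "k \<in> I"
      have "gauss_mean (?p k) * expectation (\<lambda>\<omega>. g k \<omega> ^ 4) \<le> \<bar>gauss_mean (?p k)\<bar> * expectation (\<lambda>\<omega>. g k \<omega> ^ 4)"
        by (intro mult_right_mono) auto
      also have "\<dots> \<le> \<bar>gauss_mean (?p k)\<bar> * (K' * (c * ?b)\<^sup>2)"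
        using g_bound[OF k] by (intro mult_left_mono) auto
      finally show "gauss_mean (?p k) * expectation (\<lambda>\<omega>. g k \<omega> ^ 4) \<le> \<bar>gauss_mean (?p k)\<bar> * (K' * (c * ?b)\<^sup>2)" .
    qed simp
    also have "\<dots> = A * ?b\<^sup>2"
      unfolding A_def hc_factor_def I_def sum_distrib_right[symmetric] power_mult_distrib by (simp only: mult_ac)
    finally show ?thesis .
  qed
  have A: "0 \<le> A" using K' unfolding A_def hc_factor_def by (auto intro!: mult_nonneg_nonneg sum_nonneg)
  have K: "16 * A \<le> K" using K unfolding A_def .
  have u4: "expectation (\<lambda>\<omega>. u \<omega> ^ 4) \<le> K * ?a\<^sup>2"
    using HC u by (simp add: hypercontractive_def)
  let ?m = "expectation (\<lambda>\<omega>. (u \<omega>)\<^sup>2 * (R \<omega>)\<^sup>2)"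
  \<comment> \<open>Cauchy-Schwarz gives
    \<open>(4 * ?m)\<^sup>2 \<le> 16 * A * K * (?a * ?b)\<^sup>2\<close>; the requirement
    \<open>16 * A \<le> K\<close> is made for this step.\<close>
  have m: "4 * ?m \<le> K * (?a * ?b)"
  proof (rule power2_le_imp_le)
    have "?m\<^sup>2 \<le> expectation (\<lambda>\<omega>. ((u \<omega>)\<^sup>2)\<^sup>2) * expectation (\<lambda>\<omega>. ((R \<omega>)\<^sup>2)\<^sup>2)"
      using fm by (intro Cauchy_Schwarz_expectation) auto
    also have "\<dots> = expectation (\<lambda>\<omega>. u \<omega> ^ 4) * expectation (\<lambda>\<omega>. R \<omega> ^ 4)"
      by (simp flip: power_mult)
    also have "\<dots> \<le> (K * ?a\<^sup>2) * (A * ?b\<^sup>2)"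
      using u4 R4 K A by (intro mult_mono) auto
    finally have "(4 * ?m)\<^sup>2 \<le> 16 * ((K * ?a\<^sup>2) * (A * ?b\<^sup>2))" by (simp add: power_mult_distrib)
    also have "\<dots> = K * (16 * A) * (?a * ?b)\<^sup>2" by (simp add: power_mult_distrib)
    also have "\<dots> \<le> K * K * (?a * ?b)\<^sup>2"
      using K A by (intro mult_right_mono mult_left_mono) auto
    finally show "(4 * ?m)\<^sup>2 \<le> (K * (?a * ?b))\<^sup>2" by (simp add: power2_eq_square mult_ac)
    show "0 \<le> K * (?a * ?b)" using K A a b by (intro mult_nonneg_nonneg) auto
  qed
  have int: "integrable M (\<lambda>\<omega>. u \<omega> ^ i * R \<omega> ^ j)" for i j
    using fm by (intro finite_moments_integrable) auto
  have int1: "integrable M (\<lambda>\<omega>. u \<omega> ^ 4)" "integrable M (\<lambda>\<omega>. R \<omega> ^ 4)"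
      "integrable M (\<lambda>\<omega>. (u \<omega>)\<^sup>2 * (R \<omega>)\<^sup>2)" "integrable M (\<lambda>\<omega>. u \<omega> ^ 3 * R \<omega>)"
      "integrable M (\<lambda>\<omega>. f \<omega> ^ 4)" "integrable M (\<lambda>\<omega>. (u \<omega>)\<^sup>2)" "integrable M (\<lambda>\<omega>. (R \<omega>)\<^sup>2)"
      "integrable M (\<lambda>\<omega>. u \<omega> * R \<omega>)"
    using fm unfolding f_eq by (auto intro!: finite_moments_integrable)
  have "expectation (\<lambda>\<omega>. f \<omega> ^ 4)
      \<le> expectation (\<lambda>\<omega>. u \<omega> ^ 4 + 4 * (u \<omega> ^ 3 * R \<omega>) + 8 * ((u \<omega>)\<^sup>2 * (R \<omega>)\<^sup>2) + 3 * R \<omega> ^ 4)"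
  proof (rule integral_mono)
    fix \<omega>
    \<comment> \<open>Absorbs the term \<open>4 * u * R ^ 3\<close> into
      \<open>2 * u\<^sup>2 * R\<^sup>2 + 2 * R ^ 4\<close>, which raises the binomial coefficients 6
      and 1 to 8 and 3.\<close>
    have "0 \<le> 2 * ((R \<omega>)\<^sup>2 * (u \<omega> - R \<omega>)\<^sup>2)" by simp
    then show "f \<omega> ^ 4 \<le> u \<omega> ^ 4 + 4 * (u \<omega> ^ 3 * R \<omega>) + 8 * ((u \<omega>)\<^sup>2 * (R \<omega>)\<^sup>2) + 3 * R \<omega> ^ 4"
      by (simp add: f_eq power4_eq_xxxx power3_eq_cube power2_eq_square algebra_simps)
  qed (use int1 in auto)
  also have "\<dots> = expectation (\<lambda>\<omega>. u \<omega> ^ 4) + 8 * ?m + 3 * expectation (\<lambda>\<omega>. R \<omega> ^ 4)"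
    using int1 orth[OF poly_rv_power[OF u, of 3]] by simp
  also have "\<dots> \<le> K * ?a\<^sup>2 + 2 * (K * (?a * ?b)) + 3 * (A * ?b\<^sup>2)"
    using u4 m R4 by linarith
  also have "\<dots> \<le> K * ?a\<^sup>2 + 2 * (K * (?a * ?b)) + K * ?b\<^sup>2"
    using mult_right_mono[of "3 * A" K "?b\<^sup>2"] K A by simp
  also have "\<dots> = K * (?a + ?b)\<^sup>2"
    by (simp add: power2_eq_square algebra_simps)
  also have "?a + ?b = expectation (\<lambda>\<omega>. (f \<omega>)\<^sup>2)"
    using int1 orth[OF u] by (simp add: f_eq power2_sum mult.assoc)
  finally show "expectation (\<lambda>\<omega>. f \<omega> ^ 4) \<le> K * (expectation (\<lambda>\<omega>. (f \<omega>)\<^sup>2))\<^sup>2" .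
qed


section \<open>Finite-dimensional subspaces, orthogonal projection and constants free of the
  dimension\<close>

text \<open>Generators may be linearly dependent; dependence shows up later as a projection residual
  of variance zero.\<close>

inductive spanned :: "('a \<Rightarrow> real) set \<Rightarrow> ('a \<Rightarrow> real) set \<Rightarrow> bool" for G where
  zero: "spanned G {\<lambda>_. 0}"
| extend: "spanned G V \<Longrightarrow> X \<in> G \<Longrightarrow> spanned G (extend V X)"

lemma linear_space_extend:
  assumes V: "linear_space V"
  shows "linear_space (extend V X)" "V \<subseteq> extend V X" "X \<in> extend V X"
proof -
  show "linear_space (extend V X)"
    unfolding linear_space_def
  proof (intro conjI ballI allI)
    show "(\<lambda>_. 0) \<in> extend V X"
      using linear_space_0[OF V] by (force simp: extend_def intro!: exI[of _ 0])
    fix f1 f2 a b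
    assume "f1 \<in> extend V X" "f2 \<in> extend V X"
    then obtain c1 z1 c2 z2 where z: "z1 \<in> V" "z2 \<in> V"
      and f: "f1 = (\<lambda>\<omega>. c1 * X \<omega> + z1 \<omega>)" "f2 = (\<lambda>\<omega>. c2 * X \<omega> + z2 \<omega>)"
      by (auto simp: extend_def)
    have "(\<lambda>\<omega>. a * z1 \<omega> + b * z2 \<omega>) \<in> V" using linear_spaceD[OF V z] .
    then show "(\<lambda>\<omega>. a * f1 \<omega> + b * f2 \<omega>) \<in> extend V X"
      unfolding extend_def f
      by (auto intro!: exI[of _ "a * c1 + b * c2"] bexI[of _ "\<lambda>\<omega>. a * z1 \<omega> + b * z2 \<omega>"] simp: algebra_simps)
  qed
  show "V \<subseteq> extend V X"
    by (force simp: extend_def intro!: exI[of _ 0])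
  show "X \<in> extend V X"
    using linear_space_0[OF V] by (force simp: extend_def intro!: exI[of _ 1] bexI[of _ "\<lambda>_. 0"])
qed

lemma extend_subset:
  assumes "linear_space G" "V \<subseteq> G" "X \<in> G"
  shows "extend V X \<subseteq> G"
  using linear_spaceD[OF assms(1) assms(3), of _ _ 1] assms(2) by (auto simp: extend_def)

text \<open>Allows a generator to be replaced by its projection residual without changing the span;
  \<open>extend_scale\<close> then permits normalising it.\<close>

lemma extend_shift:
  assumes V: "linear_space V" and z: "z \<in> V"
  shows "extend V (\<lambda>\<omega>. X \<omega> - z \<omega>) = extend V X"
proof -
  have *: "extend V (\<lambda>\<omega>. U \<omega> + c * z \<omega>) \<subseteq> extend V U" for U c
  proof
    fix f assume "f \<in> extend V (\<lambda>\<omega>. U \<omega> + c * z \<omega>)"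
    then obtain a w where w: "w \<in> V" and f: "f = (\<lambda>\<omega>. a * (U \<omega> + c * z \<omega>) + w \<omega>)"
      by (auto simp: extend_def)
    have "(\<lambda>\<omega>. (a * c) * z \<omega> + 1 * w \<omega>) \<in> V" by (rule linear_spaceD[OF V z w])
    then show "f \<in> extend V U"
      unfolding extend_def f
      by (auto intro!: exI[of _ a] bexI[of _ "\<lambda>\<omega>. (a * c) * z \<omega> + 1 * w \<omega>"] simp: algebra_simps)
  qed
  show ?thesis
    using *[of X "-1"] *[of "\<lambda>\<omega>. X \<omega> - z \<omega>" 1] by auto
qed

lemma extend_scale:
  assumes "c \<noteq> 0"
  shows "extend V (\<lambda>\<omega>. c * X \<omega>) = extend V X"
proof -
  have *: "extend V (\<lambda>\<omega>. b * U \<omega>) \<subseteq> extend V U" for U b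
    unfolding extend_def mult.assoc[symmetric] by blast
  show ?thesis using *[of c X] *[of "1 / c" "\<lambda>\<omega>. c * X \<omega>"] assms by auto
qed

lemma expectation_lincomb:
  assumes "finite_moments f" "finite_moments g"
  shows "expectation (\<lambda>\<omega>. a * f \<omega> + b * g \<omega>) = a * expectation f + b * expectation g"
  using assms by (simp add: finite_moments_integrable)

text \<open>Gram--Schmidt, one variable at a time.\<close>

lemma spanned_projection:
  assumes G: "gaussian_space G" and "spanned G V"
  shows "linear_space V" and "V \<subseteq> G"
    and "X \<in> G \<Longrightarrow> \<exists>z\<in>V. \<forall>v\<in>V. expectation (\<lambda>\<omega>. (X \<omega> - z \<omega>) * v \<omega>) = 0"
proof -
  note linG = gaussian_space_linear[OF G]
  note fm = gaussian_space_finite_moments[OF G]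
  from assms(2) have "linear_space V \<and> V \<subseteq> G \<and>
      (\<forall>X\<in>G. \<exists>z\<in>V. \<forall>v\<in>V. expectation (\<lambda>\<omega>. (X \<omega> - z \<omega>) * v \<omega>) = 0)"
  proof induction
    case zero
    show ?case using linear_space_0[OF linG] by (simp add: linear_space_def)
  next
    case (extend V X)
    then have V: "linear_space V" "V \<subseteq> G" by auto
    from extend obtain z where z: "z \<in> V" and zorth: "\<And>v. v \<in> V \<Longrightarrow> expectation (\<lambda>\<omega>. (X \<omega> - z \<omega>) * v \<omega>) = 0"
      by blast
    define Y where "Y = (\<lambda>\<omega>. X \<omega> - z \<omega>)"
    have Y: "Y \<in> G"
      using linear_spaceD[OF linG extend.hyps(2), of z 1 "-1"] z V by (auto simp: Y_def)
    have Yorth: "expectation (\<lambda>\<omega>. Y \<omega> * v \<omega>) = 0" if "v \<in> V" for v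
      using zorth[OF that] by (simp add: Y_def)
    have ext: "extend V X = extend V Y"
      unfolding Y_def using extend_shift[OF V(1) z] by simp
    have "\<exists>w\<in>extend V Y. \<forall>v\<in>extend V Y. expectation (\<lambda>\<omega>. (U \<omega> - w \<omega>) * v \<omega>) = 0" if U: "U \<in> G" for U
    proof -
      from extend.IH U obtain u where u: "u \<in> V"
        and uorth: "\<And>v. v \<in> V \<Longrightarrow> expectation (\<lambda>\<omega>. (U \<omega> - u \<omega>) * v \<omega>) = 0" by blast
      \<comment> \<open>If \<open>Y\<close> is degenerate, the quotient is \<open>0\<close> by
        convention, and Cauchy-Schwarz makes the covariance vanish too, so the equation below holds
        in either case.\<close>
      define c where "c = expectation (\<lambda>\<omega>. U \<omega> * Y \<omega>) / expectation (\<lambda>\<omega>. (Y \<omega>)\<^sup>2)"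
      have c: "expectation (\<lambda>\<omega>. U \<omega> * Y \<omega>) = c * expectation (\<lambda>\<omega>. (Y \<omega>)\<^sup>2)"
      proof (cases "expectation (\<lambda>\<omega>. (Y \<omega>)\<^sup>2) = 0")
        case True
        then show ?thesis using Cauchy_Schwarz_expectation[OF fm[OF U] fm[OF Y]] by simp
      qed (simp add: c_def)
      show ?thesis
      proof (intro bexI[of _ "\<lambda>\<omega>. c * Y \<omega> + u \<omega>"] ballI)
        show "(\<lambda>\<omega>. c * Y \<omega> + u \<omega>) \<in> extend V Y" using u by (auto simp: extend_def)
        fix f assume "f \<in> extend V Y"
        then obtain a v where v: "v \<in> V" and f: "f = (\<lambda>\<omega>. a * Y \<omega> + v \<omega>)"
          by (auto simp: extend_def)
        have fm': "finite_moments U" "finite_moments Y" "finite_moments u" "finite_moments v"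
          using fm U Y u v V by auto
        have int: "integrable M (\<lambda>\<omega>. (U \<omega> - u \<omega>) * v \<omega>)" "integrable M (\<lambda>\<omega>. Y \<omega> * v \<omega>)"
          "integrable M (\<lambda>\<omega>. U \<omega> * Y \<omega>)" "integrable M (\<lambda>\<omega>. Y \<omega> * u \<omega>)" "integrable M (\<lambda>\<omega>. (Y \<omega>)\<^sup>2)"
          using fm' by (auto intro!: finite_moments_integrable)
        have "(\<lambda>\<omega>. (U \<omega> - (c * Y \<omega> + u \<omega>)) * f \<omega>) = (\<lambda>\<omega>. (U \<omega> - u \<omega>) * v \<omega> - c * (Y \<omega> * v \<omega>)
            + a * (U \<omega> * Y \<omega>) - a * (Y \<omega> * u \<omega>) - (a * c) * (Y \<omega>)\<^sup>2)"
          by (auto simp: f power2_eq_square algebra_simps)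
        then have "expectation (\<lambda>\<omega>. (U \<omega> - (c * Y \<omega> + u \<omega>)) * f \<omega>)
          = expectation (\<lambda>\<omega>. (U \<omega> - u \<omega>) * v \<omega>) - c * expectation (\<lambda>\<omega>. Y \<omega> * v \<omega>)
            + a * expectation (\<lambda>\<omega>. U \<omega> * Y \<omega>) - a * expectation (\<lambda>\<omega>. Y \<omega> * u \<omega>) - (a * c) * expectation (\<lambda>\<omega>. (Y \<omega>)\<^sup>2)"
          using int by simp
        then show "expectation (\<lambda>\<omega>. (U \<omega> - (c * Y \<omega> + u \<omega>)) * f \<omega>) = 0"
          by (simp add: uorth[OF v] Yorth[OF v] Yorth[OF u] c)
      qed
    qed
    then show ?case
      using linear_space_extend(1)[OF V(1)] extend_subset[OF linG V(2) Y] unfolding ext by blast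
  qed
  then show "linear_space V" and "V \<subseteq> G"
    and "X \<in> G \<Longrightarrow> \<exists>z\<in>V. \<forall>v\<in>V. expectation (\<lambda>\<omega>. (X \<omega> - z \<omega>) * v \<omega>) = 0"
    by auto
qed

lemma poly_rv_0: "poly_rv V d f \<Longrightarrow> d = 0 \<Longrightarrow> \<exists>c. f = (\<lambda>_. c)"
  by (induction rule: poly_rv.induct) force+

lemma poly_rv_zero_space: "poly_rv {\<lambda>_. 0} d f \<Longrightarrow> \<exists>c. f = (\<lambda>_. c)"
  by (induction rule: poly_rv.induct) force+

lemma hypercontractive_const:
  assumes "1 \<le> K" and "\<And>f. poly_rv V d f \<Longrightarrow> \<exists>c. f = (\<lambda>_. c)"
  shows "hypercontractive V d K"
  unfolding hypercontractive_def
proof (intro allI impI)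
  fix f assume "poly_rv V d f"
  with assms(2) obtain c where "f = (\<lambda>_. c)" by blast
  then show "expectation (\<lambda>\<omega>. f \<omega> ^ 4) \<le> K * (expectation (\<lambda>\<omega>. (f \<omega>)\<^sup>2))\<^sup>2"
    using mult_right_mono[OF assms(1), of "c ^ 4"] by (simp add: prob_space flip: power_mult)
qed

text \<open>\<open>K\<close> is fixed beforehand by recursion on the degree. The induction over
  generators then runs for all degrees at once, since a new variable at degree \<open>Suc e\<close>
  calls on the old space at degrees \<open>e\<close> and \<open>Suc e\<close>.\<close>

lemma spanned_hypercontractive:
  obtains K :: "nat \<Rightarrow> real" where "\<And>d. 1 \<le> K d"
    and "\<And>G V d. gaussian_space G \<Longrightarrow> spanned G V \<Longrightarrow> hypercontractive V d (K d)"
proof -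
  \<comment> \<open>Packs the bound into a predicate, so that one constant per degree can be chosen
    as a function.\<close>
  define P where "P d c \<longleftrightarrow> 0 \<le> c \<and> (\<forall>G V Y e g k. normal_complement G V Y \<longrightarrow>
      (\<forall>k\<le>d. poly_rv V e (g k)) \<longrightarrow> k \<le> d \<longrightarrow>
      expectation (\<lambda>\<omega>. (g k \<omega>)\<^sup>2) \<le> c * expectation (\<lambda>\<omega>. (\<Sum>k\<le>d. Y \<omega> ^ k * g k \<omega>)\<^sup>2))" for d c
  have "\<exists>c. P d c" for d
    by (rule coefficient_bound[of d]) (unfold P_def, blast)
  then obtain c where "\<And>d. P d (c d)" by metis
  then have c: "\<And>d. 0 \<le> c d"
    and bound: "\<And>d G V Y e g k. normal_complement G V Y \<Longrightarrow> (\<And>k. k \<le> d \<Longrightarrow> poly_rv V e (g k)) \<Longrightarrow> k \<le> d \<Longrightarrow>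
      expectation (\<lambda>\<omega>. (g k \<omega>)\<^sup>2) \<le> c d * expectation (\<lambda>\<omega>. (\<Sum>k\<le>d. Y \<omega> ^ k * g k \<omega>)\<^sup>2)"
    unfolding P_def by blast+
  define K where "K = rec_nat 1 (\<lambda>d x. max 1 (16 * (hc_factor (Suc d) (c (Suc d)) * x)))"
  have K_Suc: "K (Suc d) = max 1 (16 * (hc_factor (Suc d) (c (Suc d)) * K d))" for d
    by (simp add: K_def)
  have K1: "1 \<le> K d" for d by (cases d) (simp_all add: K_def)
  have "hypercontractive V d (K d)" if G: "gaussian_space G" and "spanned G V" for G V d
    using that(2)
  proof (induction arbitrary: d)
    case zero
    show ?case by (rule hypercontractive_const[OF K1]) (rule poly_rv_zero_space)
  next
    case (extend V X)
    note linG = gaussian_space_linear[OF G]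
    note V = spanned_projection[OF G extend.hyps(1)]
    from V(3)[OF extend.hyps(2)] obtain z where z: "z \<in> V"
      and zorth: "\<And>v. v \<in> V \<Longrightarrow> expectation (\<lambda>\<omega>. (X \<omega> - z \<omega>) * v \<omega>) = 0" by blast
    define Y where "Y = (\<lambda>\<omega>. X \<omega> - z \<omega>)"
    have Y: "Y \<in> G"
      using linear_spaceD[OF linG extend.hyps(2), of z 1 "-1"] z V(2) by (auto simp: Y_def)
    have ext: "extend V X = extend V Y"
      unfolding Y_def using extend_shift[OF V(1) z] by simp
    have fmY: "finite_moments Y" by (rule gaussian_space_finite_moments[OF G Y])
    show ?case
    proof (cases d)
      case 0
      then show ?thesis by (intro hypercontractive_const[OF K1]) (auto dest: poly_rv_0)
    next
      case (Suc e)
      show ?thesis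
      proof (cases "expectation (\<lambda>\<omega>. (Y \<omega>)\<^sup>2) = 0")
        \<comment> \<open>The residual vanishes almost surely, so \<open>f\<close> coincides with
          its coefficient at \<open>Y ^ 0\<close>, a polynomial in \<open>V\<close> to which the
          induction hypothesis applies.\<close>
        case True
        have "integrable M (\<lambda>\<omega>. (Y \<omega>)\<^sup>2)" using fmY by (auto intro: finite_moments_integrable)
        then have Y0: "AE \<omega> in M. Y \<omega> = 0"
          using True integral_nonneg_eq_0_iff_AE[of M "\<lambda>\<omega>. (Y \<omega>)\<^sup>2"] by simp
        show ?thesis
          unfolding hypercontractive_def ext
        proof (intro allI impI)
          fix f assume f: "poly_rv (extend V Y) d f"
          then obtain g where g: "\<And>k. poly_rv V (d - k) (g k)"
            and f_eq: "\<And>\<omega>. f \<omega> = (\<Sum>k\<le>d. Y \<omega> ^ k * g k \<omega>)" by (rule poly_rv_extend) blast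
          have eq: "AE \<omega> in M. f \<omega> = g 0 \<omega>"
            using Y0
          proof eventually_elim
            case (elim \<omega>)
            have "f \<omega> = (\<Sum>k\<le>d. if k = 0 then g 0 \<omega> else 0)"
              unfolding f_eq by (intro sum.cong) (auto simp: elim)
            then show ?case by simp
          qed
          have g0: "poly_rv V d (g 0)" using g[of 0] by simp
          have meas: "random_variable borel (g 0)" "random_variable borel f"
          proof -
            have "finite_moments v" if "v \<in> extend V Y" for v
              using that extend_subset[OF linG V(2) Y] gaussian_space_finite_moments[OF G] by blast
            then show "random_variable borel f"
              using poly_rv_finite_moments[OF f] by (auto intro: finite_moments_measurable)
            have "finite_moments v" if "v \<in> V" for v
              using that V(2) gaussian_space_finite_moments[OF G] by blast
            then show "random_variable borel (g 0)"
              using poly_rv_finite_moments[OF g0] by (auto intro: finite_moments_measurable)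
          qed
          have "expectation (\<lambda>\<omega>. f \<omega> ^ n) = expectation (\<lambda>\<omega>. g 0 \<omega> ^ n)" for n
            using eq meas by (intro integral_cong_AE) auto
          then show "expectation (\<lambda>\<omega>. f \<omega> ^ 4) \<le> K d * (expectation (\<lambda>\<omega>. (f \<omega>)\<^sup>2))\<^sup>2"
            using extend.IH[of d] g0 by (simp add: hypercontractive_def)
        qed
      next
        case False
        have "0 \<le> expectation (\<lambda>\<omega>. (Y \<omega>)\<^sup>2)" by simp
        with False have pos: "0 < expectation (\<lambda>\<omega>. (Y \<omega>)\<^sup>2)" by (metis less_eq_real_def)
        define s where "s = 1 / sqrt (expectation (\<lambda>\<omega>. (Y \<omega>)\<^sup>2))"
        have s: "s \<noteq> 0" "s\<^sup>2 * expectation (\<lambda>\<omega>. (Y \<omega>)\<^sup>2) = 1"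
          using pos by (auto simp: s_def power_divide)
        have "expectation (\<lambda>\<omega>. (s * Y \<omega>) * v \<omega>) = 0" if "v \<in> V" for v
          using zorth[OF that] by (simp add: Y_def mult.assoc)
        then have compl: "normal_complement G V (\<lambda>\<omega>. s * Y \<omega>)"
          using G V(1,2) linear_space_scale[OF linG Y] s
          by (auto simp: normal_complement_def power_mult_distrib)
        have "hypercontractive (extend V (\<lambda>\<omega>. s * Y \<omega>)) (Suc e) (K (Suc e))"
        proof (rule hypercontractive_extend[OF compl extend.IH[of e] extend.IH[of "Suc e"] _ _ c[of "Suc e"]])
          show "0 \<le> K e" using K1[of e] by simp
          show "16 * (hc_factor (Suc e) (c (Suc e)) * K e) \<le> K (Suc e)" by (simp add: K_Suc)
        qed (rule bound[OF compl])
        then show ?thesis unfolding ext Suc extend_scale[OF s(1)] .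
      qed
    qed
  qed
  with K1 show thesis by (rule that)
qed

lemma spanned_union:
  assumes G: "gaussian_space G" and V1: "spanned G V1"
  shows "spanned G V2 \<Longrightarrow> \<exists>V. spanned G V \<and> V1 \<subseteq> V \<and> V2 \<subseteq> V"
proof (induction rule: spanned.induct)
  case zero
  then show ?case using V1 linear_space_0[OF spanned_projection(1)[OF G V1]] by auto
next
  case (extend V2 X)
  then obtain V where V: "spanned G V" "V1 \<subseteq> V" "V2 \<subseteq> V" by auto
  then have "spanned G (extend V X)" using extend by (intro spanned.extend)
  moreover have "V \<subseteq> extend V X"
    by (rule linear_space_extend(2)[OF spanned_projection(1)[OF G V(1)]])
  moreover have "extend V2 X \<subseteq> extend V X" using V(3) by (auto simp: extend_def)
  ultimately show ?case using V(2) by blast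
qed

text \<open>A polynomial involves only finitely many elements of \<open>G\<close>. As the constants
  do not depend on the dimension, the bound passes to all of \<open>G\<close>.\<close>

lemma poly_rv_spanned:
  assumes G: "gaussian_space G"
  shows "poly_rv G d f \<Longrightarrow> \<exists>V. spanned G V \<and> poly_rv V d f"
proof (induction rule: poly_rv.induct)
  case (const d c)
  then show ?case using spanned.zero poly_rv.const by blast
next
  case (var v d f)
  then obtain V where V: "spanned G V" "poly_rv V d f" by blast
  note ext = linear_space_extend[OF spanned_projection(1)[OF G V(1)], of v]
  have "poly_rv (extend V v) (Suc d) (\<lambda>\<omega>. v \<omega> * f \<omega>)"
    using ext poly_rv_mono[OF V(2)] by (intro poly_rv.var) auto
  then show ?case using spanned.extend[OF V(1) var(1)] by blast
next
  case (add d f g)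
  then obtain V1 V2 where V: "spanned G V1" "poly_rv V1 d f" "spanned G V2" "poly_rv V2 d g" by blast
  then obtain V where "spanned G V" "V1 \<subseteq> V" "V2 \<subseteq> V" using spanned_union[OF G] by blast
  then show ?case using V poly_rv_mono poly_rv.add by metis
qed

lemma gaussian_fourth_moment_bound:
  obtains K :: "nat \<Rightarrow> real" where "\<And>d. 1 \<le> K d"
    and "\<And>G d f. gaussian_space G \<Longrightarrow> poly_rv G d f \<Longrightarrow>
      expectation (\<lambda>\<omega>. f \<omega> ^ 4) \<le> K d * (expectation (\<lambda>\<omega>. (f \<omega>)\<^sup>2))\<^sup>2"
proof -
  obtain K :: "nat \<Rightarrow> real" where "\<And>d. 1 \<le> K d"
    and "\<And>G V d. gaussian_space G \<Longrightarrow> spanned G V \<Longrightarrow> hypercontractive V d (K d)"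
    by (rule spanned_hypercontractive) blast
  then show ?thesis
    using poly_rv_spanned unfolding hypercontractive_def by (intro that[of K]) metis+
qed

text \<open>The induction step applies the bound for \<open>j\<close> to \<open>f\<^sup>2\<close>, again a polynomial of fixed degree.\<close>

lemma gaussian_moment_bound:
  obtains C :: "nat \<Rightarrow> nat \<Rightarrow> real" where "\<And>j d. 0 \<le> C j d"
    and "\<And>G j d f. gaussian_space G \<Longrightarrow> poly_rv G d f \<Longrightarrow>
      expectation (\<lambda>\<omega>. f \<omega> ^ (2 * 2 ^ j)) \<le> C j d * (expectation (\<lambda>\<omega>. (f \<omega>)\<^sup>2)) ^ (2 ^ j)"
proof -
  obtain K :: "nat \<Rightarrow> real" where K1: "\<And>d. 1 \<le> K d"
    and K: "\<And>G d f. gaussian_space G \<Longrightarrow> poly_rv G d f \<Longrightarrow>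
      expectation (\<lambda>\<omega>. f \<omega> ^ 4) \<le> K d * (expectation (\<lambda>\<omega>. (f \<omega>)\<^sup>2))\<^sup>2"
    by (rule gaussian_fourth_moment_bound) blast
  define P where "P j d C \<longleftrightarrow> 0 \<le> C \<and> (\<forall>G f. gaussian_space G \<longrightarrow> poly_rv G d f \<longrightarrow>
      expectation (\<lambda>\<omega>. f \<omega> ^ (2 * 2 ^ j)) \<le> C * (expectation (\<lambda>\<omega>. (f \<omega>)\<^sup>2)) ^ (2 ^ j))" for j d C
  have "\<exists>C. P j d C" for j d
  proof (induction j arbitrary: d)
    case 0
    show ?case unfolding P_def by (intro exI[of _ 1]) auto
  next
    case (Suc j)
    from Suc[of "d * 2"] obtain C where C: "0 \<le> C"
      and bound: "\<And>G f. gaussian_space G \<Longrightarrow> poly_rv G (d * 2) f \<Longrightarrow>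
        expectation (\<lambda>\<omega>. f \<omega> ^ (2 * 2 ^ j)) \<le> C * (expectation (\<lambda>\<omega>. (f \<omega>)\<^sup>2)) ^ (2 ^ j)"
      unfolding P_def by blast
    show ?case
      unfolding P_def
    proof (intro exI[of _ "C * K d ^ (2 ^ j)"] conjI allI impI)
      show "0 \<le> C * K d ^ (2 ^ j)" using C K1[of d] by simp
      fix G f assume G: "gaussian_space G" and f: "poly_rv G d f"
      let ?E = "expectation (\<lambda>\<omega>. (f \<omega>)\<^sup>2)"
      have "expectation (\<lambda>\<omega>. f \<omega> ^ (2 * 2 ^ Suc j)) = expectation (\<lambda>\<omega>. ((f \<omega>)\<^sup>2) ^ (2 * 2 ^ j))"
        unfolding power_mult[symmetric] by simp
      also have "\<dots> \<le> C * (expectation (\<lambda>\<omega>. ((f \<omega>)\<^sup>2)\<^sup>2)) ^ (2 ^ j)"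
        by (rule bound[OF G poly_rv_power[OF f]])
      also have "expectation (\<lambda>\<omega>. ((f \<omega>)\<^sup>2)\<^sup>2) = expectation (\<lambda>\<omega>. f \<omega> ^ 4)"
        unfolding power_mult[symmetric] by simp
      also have "C * (expectation (\<lambda>\<omega>. f \<omega> ^ 4)) ^ (2 ^ j) \<le> C * (K d * ?E\<^sup>2) ^ (2 ^ j)"
        using K[OF G f] C by (intro mult_left_mono power_mono) auto
      also have "\<dots> = C * K d ^ (2 ^ j) * ?E ^ (2 ^ Suc j)"
        by (simp add: power_mult_distrib flip: power_mult)
      finally show "expectation (\<lambda>\<omega>. f \<omega> ^ (2 * 2 ^ Suc j)) \<le> C * K d ^ (2 ^ j) * ?E ^ (2 ^ Suc j)" .
    qed
  qed
  then obtain C where "\<And>j d. P j d (C j d)" by metis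
  then show ?thesis by (intro that[of C]) (auto simp: P_def)
qed

end

section \<open>Correlation of powers of Gaussian variables\<close>

text \<open>The sum collects the coefficients of the terms with a positive power of
  \<open>\<rho>\<close> in \<open>expectation_correlated_powers\<close>; the last summand bounds the
  change of the term at \<open>k = 0\<close> from its value at \<open>\<rho> = 0\<close>.\<close>

definition corr_const :: "nat \<Rightarrow> real" where
  "corr_const r = (\<Sum>k\<in>{1..r}. real (r choose k) * (mu (r + k) * mu (r - k))) + real r * (mu r)\<^sup>2"

lemma corr_const_nonneg: "0 \<le> corr_const r"
  unfolding corr_const_def by (intro add_nonneg_nonneg sum_nonneg mult_nonneg_nonneg mu_nonneg) auto

text \<open>For positive \<open>r\<close> the exponent is the Hermite rank of \<open>x ^ r\<close>
  minus its mean: two for even \<open>r\<close>, one for odd \<open>r\<close>.\<close>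

definition corr_size :: "nat \<Rightarrow> real \<Rightarrow> real" where
  "corr_size r \<rho> = (if even r then \<rho>\<^sup>2 else \<bar>\<rho>\<bar>)"

lemma corr_size_power_bound:
  assumes "\<bar>\<rho>\<bar> \<le> 1" "1 \<le> k" "even r \<Longrightarrow> 2 \<le> k"
  shows "\<bar>\<rho>\<bar> ^ k \<le> corr_size r \<rho>"
proof (cases "even r")
  case True
  then have "\<bar>\<rho>\<bar> ^ k \<le> \<bar>\<rho>\<bar> ^ 2" using assms by (intro power_decreasing) auto
  with True show ?thesis by (simp add: corr_size_def)
next
  case False
  have "\<bar>\<rho>\<bar> ^ k \<le> \<bar>\<rho>\<bar> ^ 1" using assms by (intro power_decreasing) auto
  with False show ?thesis by (simp add: corr_size_def)
qed

text \<open>An even exponent removes the square root, and Bernoulli's inequality applies to the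
  remaining power of \<open>1 - \<rho>\<^sup>2\<close>.\<close>

lemma one_minus_sqrt_power_bound:
  assumes "\<bar>\<rho>\<bar> \<le> 1" "even r"
  shows "\<bar>sqrt (1 - \<rho>\<^sup>2) ^ r - 1\<bar> \<le> real r * \<rho>\<^sup>2"
proof -
  obtain m where r: "r = 2 * m" using assms(2) by (elim evenE)
  have \<rho>: "0 \<le> \<rho>\<^sup>2" "\<rho>\<^sup>2 \<le> 1" using assms(1) by (auto simp: abs_square_le_1)
  have eq: "sqrt (1 - \<rho>\<^sup>2) ^ r = (1 - \<rho>\<^sup>2) ^ m" using \<rho> by (simp add: r power_mult)
  have "1 + real m * (- \<rho>\<^sup>2) \<le> (1 + - \<rho>\<^sup>2) ^ m" using \<rho> by (intro Bernoulli_inequality) auto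
  moreover have "(1 - \<rho>\<^sup>2) ^ m \<le> 1" using \<rho> by (intro power_le_one) auto
  moreover have "real m * \<rho>\<^sup>2 \<le> real r * \<rho>\<^sup>2" unfolding r using \<rho> by (intro mult_right_mono) auto
  ultimately show ?thesis unfolding eq by auto
qed

context prob_space
begin

text \<open>Regression of \<open>Y\<close> on \<open>X\<close>: the residual \<open>Z\<close> is
  orthogonal to \<open>X\<close> with variance \<open>1 - \<rho>\<^sup>2\<close>, so its powers
  factor off after the binomial expansion of \<open>(Z + \<rho> * X) ^ r\<close>.\<close>

lemma expectation_correlated_powers:
  assumes G: "gaussian_space G" and X: "X \<in> G" and Y: "Y \<in> G"
    and X1: "expectation (\<lambda>\<omega>. (X \<omega>)\<^sup>2) = 1" and Y1: "expectation (\<lambda>\<omega>. (Y \<omega>)\<^sup>2) = 1"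
    and \<rho>: "expectation (\<lambda>\<omega>. X \<omega> * Y \<omega>) = \<rho>"
  shows "expectation (\<lambda>\<omega>. X \<omega> ^ r * Y \<omega> ^ r) =
    (\<Sum>k\<le>r. real (r choose k) * (mu (r + k) * mu (r - k)) * (sqrt (1 - \<rho>\<^sup>2) ^ (r - k) * \<rho> ^ k))"
proof -
  define Z where "Z = (\<lambda>\<omega>. Y \<omega> - \<rho> * X \<omega>)"
  have Z: "Z \<in> G" using linear_spaceD[OF gaussian_space_linear[OF G] Y X, of 1 "- \<rho>"] by (simp add: Z_def)
  note fm = gaussian_space_finite_moments[OF G X] gaussian_space_finite_moments[OF G Y] gaussian_space_finite_moments[OF G Z]
  have int: "integrable M (\<lambda>\<omega>. X \<omega> * Y \<omega>)" "integrable M (\<lambda>\<omega>. (X \<omega>)\<^sup>2)"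
    using fm by (auto intro!: finite_moments_integrable)
  have "(\<lambda>\<omega>. X \<omega> * Z \<omega>) = (\<lambda>\<omega>. X \<omega> * Y \<omega> - \<rho> * (X \<omega>)\<^sup>2)"
    by (auto simp: Z_def power2_eq_square algebra_simps)
  then have orth: "expectation (\<lambda>\<omega>. X \<omega> * Z \<omega>) = 0"
    using int X1 \<rho> by simp
  have "expectation (\<lambda>\<omega>. (Z \<omega>)\<^sup>2) = 1 - \<rho>\<^sup>2"
    using expectation_power2_add[OF fm(2,1), of 1 "- \<rho>"] X1 Y1 \<rho>
    by (simp add: Z_def mult.commute[of "X _" "Y _"] power2_eq_square)
  then have powers: "expectation (\<lambda>\<omega>. X \<omega> ^ j * Z \<omega> ^ i) = mu j * (mu i * sqrt (1 - \<rho>\<^sup>2) ^ i)" for i j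
    using expectation_orthogonal_powers[OF G X Z orth, of j i] gaussian_space_moment[OF G X, of j]
      gaussian_space_moment[OF G Z, of i] X1 by simp
  have "expectation (\<lambda>\<omega>. X \<omega> ^ r * Y \<omega> ^ r) = expectation (\<lambda>\<omega>. X \<omega> ^ r * (Z \<omega> + \<rho> * X \<omega>) ^ r)"
    by (simp add: Z_def)
  also have "\<dots> = (\<Sum>k\<le>r. (real (r choose k) * expectation (\<lambda>\<omega>. X \<omega> ^ r * (X \<omega> ^ k * Z \<omega> ^ (r - k)))) * \<rho> ^ k)"
    using fm by (intro expectation_power_mult_add) auto
  also have "\<dots> = (\<Sum>k\<le>r. real (r choose k) * (mu (r + k) * mu (r - k)) * (sqrt (1 - \<rho>\<^sup>2) ^ (r - k) * \<rho> ^ k))"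
  proof (intro sum.cong refl)
    fix k
    have "(\<lambda>\<omega>. X \<omega> ^ r * (X \<omega> ^ k * Z \<omega> ^ (r - k))) = (\<lambda>\<omega>. X \<omega> ^ (r + k) * Z \<omega> ^ (r - k))"
      by (simp add: power_add mult.assoc)
    then show "(real (r choose k) * expectation (\<lambda>\<omega>. X \<omega> ^ r * (X \<omega> ^ k * Z \<omega> ^ (r - k)))) * \<rho> ^ k
        = real (r choose k) * (mu (r + k) * mu (r - k)) * (sqrt (1 - \<rho>\<^sup>2) ^ (r - k) * \<rho> ^ k)"
      by (simp add: powers)
  qed
  finally show ?thesis .
qed

lemma correlated_powers_bound:
  assumes G: "gaussian_space G" and X: "X \<in> G" and Y: "Y \<in> G"
    and X1: "expectation (\<lambda>\<omega>. (X \<omega>)\<^sup>2) = 1" and Y1: "expectation (\<lambda>\<omega>. (Y \<omega>)\<^sup>2) = 1"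
    and \<rho>: "expectation (\<lambda>\<omega>. X \<omega> * Y \<omega>) = \<rho>"
  shows "\<bar>expectation (\<lambda>\<omega>. X \<omega> ^ r * Y \<omega> ^ r) - (mu r)\<^sup>2\<bar> \<le> corr_const r * corr_size r \<rho>"
proof -
  note fm = gaussian_space_finite_moments[OF G X] gaussian_space_finite_moments[OF G Y]
  have "\<rho>\<^sup>2 \<le> 1" using Cauchy_Schwarz_expectation[OF fm] X1 Y1 \<rho> by simp
  then have \<rho>1: "\<bar>\<rho>\<bar> \<le> 1" by (simp add: abs_square_le_1)
  define s where "s = sqrt (1 - \<rho>\<^sup>2)"
  have s: "0 \<le> s" "s \<le> 1" using \<open>\<rho>\<^sup>2 \<le> 1\<close> by (auto simp: s_def)
  define t where "t k = real (r choose k) * (mu (r + k) * mu (r - k))" for k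
  have t: "0 \<le> t k" for k by (simp add: t_def mu_nonneg)
  have size: "0 \<le> corr_size r \<rho>" by (simp add: corr_size_def)
  have "expectation (\<lambda>\<omega>. X \<omega> ^ r * Y \<omega> ^ r) = (\<Sum>k\<in>insert 0 {1..r}. t k * (s ^ (r - k) * \<rho> ^ k))"
    unfolding expectation_correlated_powers[OF assms] t_def s_def by (intro sum.cong) auto
  also have "\<dots> = (mu r)\<^sup>2 * s ^ r + (\<Sum>k\<in>{1..r}. t k * (s ^ (r - k) * \<rho> ^ k))"
    by (subst sum.insert) (auto simp: t_def power2_eq_square)
  finally have eq: "expectation (\<lambda>\<omega>. X \<omega> ^ r * Y \<omega> ^ r) - (mu r)\<^sup>2
      = (mu r)\<^sup>2 * (s ^ r - 1) + (\<Sum>k\<in>{1..r}. t k * (s ^ (r - k) * \<rho> ^ k))"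
    by (simp add: algebra_simps)
  have first: "\<bar>(mu r)\<^sup>2 * (s ^ r - 1)\<bar> \<le> (real r * (mu r)\<^sup>2) * corr_size r \<rho>"
  proof (cases "even r")
    case True
    have "\<bar>(mu r)\<^sup>2 * (s ^ r - 1)\<bar> = (mu r)\<^sup>2 * \<bar>s ^ r - 1\<bar>" by (simp add: abs_mult)
    also have "\<dots> \<le> (mu r)\<^sup>2 * (real r * \<rho>\<^sup>2)"
      unfolding s_def by (intro mult_left_mono one_minus_sqrt_power_bound[OF \<rho>1 True]) auto
    finally show ?thesis using True by (simp add: corr_size_def mult_ac)
  qed (simp add: std_normal_moment_odd)
  have "\<bar>\<Sum>k\<in>{1..r}. t k * (s ^ (r - k) * \<rho> ^ k)\<bar> \<le> (\<Sum>k\<in>{1..r}. \<bar>t k * (s ^ (r - k) * \<rho> ^ k)\<bar>)"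
    by (rule sum_abs)
  also have "\<dots> \<le> (\<Sum>k\<in>{1..r}. t k * corr_size r \<rho>)"
  proof (intro sum_mono)
    fix k assume k: "k \<in> {1..r}"
    show "\<bar>t k * (s ^ (r - k) * \<rho> ^ k)\<bar> \<le> t k * corr_size r \<rho>"
    proof (cases "even r \<and> k < 2")
      case True
      \<comment> \<open>For even \<open>r\<close> the coefficient at \<open>k = 1\<close> contains
        the odd moment \<open>mu (r + 1)\<close>. This is why the linear term in
        \<open>\<rho>\<close> is absent.\<close>
      with k have "k = 1" by auto
      with True show ?thesis using size t[of k] by (simp add: t_def std_normal_moment_odd)
    next
      case False
      have "s ^ (r - k) \<le> 1" using s by (intro power_le_one)
      then have "s ^ (r - k) * \<bar>\<rho>\<bar> ^ k \<le> 1 * corr_size r \<rho>"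
        using False k s \<rho>1 by (intro mult_mono corr_size_power_bound) auto
      then have "t k * (s ^ (r - k) * \<bar>\<rho>\<bar> ^ k) \<le> t k * corr_size r \<rho>"
        using t[of k] by (intro mult_left_mono) auto
      then show ?thesis using t[of k] s by (simp add: abs_mult power_abs)
    qed
  qed
  also have "\<dots> = (\<Sum>k\<in>{1..r}. t k) * corr_size r \<rho>"
    by (simp only: sum_distrib_right)
  finally show ?thesis
    using first unfolding eq corr_const_def t_def[symmetric] distrib_right by linarith
qed

section \<open>Variance of sums of centered mixed powers\<close>

text \<open>Taking the full orthogonal complement of \<open>X\<close> reduces factoring out powers
  of \<open>X\<close> to checking covariances.\<close>

lemma normal_complement_orthogonal:
  assumes G: "gaussian_space G" and X: "X \<in> G" and X1: "expectation (\<lambda>\<omega>. (X \<omega>)\<^sup>2) = 1"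
  shows "normal_complement G {v\<in>G. expectation (\<lambda>\<omega>. X \<omega> * v \<omega>) = 0} X"
proof -
  note linG = gaussian_space_linear[OF G]
  have "expectation (\<lambda>\<omega>. X \<omega> * (a * u \<omega> + b * v \<omega>)) = 0"
    if "u \<in> G" "v \<in> G" "expectation (\<lambda>\<omega>. X \<omega> * u \<omega>) = 0" "expectation (\<lambda>\<omega>. X \<omega> * v \<omega>) = 0" for u v a b
  proof -
    note fm = gaussian_space_finite_moments[OF G]
    have "expectation (\<lambda>\<omega>. a * (X \<omega> * u \<omega>) + b * (X \<omega> * v \<omega>)) = 0"
      using that fm X by (subst expectation_lincomb) auto
    then show ?thesis by (simp add: algebra_simps)
  qed
  then have "linear_space {v\<in>G. expectation (\<lambda>\<omega>. X \<omega> * v \<omega>) = 0}"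
    using linG unfolding linear_space_def by auto
  then show ?thesis using assms by (auto simp: normal_complement_def)
qed

lemma expectation_power_split:
  assumes G: "gaussian_space G" and X: "X \<in> G" and X1: "expectation (\<lambda>\<omega>. (X \<omega>)\<^sup>2) = 1"
    and f: "poly_rv {v\<in>G. expectation (\<lambda>\<omega>. X \<omega> * v \<omega>) = 0} d f"
  shows "expectation (\<lambda>\<omega>. X \<omega> ^ k * f \<omega>) = mu k * expectation f"
  by (rule expectation_power_normal_complement[OF normal_complement_orthogonal[OF G X X1] f])

text \<open>\<open>X\<close> and then \<open>X'\<close> are orthogonal to everything else in the
  product, so their powers factor out as \<open>(mu p)\<^sup>2\<close> and only the correlated pair
  \<open>Y\<close>, \<open>Y'\<close> remains.\<close>

lemma mixed_power_covariance:
  assumes G: "gaussian_space G" and mem: "X \<in> G" "X' \<in> G" "Y \<in> G" "Y' \<in> G"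
    and var: "expectation (\<lambda>\<omega>. (X \<omega>)\<^sup>2) = 1" "expectation (\<lambda>\<omega>. (X' \<omega>)\<^sup>2) = 1"
      "expectation (\<lambda>\<omega>. (Y \<omega>)\<^sup>2) = 1" "expectation (\<lambda>\<omega>. (Y' \<omega>)\<^sup>2) = 1"
    and orth: "expectation (\<lambda>\<omega>. X \<omega> * X' \<omega>) = 0" "expectation (\<lambda>\<omega>. X \<omega> * Y \<omega>) = 0"
      "expectation (\<lambda>\<omega>. X \<omega> * Y' \<omega>) = 0" "expectation (\<lambda>\<omega>. X' \<omega> * Y \<omega>) = 0"
      "expectation (\<lambda>\<omega>. X' \<omega> * Y' \<omega>) = 0"
    and \<rho>: "expectation (\<lambda>\<omega>. Y \<omega> * Y' \<omega>) = \<rho>"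
  shows "\<bar>expectation (\<lambda>\<omega>. (X \<omega> ^ p * Y \<omega> ^ r - mu p * mu r) * (X' \<omega> ^ p * Y' \<omega> ^ r - mu p * mu r))\<bar>
    \<le> (mu p)\<^sup>2 * (corr_const r * corr_size r \<rho>)"
proof -
  note fm = gaussian_space_finite_moments[OF G mem(1)] gaussian_space_finite_moments[OF G mem(2)]
    gaussian_space_finite_moments[OF G mem(3)] gaussian_space_finite_moments[OF G mem(4)]
  have pow: "poly_rv V (1 * k) (\<lambda>\<omega>. v \<omega> ^ k)" if "v \<in> V" for v V k
    using that by (intro poly_rv_power poly_rv_var)
  have EX: "expectation (\<lambda>\<omega>. X \<omega> ^ p * Y \<omega> ^ r) = mu p * mu r"
    using expectation_power_split[OF G mem(1) var(1) pow[of Y _ r], of p] orth mem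
      gaussian_space_moment[OF G mem(3), of r] var by simp
  have EX': "expectation (\<lambda>\<omega>. X' \<omega> ^ p * Y' \<omega> ^ r) = mu p * mu r"
    using expectation_power_split[OF G mem(2) var(2) pow[of Y' _ r], of p] orth mem
      gaussian_space_moment[OF G mem(4), of r] var by simp
  have "expectation (\<lambda>\<omega>. X \<omega> ^ p * (X' \<omega> ^ p * (Y \<omega> ^ r * Y' \<omega> ^ r)))
      = mu p * expectation (\<lambda>\<omega>. X' \<omega> ^ p * (Y \<omega> ^ r * Y' \<omega> ^ r))"
    using orth mem by (intro expectation_power_split[OF G mem(1) var(1), where d = "1 * p + (1 * r + 1 * r)"] poly_rv_mult pow) auto
  also have "expectation (\<lambda>\<omega>. X' \<omega> ^ p * (Y \<omega> ^ r * Y' \<omega> ^ r)) = mu p * expectation (\<lambda>\<omega>. Y \<omega> ^ r * Y' \<omega> ^ r)"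
    using orth mem by (intro expectation_power_split[OF G mem(2) var(2), where d = "1 * r + 1 * r"] poly_rv_mult pow) auto
  finally have EXX: "expectation (\<lambda>\<omega>. X \<omega> ^ p * (X' \<omega> ^ p * (Y \<omega> ^ r * Y' \<omega> ^ r)))
      = (mu p)\<^sup>2 * expectation (\<lambda>\<omega>. Y \<omega> ^ r * Y' \<omega> ^ r)" by (simp add: power2_eq_square)
  have int: "integrable M (\<lambda>\<omega>. X \<omega> ^ p * (X' \<omega> ^ p * (Y \<omega> ^ r * Y' \<omega> ^ r)))"
    "integrable M (\<lambda>\<omega>. X \<omega> ^ p * Y \<omega> ^ r)" "integrable M (\<lambda>\<omega>. X' \<omega> ^ p * Y' \<omega> ^ r)"
    using fm by (auto intro!: finite_moments_integrable)
  let ?c = "mu p * mu r"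
  have "(\<lambda>\<omega>. (X \<omega> ^ p * Y \<omega> ^ r - ?c) * (X' \<omega> ^ p * Y' \<omega> ^ r - ?c))
      = (\<lambda>\<omega>. X \<omega> ^ p * (X' \<omega> ^ p * (Y \<omega> ^ r * Y' \<omega> ^ r)) - ?c * (X \<omega> ^ p * Y \<omega> ^ r) - ?c * (X' \<omega> ^ p * Y' \<omega> ^ r) + ?c * ?c)"
    by (auto simp: algebra_simps)
  then have "expectation (\<lambda>\<omega>. (X \<omega> ^ p * Y \<omega> ^ r - ?c) * (X' \<omega> ^ p * Y' \<omega> ^ r - ?c))
     = (mu p)\<^sup>2 * expectation (\<lambda>\<omega>. Y \<omega> ^ r * Y' \<omega> ^ r) - ?c * ?c - ?c * ?c + ?c * ?c"
    using int by (simp add: EXX EX EX' prob_space)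
  also have "\<dots> = (mu p)\<^sup>2 * (expectation (\<lambda>\<omega>. Y \<omega> ^ r * Y' \<omega> ^ r) - (mu r)\<^sup>2)"
    by (simp add: power2_eq_square algebra_simps)
  finally show ?thesis
    using correlated_powers_bound[OF G mem(3,4) var(3,4) \<rho>, of r]
    by (simp add: abs_mult mult_left_mono)
qed

lemma mixed_power_variance:
  assumes G: "gaussian_space G" and mem: "X \<in> G" "Y \<in> G"
    and var: "expectation (\<lambda>\<omega>. (X \<omega>)\<^sup>2) = 1" "expectation (\<lambda>\<omega>. (Y \<omega>)\<^sup>2) = 1"
    and orth: "expectation (\<lambda>\<omega>. X \<omega> * Y \<omega>) = 0"
  shows "expectation (\<lambda>\<omega>. (X \<omega> ^ p * Y \<omega> ^ r - mu p * mu r) * (X \<omega> ^ p * Y \<omega> ^ r - mu p * mu r))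
    \<le> mu (2 * p) * mu (2 * r)"
proof -
  note fm = gaussian_space_finite_moments[OF G mem(1)] gaussian_space_finite_moments[OF G mem(2)]
  have E: "expectation (\<lambda>\<omega>. X \<omega> ^ k * Y \<omega> ^ l) = mu k * mu l" for k l
    using expectation_orthogonal_powers[OF G mem orth, of k l] gaussian_space_moment[OF G mem(1), of k]
      gaussian_space_moment[OF G mem(2), of l] var by simp
  let ?c = "mu p * mu r"
  have int: "integrable M (\<lambda>\<omega>. X \<omega> ^ (2 * p) * Y \<omega> ^ (2 * r))" "integrable M (\<lambda>\<omega>. X \<omega> ^ p * Y \<omega> ^ r)"
    using fm by (auto intro!: finite_moments_integrable)
  have "(\<lambda>\<omega>. (X \<omega> ^ p * Y \<omega> ^ r - ?c) * (X \<omega> ^ p * Y \<omega> ^ r - ?c))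
      = (\<lambda>\<omega>. X \<omega> ^ (2 * p) * Y \<omega> ^ (2 * r) - (2 * ?c) * (X \<omega> ^ p * Y \<omega> ^ r) + ?c * ?c)"
    by (simp only: power_even_eq power2_eq_square) (auto simp: algebra_simps)
  then have "expectation (\<lambda>\<omega>. (X \<omega> ^ p * Y \<omega> ^ r - ?c) * (X \<omega> ^ p * Y \<omega> ^ r - ?c))
     = mu (2 * p) * mu (2 * r) - (2 * ?c) * ?c + ?c * ?c"
    using int by (simp add: E prob_space)
  also have "\<dots> \<le> mu (2 * p) * mu (2 * r)" using zero_le_square[of ?c] by linarith
  finally show ?thesis .
qed

lemma expectation_square_sum:
  assumes "\<And>i. i < n \<Longrightarrow> finite_moments (f i)"
  shows "expectation (\<lambda>\<omega>. (\<Sum>i<n. f i \<omega>)\<^sup>2) = (\<Sum>i<n. \<Sum>j<n. expectation (\<lambda>\<omega>. f i \<omega> * f j \<omega>))"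
proof -
  have int: "integrable M (\<lambda>\<omega>. f i \<omega> * f j \<omega>)" if "i < n" "j < n" for i j
    using assms that by (auto intro!: finite_moments_integrable)
  have "(\<lambda>\<omega>. (\<Sum>i<n. f i \<omega>)\<^sup>2) = (\<lambda>\<omega>. \<Sum>i<n. \<Sum>j<n. f i \<omega> * f j \<omega>)"
    by (simp add: power2_eq_square sum_product)
  then have "expectation (\<lambda>\<omega>. (\<Sum>i<n. f i \<omega>)\<^sup>2) = (\<Sum>i<n. expectation (\<lambda>\<omega>. \<Sum>j<n. f i \<omega> * f j \<omega>))"
    using int by (simp only:) (intro Bochner_Integration.integral_sum Bochner_Integration.integrable_sum; simp)
  also have "\<dots> = (\<Sum>i<n. \<Sum>j<n. expectation (\<lambda>\<omega>. f i \<omega> * f j \<omega>))"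
    using int by (intro sum.cong refl Bochner_Integration.integral_sum) auto
  finally show ?thesis .
qed

section \<open>From moments to almost sure convergence\<close>

text \<open>The series of even powers has finite expectation, by exchange of sum and integral. Hence
  it converges almost surely and its terms tend to zero.\<close>

lemma AE_tendsto_0_moments:
  assumes fm: "\<And>n. finite_moments (f n)" and m: "0 < m"
    and sum: "summable (\<lambda>n. expectation (\<lambda>\<omega>. f n \<omega> ^ (2 * m)))"
  shows "AE \<omega> in M. (\<lambda>n. f n \<omega>) \<longlonglongrightarrow> 0"
proof -
  let ?g = "\<lambda>n \<omega>. f n \<omega> ^ (2 * m)"
  have nonneg: "0 \<le> ?g n \<omega>" for n \<omega> by (simp add: power_mult)
  have int: "integrable M (?g n)" for n using fm by (auto simp: finite_moments_def)
  have "(\<integral>\<^sup>+ \<omega>. (\<Sum>n. ennreal (?g n \<omega>)) \<partial>M) = (\<Sum>n. \<integral>\<^sup>+ \<omega>. ennreal (?g n \<omega>) \<partial>M)"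
    using int by (intro nn_integral_suminf) (auto intro: borel_measurable_integrable measurable_compose[OF _ measurable_ennreal])
  also have "\<dots> = (\<Sum>n. ennreal (expectation (?g n)))"
    using int nonneg by (intro suminf_cong nn_integral_eq_integral) auto
  also have "\<dots> = ennreal (\<Sum>n. expectation (?g n))"
    using sum nonneg by (intro suminf_ennreal2) auto
  finally have "(\<integral>\<^sup>+ \<omega>. (\<Sum>n. ennreal (?g n \<omega>)) \<partial>M) \<noteq> \<infinity>" by simp
  moreover have "(\<lambda>\<omega>. \<Sum>n. ennreal (?g n \<omega>)) \<in> borel_measurable M"
    using int by (intro borel_measurable_suminf_order) (auto intro: measurable_compose[OF _ measurable_ennreal])
  ultimately have "AE \<omega> in M. (\<Sum>n. ennreal (?g n \<omega>)) \<noteq> \<infinity>" by (rule nn_integral_PInf_AE[rotated])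
  then show ?thesis
  proof eventually_elim
    case (elim \<omega>)
    then have "summable (\<lambda>n. ?g n \<omega>)"
      by (intro summable_suminf_not_top[OF nonneg]) (simp only: infinity_ennreal_def not_False_eq_True)
    then have "(\<lambda>n. \<bar>f n \<omega>\<bar> ^ (2 * m)) \<longlonglongrightarrow> 0"
      using summable_LIMSEQ_zero by (simp add: power_mult)
    then have "(\<lambda>n. root (2 * m) (\<bar>f n \<omega>\<bar> ^ (2 * m))) \<longlonglongrightarrow> root (2 * m) 0"
      by (rule tendsto_real_root)
    then have "(\<lambda>n. \<bar>f n \<omega>\<bar>) \<longlonglongrightarrow> 0"
      using m by (simp add: real_root_power_cancel)
    then show ?case by (rule tendsto_rabs_zero_cancel)
  qed
qed

lemma AE_smallo_of_variance:
  assumes G: "\<And>n. 1 \<le> n \<Longrightarrow> gaussian_space (G n)" and S: "\<And>n. 1 \<le> n \<Longrightarrow> poly_rv (G n) d (S n)"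
    and var: "\<And>n. 1 \<le> n \<Longrightarrow> expectation (\<lambda>\<omega>. (S n \<omega>)\<^sup>2) \<le> D * real n powr (2 * \<gamma> + \<epsilon>)"
    and D: "0 \<le> D" and \<epsilon>: "0 < \<epsilon>"
  shows "AE \<omega> in M. (\<lambda>n. S n \<omega>) \<in> o(\<lambda>n. real n powr (\<gamma> + \<epsilon>))"
proof -
  obtain C :: "nat \<Rightarrow> nat \<Rightarrow> real" where C: "\<And>j d. 0 \<le> C j d"
    and moment: "\<And>G j d f. gaussian_space G \<Longrightarrow> poly_rv G d f \<Longrightarrow>
      expectation (\<lambda>\<omega>. f \<omega> ^ (2 * 2 ^ j)) \<le> C j d * (expectation (\<lambda>\<omega>. (f \<omega>)\<^sup>2)) ^ (2 ^ j)"
    by (rule gaussian_moment_bound) blast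
  \<comment> \<open>The moment of order \<open>2 * 2 ^ j\<close> of the normalised variable is of
    order \<open>n powr (- \<epsilon> * 2 ^ j)\<close>; \<open>j\<close> brings this below the
    summable rate \<open>n powr - 2\<close>.\<close>
  obtain j :: nat where "2 / \<epsilon> < 2 ^ j"
    using real_arch_pow[of 2 "2 / \<epsilon>"] by auto
  then have j: "2 \<le> \<epsilon> * 2 ^ j" using \<epsilon> by (simp add: field_simps)
  \<comment> \<open>Nothing is assumed about \<open>S 0\<close>, so index \<open>0\<close> is given
    the value zero to make all terms of the series meaningful.\<close>
  define f where "f n = (if n = 0 then (\<lambda>_. 0) else (\<lambda>\<omega>. (1 / real n powr (\<gamma> + \<epsilon>)) * S n \<omega>))" for n
  have fmS: "finite_moments (S n)" if "1 \<le> n" for n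
    using poly_rv_finite_moments[OF S[OF that]] gaussian_space_finite_moments[OF G[OF that]] by blast
  have fm: "finite_moments (f n)" for n
    using finite_moments_mult[OF finite_moments_const[of "1 / real n powr (\<gamma> + \<epsilon>)"] fmS[of n]]
    by (cases "n = 0") (simp_all add: f_def)
  let ?J = "2 ^ j :: nat"
  have bound: "expectation (\<lambda>\<omega>. f n \<omega> ^ (2 * ?J)) \<le> C j d * D ^ ?J * real n powr - 2" for n
  proof (cases "n = 0")
    case False
    then have n: "1 \<le> n" by simp
    have "expectation (\<lambda>\<omega>. f n \<omega> ^ (2 * ?J)) = (1 / real n powr (\<gamma> + \<epsilon>)) ^ (2 * ?J) * expectation (\<lambda>\<omega>. S n \<omega> ^ (2 * ?J))"
      using False by (simp only: f_def if_False power_mult_distrib integral_mult_right_zero)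
    also have "\<dots> \<le> (1 / real n powr (\<gamma> + \<epsilon>)) ^ (2 * ?J) * (C j d * (D * real n powr (2 * \<gamma> + \<epsilon>)) ^ ?J)"
    proof (intro mult_left_mono)
      have "expectation (\<lambda>\<omega>. S n \<omega> ^ (2 * ?J)) \<le> C j d * (expectation (\<lambda>\<omega>. (S n \<omega>)\<^sup>2)) ^ ?J"
        by (rule moment[OF G[OF n] S[OF n]])
      also have "\<dots> \<le> C j d * (D * real n powr (2 * \<gamma> + \<epsilon>)) ^ ?J"
        using C var[OF n] by (intro mult_left_mono power_mono) auto
      finally show "expectation (\<lambda>\<omega>. S n \<omega> ^ (2 * ?J)) \<le> C j d * (D * real n powr (2 * \<gamma> + \<epsilon>)) ^ ?J" .
    qed simp
    also have "\<dots> = C j d * D ^ ?J * (real n powr (2 * \<gamma> + \<epsilon>) * (1 / real n powr (\<gamma> + \<epsilon>)) ^ 2) ^ ?J"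
      by (simp add: power_mult power_mult_distrib)
    also have "real n powr (2 * \<gamma> + \<epsilon>) * (1 / real n powr (\<gamma> + \<epsilon>)) ^ 2 = real n powr - \<epsilon>"
    proof -
      have "(1 / real n powr (\<gamma> + \<epsilon>)) ^ 2 = real n powr (- (\<gamma> + \<epsilon>) + - (\<gamma> + \<epsilon>))"
        unfolding powr_add powr_minus by (simp add: power2_eq_square field_simps)
      then show ?thesis by (simp flip: powr_add)
    qed
    also have "(real n powr - \<epsilon>) ^ ?J = real n powr (- \<epsilon> * real ?J)"
      using n by (simp add: powr_powr flip: powr_realpow)
    also have "C j d * D ^ ?J * real n powr (- \<epsilon> * real ?J) \<le> C j d * D ^ ?J * real n powr - 2"
      using j n C D by (intro mult_left_mono powr_mono) auto
    finally show ?thesis .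
  qed (simp add: f_def power_0_left)
  have "summable (\<lambda>n. expectation (\<lambda>\<omega>. f n \<omega> ^ (2 * ?J)))"
  proof (rule summable_comparison_test[OF _ summable_mult[of "\<lambda>n. real n powr - 2" "C j d * D ^ ?J"]])
    show "summable (\<lambda>n. real n powr - 2)" by (simp add: summable_real_powr_iff)
    have "0 \<le> expectation (\<lambda>\<omega>. f n \<omega> ^ (2 * ?J))" for n by (simp add: power_mult)
    then show "\<exists>N. \<forall>n\<ge>N. norm (expectation (\<lambda>\<omega>. f n \<omega> ^ (2 * ?J))) \<le> C j d * D ^ ?J * real n powr - 2"
      using bound by simp
  qed
  from AE_tendsto_0_moments[OF fm _ this] have "AE \<omega> in M. (\<lambda>n. f n \<omega>) \<longlonglongrightarrow> 0" by simp
  then show ?thesis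
  proof eventually_elim
    case (elim \<omega>)
    have "\<forall>\<^sub>F n in sequentially. f n \<omega> = S n \<omega> / real n powr (\<gamma> + \<epsilon>)"
      using eventually_gt_at_top[of 0] by eventually_elim (simp add: f_def)
    then have "(\<lambda>n. S n \<omega> / real n powr (\<gamma> + \<epsilon>)) \<longlonglongrightarrow> 0"
      using elim by (simp add: tendsto_cong)
    then show ?case
      by (rule smalloI_tendsto) (use eventually_gt_at_top[of 0] in \<open>eventually_elim, simp\<close>)
  qed
qed

end

section \<open>Power sums and second differences\<close>

text \<open>Two applications of the mean value theorem give
  \<open>a * (a - 1) * w powr (a - 2)\<close> with \<open>w\<close> between \<open>k - 1\<close> and
  \<open>k + 1\<close>. The constant is \<open>2 * 4\<close>: \<open>a * \<bar>a - 1\<bar>\<close>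
  is at most \<open>2\<close>, and \<open>w \<ge> k / 2\<close> costs at most
  \<open>2 powr (2 - a) \<le> 4\<close>.\<close>

lemma powr_second_difference_bound:
  fixes a :: real and k :: nat
  assumes a: "0 < a" "a < 2" and k: "1 \<le> k"
  shows "\<bar>(real k + 1) powr a + (real k - 1) powr a - 2 * real k powr a\<bar> \<le> 8 * real k powr (a - 2)"
proof (cases "k = 1")
  \<comment> \<open>Here the interval for \<open>w\<close> would reach \<open>0\<close>, where the
    negative power is unbounded; the value \<open>2 powr a - 2\<close> is estimated
    directly.\<close>
  case True
  have "2 powr a \<le> 2 powr 2" "2 powr 0 \<le> 2 powr a" using a by (intro powr_mono; simp)+
  then show ?thesis using True by simp
next
  case False
  with k have k2: "2 \<le> real k" by simp
  let ?g = "\<lambda>t. (t + 1) powr a - t powr a"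
  have "\<exists>z. real k - 1 < z \<and> z < real k \<and>
      ?g (real k) - ?g (real k - 1) = (real k - (real k - 1)) * (a * (z + 1) powr (a - 1) - a * z powr (a - 1))"
    using k2 by (intro MVT2) (auto intro!: derivative_eq_intros)
  then obtain z where z: "real k - 1 < z" "z < real k"
    and g: "?g (real k) - ?g (real k - 1) = a * ((z + 1) powr (a - 1) - z powr (a - 1))"
    by (auto simp: algebra_simps)
  have "\<exists>w. z < w \<and> w < z + 1 \<and>
      (z + 1) powr (a - 1) - z powr (a - 1) = (z + 1 - z) * ((a - 1) * w powr (a - 1 - 1))"
    using k2 z by (intro MVT2) (auto intro!: derivative_eq_intros)
  then obtain w where w: "z < w"
    and h: "(z + 1) powr (a - 1) - z powr (a - 1) = (a - 1) * w powr (a - 2)"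
    by auto
  have "w powr (a - 2) \<le> (real k / 2) powr (a - 2)"
    using a k2 z w by (intro powr_mono2') auto
  also have "\<dots> = real k powr (a - 2) * 2 powr (2 - a)"
    using k2 by (simp add: powr_divide powr_diff)
  also have "\<dots> \<le> real k powr (a - 2) * 2 powr 2"
    using a by (intro mult_left_mono powr_mono) auto
  finally have w4: "w powr (a - 2) \<le> 4 * real k powr (a - 2)" by simp
  have "\<bar>(real k + 1) powr a + (real k - 1) powr a - 2 * real k powr a\<bar> = \<bar>?g (real k) - ?g (real k - 1)\<bar>"
    by simp
  also have "\<dots> = a * \<bar>a - 1\<bar> * w powr (a - 2)"
    unfolding g h using a by (simp add: abs_mult)
  also have "\<dots> \<le> 2 * 1 * (4 * real k powr (a - 2))"
    using a w4 by (intro mult_mono) auto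
  finally show ?thesis by simp
qed

text \<open>Splitting off the summable factor \<open>k powr (- 1 - \<epsilon>)\<close> and bounding
  the rest at \<open>k = n\<close> treats decay faster than, equal to and slower than
  \<open>1 / k\<close> in one estimate. The two conditions on \<open>\<gamma>\<close> match the two
  branches of the maximum.\<close>

lemma sum_powr_bound:
  assumes \<epsilon>: "0 < \<epsilon>" and n: "1 \<le> n" and \<gamma>: "1 \<le> 2 * \<gamma>" "2 - \<alpha> \<le> 2 * \<gamma>"
  shows "real n * (\<Sum>k\<in>{1..n}. real k powr - \<alpha>) \<le> (\<Sum>k. real k powr (- 1 - \<epsilon>)) * real n powr (2 * \<gamma> + \<epsilon>)"
proof -
  let ?s = "\<Sum>k. real k powr (- 1 - \<epsilon>)" and ?m = "max 0 (1 + \<epsilon> - \<alpha>)"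
  have sum: "summable (\<lambda>k. real k powr (- 1 - \<epsilon>))" using \<epsilon> by (simp add: summable_real_powr_iff)
  have "(\<Sum>k\<in>{1..n}. real k powr - \<alpha>) \<le> (\<Sum>k\<in>{1..n}. real k powr (- 1 - \<epsilon>) * real n powr ?m)"
  proof (intro sum_mono)
    fix k assume k: "k \<in> {1..n}"
    have "real k powr (1 + \<epsilon> - \<alpha>) \<le> real k powr ?m" using k by (intro powr_mono) auto
    also have "\<dots> \<le> real n powr ?m" using k by (intro powr_mono2) auto
    finally have "real k powr (- 1 - \<epsilon>) * real k powr (1 + \<epsilon> - \<alpha>) \<le> real k powr (- 1 - \<epsilon>) * real n powr ?m"
      by (intro mult_left_mono) auto
    then show "real k powr - \<alpha> \<le> real k powr (- 1 - \<epsilon>) * real n powr ?m"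
      by (simp flip: powr_add)
  qed
  also have "\<dots> = (\<Sum>k\<in>{1..n}. real k powr (- 1 - \<epsilon>)) * real n powr ?m"
    by (simp add: sum_distrib_right)
  also have "\<dots> \<le> ?s * real n powr ?m"
    using sum by (intro mult_right_mono sum_le_suminf) auto
  finally have "real n * (\<Sum>k\<in>{1..n}. real k powr - \<alpha>) \<le> real n * (?s * real n powr ?m)"
    by (intro mult_left_mono) auto
  also have "\<dots> = ?s * real n powr (1 + ?m)"
    using n by (simp add: powr_add)
  also have "\<dots> \<le> ?s * real n powr (2 * \<gamma> + \<epsilon>)"
    using n \<gamma> \<epsilon> sum by (intro mult_left_mono powr_mono suminf_nonneg) auto
  finally show ?thesis .
qed

text \<open>Each distance from \<open>i\<close> is attained at most twice, once on either
  side.\<close>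

lemma sum_distance_bound:
  fixes g :: "nat \<Rightarrow> real"
  assumes g: "\<And>k. 0 \<le> g k" and i: "i < n"
  shows "(\<Sum>j\<in>{..<n} - {i}. g (if i \<le> j then j - i else i - j)) \<le> 2 * (\<Sum>k\<in>{1..n}. g k)"
proof -
  let ?d = "\<lambda>j. if i \<le> j then j - i else i - j"
  have disjoint: "{..<i} \<inter> {i<..<n} = {}" by auto
  have "{..<n} - {i} = {..<i} \<union> {i<..<n}" using i by auto
  then have "(\<Sum>j\<in>{..<n} - {i}. g (?d j)) = (\<Sum>j\<in>{..<i}. g (?d j)) + (\<Sum>j\<in>{i<..<n}. g (?d j))"
    by (simp only: sum.union_disjoint[OF finite_lessThan finite_greaterThanLessThan] disjoint)
  also have "(\<Sum>j\<in>{..<i}. g (?d j)) = (\<Sum>k\<in>{1..i}. g k)"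
    by (rule sum.reindex_bij_witness[of _ "\<lambda>k. i - k" "\<lambda>j. i - j"]) auto
  also have "\<dots> \<le> (\<Sum>k\<in>{1..n}. g k)" using i g by (intro sum_mono2) auto
  also have "(\<Sum>j\<in>{i<..<n}. g (?d j)) = (\<Sum>k\<in>{1..<n - i}. g k)"
    by (rule sum.reindex_bij_witness[of _ "\<lambda>k. i + k" "\<lambda>j. j - i"]) auto
  also have "\<dots> \<le> (\<Sum>k\<in>{1..n}. g k)" using g by (intro sum_mono2) auto
  finally show ?thesis by simp
qed

section \<open>The Gaussian space of the increments\<close>

context prob_space
begin

text \<open>The condition that \<open>gaussian_space\<close> imposes on each single element.
  Isolated, it can be propagated through scaling and independent sums before any linear space is
  formed.\<close>

definition gaussian_moments :: "('a \<Rightarrow> real) \<Rightarrow> bool" where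
  "gaussian_moments X \<longleftrightarrow> finite_moments X \<and>
     (\<forall>k. expectation (\<lambda>\<omega>. X \<omega> ^ k) = mu k * sqrt (expectation (\<lambda>\<omega>. (X \<omega>)\<^sup>2)) ^ k)"

lemma gaussian_momentsD:
  assumes "gaussian_moments X"
  shows "finite_moments X"
    and "expectation (\<lambda>\<omega>. X \<omega> ^ k) = mu k * sqrt (expectation (\<lambda>\<omega>. (X \<omega>)\<^sup>2)) ^ k"
  using assms unfolding gaussian_moments_def by blast+

lemma gaussian_moments_mean: "gaussian_moments X \<Longrightarrow> expectation X = 0"
  using gaussian_momentsD(2)[of X 1] by simp

lemma normal_moment:
  assumes X: "distributed M lborel X (normal_density 0 s)" and s: "0 < s"
  shows "integrable M (\<lambda>\<omega>. X \<omega> ^ k)" and "expectation (\<lambda>\<omega>. X \<omega> ^ k) = mu k * s ^ k"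
proof -
  have int: "integrable lborel (\<lambda>x. normal_density 0 s x * x ^ k)"
    using integrable_normal_moment[OF s, of 0 k] by simp
  then show "integrable M (\<lambda>\<omega>. X \<omega> ^ k)"
    by (subst (asm) distributed_integrable[OF X]) auto
  have "expectation (\<lambda>\<omega>. X \<omega> ^ k) = (\<integral>x. normal_density 0 s x * x ^ k \<partial>lborel)"
    by (subst distributed_integral[OF X]) auto
  also have "\<dots> = mu k * s ^ k"
  proof (cases "even k")
    case True
    then obtain j where k: "k = 2 * j" by (elim evenE)
    show ?thesis
      using integral_normal_moment_even[OF s, of 0 j] s
      by (simp add: k mu_even_fact power_divide power_mult)
  next
    case False
    then obtain j where k: "k = 2 * j + 1" by (elim oddE)
    show ?thesis
      using integral_normal_moment_odd[OF s, of 0 j] by (simp add: k std_normal_moment_odd)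
  qed
  finally show "expectation (\<lambda>\<omega>. X \<omega> ^ k) = mu k * s ^ k" .
qed

lemma gaussian_moments_normal:
  assumes X: "distributed M lborel X (normal_density 0 s)" and s: "0 < s"
  shows "gaussian_moments X" and "expectation (\<lambda>\<omega>. (X \<omega>)\<^sup>2) = s\<^sup>2"
proof -
  show var: "expectation (\<lambda>\<omega>. (X \<omega>)\<^sup>2) = s\<^sup>2" using normal_moment(2)[OF X s, of 2] by simp
  have "random_variable borel X" using distributed_measurable[OF X] by simp
  then show "gaussian_moments X"
    using normal_moment[OF X s] s unfolding gaussian_moments_def finite_moments_def var by simp
qed

lemma gaussian_moments_AE_zero:
  assumes X: "random_variable borel X" and zero: "AE \<omega> in M. X \<omega> = 0"
  shows "gaussian_moments X"
proof -
  have eq: "AE \<omega> in M. X \<omega> ^ k = 0 ^ k" for k using zero by eventually_elim simp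
  have "integrable M (\<lambda>\<omega>. X \<omega> ^ k)" for k
    using integrable_cong_AE[of "\<lambda>\<omega>. X \<omega> ^ k" M "\<lambda>_. 0 ^ k"] eq X by simp
  moreover have E: "expectation (\<lambda>\<omega>. X \<omega> ^ k) = 0 ^ k" for k
    using integral_cong_AE[of "\<lambda>\<omega>. X \<omega> ^ k" M "\<lambda>_. 0 ^ k"] eq X by (simp add: prob_space)
  ultimately show ?thesis
    using X by (auto simp: gaussian_moments_def finite_moments_def power_0_left)
qed

lemma gaussian_variable_moments:
  assumes X: "gaussian_variable X" and mean: "expectation X = 0"
  shows "gaussian_moments X"
proof -
  have meas: "random_variable borel X" using X by (simp add: gaussian_variable_def)
  from X consider (const) m where "AE \<omega> in M. X \<omega> = m"
    | (normal) m s where "0 < s" "distributed M lborel X (normal_density m s)"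
    unfolding gaussian_variable_def by blast
  then show ?thesis
  proof cases
    case const
    then have "expectation X = expectation (\<lambda>_. m)" using meas by (intro integral_cong_AE) auto
    then have "m = 0" using mean by (simp add: prob_space)
    then show ?thesis using const meas by (intro gaussian_moments_AE_zero) auto
  next
    case normal
    then have "m = 0" using normal_distributed_expectation mean by blast
    then show ?thesis using normal by (auto intro: gaussian_moments_normal)
  qed
qed

lemma gaussian_moments_scale:
  assumes X: "gaussian_moments X"
  shows "gaussian_moments (\<lambda>\<omega>. c * X \<omega>)"
  unfolding gaussian_moments_def
proof (intro conjI allI)
  show "finite_moments (\<lambda>\<omega>. c * X \<omega>)" using gaussian_momentsD(1)[OF X] by auto
  fix k
  \<comment> \<open>The sign of \<open>c\<close> is lost in the standard deviation, which is
    consistent because odd moments vanish.\<close>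
  have "c ^ k * mu k = \<bar>c\<bar> ^ k * mu k"
    by (cases "even k") (simp_all add: std_normal_moment_odd power_even_abs)
  moreover have "sqrt (expectation (\<lambda>\<omega>. (c * X \<omega>)\<^sup>2)) = \<bar>c\<bar> * sqrt (expectation (\<lambda>\<omega>. (X \<omega>)\<^sup>2))"
    by (simp add: power_mult_distrib real_sqrt_mult)
  moreover have "expectation (\<lambda>\<omega>. (c * X \<omega>) ^ k) = (c ^ k * mu k) * sqrt (expectation (\<lambda>\<omega>. (X \<omega>)\<^sup>2)) ^ k"
    unfolding power_mult_distrib integral_mult_right_zero gaussian_momentsD(2)[OF X, of k] by (simp only: mult.assoc)
  ultimately show "expectation (\<lambda>\<omega>. (c * X \<omega>) ^ k) = mu k * sqrt (expectation (\<lambda>\<omega>. (c * X \<omega>)\<^sup>2)) ^ k"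
    by (simp only: power_mult_distrib mult_ac)
qed

lemma expectation_indep_powers:
  assumes X: "finite_moments X" and Y: "finite_moments Y" and indep: "indep_var borel X borel Y"
  shows "expectation (\<lambda>\<omega>. X \<omega> ^ i * Y \<omega> ^ j) = expectation (\<lambda>\<omega>. X \<omega> ^ i) * expectation (\<lambda>\<omega>. Y \<omega> ^ j)"
proof (rule indep_var_lebesgue_integral)
  have "indep_var borel ((\<lambda>x. x ^ i) \<circ> X) borel ((\<lambda>x. x ^ j) \<circ> Y)"
    using indep by (rule indep_var_compose) auto
  then show "indep_var borel (\<lambda>\<omega>. X \<omega> ^ i) borel (\<lambda>\<omega>. Y \<omega> ^ j)" by (simp add: comp_def)
qed (use X Y in \<open>auto simp: finite_moments_def\<close>)

text \<open>Independence factors the terms of the binomial expansion, and \<open>mu_binomial\<close>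
  sums them again. Degenerate summands are covered as well.\<close>

lemma gaussian_moments_add:
  assumes X: "gaussian_moments X" and Y: "gaussian_moments Y" and indep: "indep_var borel X borel Y"
  shows "gaussian_moments (\<lambda>\<omega>. X \<omega> + Y \<omega>)"
  unfolding gaussian_moments_def
proof (intro conjI allI)
  note fm = gaussian_momentsD(1)[OF X] gaussian_momentsD(1)[OF Y]
  show "finite_moments (\<lambda>\<omega>. X \<omega> + Y \<omega>)" using fm by auto
  fix k
  let ?x = "expectation (\<lambda>\<omega>. (X \<omega>)\<^sup>2)" and ?y = "expectation (\<lambda>\<omega>. (Y \<omega>)\<^sup>2)"
  have "expectation (\<lambda>\<omega>. X \<omega> * Y \<omega>) = 0"
    using expectation_indep_powers[OF fm indep, of 1 1] gaussian_moments_mean[OF X] by simp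
  then have var: "expectation (\<lambda>\<omega>. (X \<omega> + Y \<omega>)\<^sup>2) = (sqrt ?y)\<^sup>2 + (sqrt ?x)\<^sup>2"
    using expectation_power2_add[OF fm, of 1 1] by simp
  have "expectation (\<lambda>\<omega>. (X \<omega> + Y \<omega>) ^ k)
      = (\<Sum>j\<le>k. real (k choose j) * expectation (\<lambda>\<omega>. Y \<omega> ^ j * X \<omega> ^ (k - j)))"
    using expectation_power_mult_add[OF finite_moments_const[of 1] fm, of 1 k] by simp
  also have "\<dots> = (\<Sum>j\<le>k. real (k choose j) * (mu j * sqrt ?y ^ j) * (mu (k - j) * sqrt ?x ^ (k - j)))"
  proof (intro sum.cong refl)
    fix j
    have "expectation (\<lambda>\<omega>. Y \<omega> ^ j * X \<omega> ^ (k - j))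
        = expectation (\<lambda>\<omega>. X \<omega> ^ (k - j)) * expectation (\<lambda>\<omega>. Y \<omega> ^ j)"
      using expectation_indep_powers[OF fm indep, of "k - j" j] by (simp add: mult.commute)
    then show "real (k choose j) * expectation (\<lambda>\<omega>. Y \<omega> ^ j * X \<omega> ^ (k - j))
        = real (k choose j) * (mu j * sqrt ?y ^ j) * (mu (k - j) * sqrt ?x ^ (k - j))"
      unfolding gaussian_momentsD(2)[OF X, of "k - j"] gaussian_momentsD(2)[OF Y, of j] by simp
  qed
  also have "\<dots> = mu k * sqrt ((sqrt ?y)\<^sup>2 + (sqrt ?x)\<^sup>2) ^ k" by (rule mu_binomial)
  finally show "expectation (\<lambda>\<omega>. (X \<omega> + Y \<omega>) ^ k) = mu k * sqrt (expectation (\<lambda>\<omega>. (X \<omega> + Y \<omega>)\<^sup>2)) ^ k"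
    unfolding var .
qed

lemma gaussian_moments_indep_sum:
  fixes X :: "nat \<Rightarrow> 'a \<Rightarrow> real"
  assumes X: "\<And>i. i < n \<Longrightarrow> gaussian_moments (X i)" and indep: "indep_vars (\<lambda>_. borel) X {..<n}"
  shows "gaussian_moments (\<lambda>\<omega>. \<Sum>i<n. c i * X i \<omega>)"
proof -
  have indep': "indep_vars (\<lambda>_. borel) (\<lambda>i \<omega>. c i * X i \<omega>) {..<n}"
    using indep by (rule indep_vars_compose2) auto
  have "gaussian_moments (\<lambda>\<omega>. \<Sum>i<m. c i * X i \<omega>)" if "m \<le> n" for m
    using that
  proof (induction m)
    case 0
    show ?case using gaussian_moments_AE_zero[of "\<lambda>_. 0"] by simp
  next
    case (Suc m)
    have "indep_vars (\<lambda>_. borel) (\<lambda>i \<omega>. c i * X i \<omega>) (insert m {..<m})"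
      using Suc.prems by (intro indep_vars_subset[OF indep']) auto
    then have "indep_var borel (\<lambda>\<omega>. c m * X m \<omega>) borel (\<lambda>\<omega>. \<Sum>i<m. c i * X i \<omega>)"
      by (intro indep_vars_sum) auto
    then have "gaussian_moments (\<lambda>\<omega>. c m * X m \<omega> + (\<Sum>i<m. c i * X i \<omega>))"
      using Suc X by (intro gaussian_moments_add gaussian_moments_scale) auto
    then show ?case by (simp add: add.commute)
  qed
  then show ?thesis by simp
qed

section \<open>Grid increments of the two processes and their joint Gaussian space\<close>

lemma wiener_increments:
  assumes W: "standard_wiener_process W" and n: "1 \<le> n"
  shows "indep_vars (\<lambda>_. borel) (\<lambda>i \<omega>. grid_increment n i (\<lambda>t. W t \<omega>)) {..<n}"
    and "gaussian_moments (\<lambda>\<omega>. grid_increment n i (\<lambda>t. W t \<omega>))"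
    and "expectation (\<lambda>\<omega>. (grid_increment n i (\<lambda>t. W t \<omega>))\<^sup>2) = 1 / real n"
proof -
  let ?t = "\<lambda>i. real i / real n"
  from W have "\<forall>(k::nat) t. 0 \<le> t 0 \<and> (\<forall>i<k. t i < t (Suc i)) \<longrightarrow>
      indep_vars (\<lambda>_. borel) (\<lambda>i \<omega>. W (t (Suc i)) \<omega> - W (t i) \<omega>) {..<k}"
    unfolding standard_wiener_process_def by (elim conjE)
  moreover have "0 \<le> ?t 0 \<and> (\<forall>i<n. ?t i < ?t (Suc i))" using n by (simp add: divide_strict_right_mono)
  ultimately have "indep_vars (\<lambda>_. borel) (\<lambda>i \<omega>. W (?t (Suc i)) \<omega> - W (?t i) \<omega>) {..<n}"
    by (elim allE impE)
  then show "indep_vars (\<lambda>_. borel) (\<lambda>i \<omega>. grid_increment n i (\<lambda>t. W t \<omega>)) {..<n}"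
    by (simp add: grid_increment_def add.commute)
  have t: "0 \<le> ?t i" "?t i < ?t (i + 1)" "?t (i + 1) - ?t i = 1 / real n"
    using n by (auto simp: divide_strict_right_mono simp flip: diff_divide_distrib)
  from W have "\<forall>s t. 0 \<le> s \<and> s < t \<longrightarrow>
      distributed M lborel (\<lambda>\<omega>. W t \<omega> - W s \<omega>) (normal_density 0 (sqrt (t - s)))"
    unfolding standard_wiener_process_def by (elim conjE)
  with t(1,2) have "distributed M lborel (\<lambda>\<omega>. W (?t (i + 1)) \<omega> - W (?t i) \<omega>)
      (normal_density 0 (sqrt (?t (i + 1) - ?t i)))" by blast
  then have D: "distributed M lborel (\<lambda>\<omega>. grid_increment n i (\<lambda>t. W t \<omega>)) (normal_density 0 (sqrt (1 / real n)))"
    unfolding t(3) grid_increment_def .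
  have "0 < sqrt (1 / real n)" using n by simp
  from gaussian_moments_normal[OF D this] n
  show "gaussian_moments (\<lambda>\<omega>. grid_increment n i (\<lambda>t. W t \<omega>))"
    and "expectation (\<lambda>\<omega>. (grid_increment n i (\<lambda>t. W t \<omega>))\<^sup>2) = 1 / real n"
    by auto
qed

lemma fbm_linear_combination:
  assumes B: "fractional_brownian_motion H B" and F: "finite F" "F \<subseteq> {0..}"
  shows "gaussian_moments (\<lambda>\<omega>. \<Sum>t\<in>F. c t * B t \<omega>)"
proof -
  have proc: "gaussian_process {0..} B" and mean: "\<And>t. 0 \<le> t \<Longrightarrow> expectation (B t) = 0"
    using B by (auto simp: fractional_brownian_motion_def)
  have gv: "gaussian_variable (\<lambda>\<omega>. \<Sum>t\<in>F. c t * B t \<omega>)" if "finite F" "F \<subseteq> {0..}" for F c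
    using proc that unfolding gaussian_process_def by blast
  \<comment> \<open>One-point combinations come first: they make each \<open>B t\<close> integrable,
    which is required before the mean of the whole combination can be split.\<close>
  have "gaussian_moments (B t)" if "0 \<le> t" for t
    using gv[of "{t}" "\<lambda>_. 1"] mean that by (intro gaussian_variable_moments) auto
  then have "integrable M (B t)" if "t \<in> F" for t
    using F that by (intro finite_moments_integrable gaussian_momentsD(1)) auto
  then have "expectation (\<lambda>\<omega>. \<Sum>t\<in>F. c t * B t \<omega>) = (\<Sum>t\<in>F. c t * expectation (B t))" by simp
  also have "\<dots> = 0" using mean F by (intro sum.neutral) auto
  finally show ?thesis using gv[OF F] by (intro gaussian_variable_moments)
qed

lemma fbm_increment_combination:
  assumes B: "fractional_brownian_motion H B"
  shows "gaussian_moments (\<lambda>\<omega>. \<Sum>i<n. b i * grid_increment n i (\<lambda>t. B t \<omega>))"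
proof -
  let ?F = "(\<lambda>i. real i / real n) ` {..n}"
  \<comment> \<open>Summation by parts: \<open>?c t\<close> gathers the coefficient of the increment
    ending at \<open>t\<close> minus that of the increment starting there. The sum runs over a set
    of times, as in \<open>gaussian_process\<close>.\<close>
  let ?c = "\<lambda>t. \<Sum>i<n. (if t = real (i + 1) / real n then b i else 0) - (if t = real i / real n then b i else 0)"
  have "(\<Sum>i<n. b i * grid_increment n i (\<lambda>t. B t \<omega>)) = (\<Sum>t\<in>?F. ?c t * B t \<omega>)" for \<omega>
  proof -
    have "(\<Sum>t\<in>?F. ?c t * B t \<omega>) = (\<Sum>i<n. \<Sum>t\<in>?F.
        (if t = real (i + 1) / real n then b i * B t \<omega> else 0) - (if t = real i / real n then b i * B t \<omega> else 0))"
      unfolding sum_distrib_right by (subst sum.swap) (auto intro!: sum.cong simp: left_diff_distrib)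
    also have "\<dots> = (\<Sum>i<n. b i * grid_increment n i (\<lambda>t. B t \<omega>))"
    proof (intro sum.cong refl)
      fix i assume "i \<in> {..<n}"
      then have "real (i + 1) / real n \<in> ?F" "real i / real n \<in> ?F" by (auto simp del: of_nat_add of_nat_Suc)
      then show "(\<Sum>t\<in>?F. (if t = real (i + 1) / real n then b i * B t \<omega> else 0) - (if t = real i / real n then b i * B t \<omega> else 0))
          = b i * grid_increment n i (\<lambda>t. B t \<omega>)"
        by (simp add: sum_subtractf grid_increment_def right_diff_distrib del: of_nat_add of_nat_Suc)
    qed
    finally show ?thesis ..
  qed
  moreover have "gaussian_moments (\<lambda>\<omega>. \<Sum>t\<in>?F. ?c t * B t \<omega>)"
    by (rule fbm_linear_combination[OF B]) auto
  ultimately show ?thesis by simp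
qed

text \<open>The \<open>W\<close> part and the \<open>B\<close> part have separate coefficients, so
  an element is visibly a sum of two independent variables with Gaussian moments.\<close>

definition increment_space :: "(real \<Rightarrow> 'a \<Rightarrow> real) \<Rightarrow> (real \<Rightarrow> 'a \<Rightarrow> real) \<Rightarrow> nat \<Rightarrow> ('a \<Rightarrow> real) set" where
  "increment_space W B n = {f. \<exists>a b. f = (\<lambda>\<omega>. (\<Sum>i<n. a i * grid_increment n i (\<lambda>t. W t \<omega>))
      + (\<Sum>i<n. b i * grid_increment n i (\<lambda>t. B t \<omega>)))}"

lemma increment_spaceI:
  "(\<lambda>\<omega>. (\<Sum>i<n. a i * grid_increment n i (\<lambda>t. W t \<omega>)) + (\<Sum>i<n. b i * grid_increment n i (\<lambda>t. B t \<omega>)))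
     \<in> increment_space W B n"
  by (auto simp: increment_space_def)

lemma increment_space_members:
  assumes "i < n"
  shows "(\<lambda>\<omega>. c * grid_increment n i (\<lambda>t. W t \<omega>)) \<in> increment_space W B n"
    and "(\<lambda>\<omega>. c * grid_increment n i (\<lambda>t. B t \<omega>)) \<in> increment_space W B n"
proof -
  have eq: "(\<Sum>j<n. (if j = i then c else 0) * f j) = c * f i" for f :: "nat \<Rightarrow> real"
    using assms by (simp add: if_distrib[of "\<lambda>x. x * _"] cong: if_cong)
  show "(\<lambda>\<omega>. c * grid_increment n i (\<lambda>t. W t \<omega>)) \<in> increment_space W B n"
    using increment_spaceI[where a = "\<lambda>j. if j = i then c else 0" and b = "\<lambda>_. 0" and n = n] by (simp add: eq)
  show "(\<lambda>\<omega>. c * grid_increment n i (\<lambda>t. B t \<omega>)) \<in> increment_space W B n"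
    using increment_spaceI[where b = "\<lambda>j. if j = i then c else 0" and a = "\<lambda>_. 0" and n = n] by (simp add: eq)
qed

text \<open>Each combination is a measurable functional \<open>?\<phi>\<close> of the whole path.
  Grid times are nonnegative, so restricting paths to \<open>{0..}\<close> does not change its
  value.\<close>

lemma indep_increment_combinations:
  assumes "indep_processes {0..} W B"
  shows "indep_var borel (\<lambda>\<omega>. \<Sum>i<n. a i * grid_increment n i (\<lambda>t. W t \<omega>))
    borel (\<lambda>\<omega>. \<Sum>i<n. b i * grid_increment n i (\<lambda>t. B t \<omega>))"
proof -
  let ?\<phi> = "\<lambda>a x. \<Sum>i<n. a i * grid_increment n i x"
  have meas: "?\<phi> a \<in> borel_measurable (PiM {0..} (\<lambda>_. borel))" for a :: "nat \<Rightarrow> real"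
    unfolding grid_increment_def
    by (intro borel_measurable_sum borel_measurable_times borel_measurable_diff borel_measurable_const
        measurable_component_singleton) auto
  have "indep_var borel (?\<phi> a \<circ> (\<lambda>\<omega>. \<lambda>t\<in>{0..}. W t \<omega>)) borel (?\<phi> b \<circ> (\<lambda>\<omega>. \<lambda>t\<in>{0..}. B t \<omega>))"
    using assms meas unfolding indep_processes_def by (intro indep_var_compose)
  then show ?thesis by (simp add: comp_def grid_increment_def)
qed

lemma gaussian_space_increments:
  assumes W: "standard_wiener_process W" and B: "fractional_brownian_motion H B"
    and indep: "indep_processes {0..} W B" and n: "1 \<le> n"
  shows "gaussian_space (increment_space W B n)"
proof -
  have "gaussian_moments X" if "X \<in> increment_space W B n" for X
    using that gaussian_moments_indep_sum[OF wiener_increments(2)[OF W n] wiener_increments(1)[OF W n]]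
      fbm_increment_combination[OF B] indep_increment_combinations[OF indep]
    by (auto simp: increment_space_def intro!: gaussian_moments_add)
  moreover have "(\<lambda>_. 0) \<in> increment_space W B n"
    using increment_spaceI[where a = "\<lambda>_. 0" and b = "\<lambda>_. 0"] by simp
  moreover have "(\<lambda>\<omega>. c * X \<omega> + d * Y \<omega>) \<in> increment_space W B n"
    if "X \<in> increment_space W B n" "Y \<in> increment_space W B n" for X Y c d
  proof -
    from that obtain a b a' b' where
      X: "X = (\<lambda>\<omega>. (\<Sum>i<n. a i * grid_increment n i (\<lambda>t. W t \<omega>)) + (\<Sum>i<n. b i * grid_increment n i (\<lambda>t. B t \<omega>)))" and
      Y: "Y = (\<lambda>\<omega>. (\<Sum>i<n. a' i * grid_increment n i (\<lambda>t. W t \<omega>)) + (\<Sum>i<n. b' i * grid_increment n i (\<lambda>t. B t \<omega>)))"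
      unfolding increment_space_def by blast
    show ?thesis
      using increment_spaceI[where a = "\<lambda>i. c * a i + d * a' i" and b = "\<lambda>i. c * b i + d * b' i" and n = n and W = W and B = B]
      unfolding X Y by (simp add: sum.distrib sum_distrib_left algebra_simps)
  qed
  ultimately show ?thesis
    unfolding gaussian_space_def gaussian_moments_def by blast
qed

section \<open>Covariances of the grid increments\<close>

lemma wiener_increment_covariance:
  assumes W: "standard_wiener_process W" and n: "1 \<le> n" and ij: "i < n" "j < n" "i \<noteq> j"
  shows "expectation (\<lambda>\<omega>. grid_increment n i (\<lambda>t. W t \<omega>) * grid_increment n j (\<lambda>t. W t \<omega>)) = 0"
proof -
  note g = wiener_increments(2)[OF W n]
  have "indep_vars (\<lambda>_. borel) (\<lambda>i \<omega>. grid_increment n i (\<lambda>t. W t \<omega>)) (insert i {j})"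
    using ij by (intro indep_vars_subset[OF wiener_increments(1)[OF W n]]) auto
  then have "indep_var borel (\<lambda>\<omega>. grid_increment n i (\<lambda>t. W t \<omega>)) borel (\<lambda>\<omega>. \<Sum>i\<in>{j}. grid_increment n i (\<lambda>t. W t \<omega>))"
    using ij by (intro indep_vars_sum) auto
  then show ?thesis
    using expectation_indep_powers[OF gaussian_momentsD(1)[OF g] gaussian_momentsD(1)[OF g], of i j 1 1]
      gaussian_moments_mean[OF g] by simp
qed

lemma mixed_increment_covariance:
  assumes W: "standard_wiener_process W" and B: "fractional_brownian_motion H B"
    and indep: "indep_processes {0..} W B" and n: "1 \<le> n" and ij: "i < n" "j < n"
  shows "expectation (\<lambda>\<omega>. grid_increment n i (\<lambda>t. W t \<omega>) * grid_increment n j (\<lambda>t. B t \<omega>)) = 0"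
proof -
  have eq: "(\<Sum>l<n. (if l = k then 1 else 0) * f l) = f k" if "k < n" for k and f :: "nat \<Rightarrow> real"
    using that by (simp add: if_distrib[of "\<lambda>x. x * _"] cong: if_cong)
  have "indep_var borel (\<lambda>\<omega>. grid_increment n i (\<lambda>t. W t \<omega>)) borel (\<lambda>\<omega>. grid_increment n j (\<lambda>t. B t \<omega>))"
    using indep_increment_combinations[OF indep, where n = n
      and a = "\<lambda>l. if l = i then 1 else 0" and b = "\<lambda>l. if l = j then 1 else 0"] ij
    by (simp only: eq)
  moreover have gB: "gaussian_moments (\<lambda>\<omega>. grid_increment n j (\<lambda>t. B t \<omega>))"
    using fbm_increment_combination[OF B, where n = n and b = "\<lambda>l. if l = j then 1 else 0"] ij by (simp only: eq)
  ultimately show ?thesis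
    using expectation_indep_powers[OF gaussian_momentsD(1)[OF wiener_increments(2)[OF W n]] gaussian_momentsD(1)[OF gB], of i 1 1]
      gaussian_moments_mean[OF gB] by simp
qed

text \<open>The one-point terms of the four covariances cancel. What remains is the second
  difference of \<open>\<bar>x\<bar> powr (2 * H)\<close> at lag \<open>i - j\<close>, which
  expresses stationarity of the increments.\<close>

lemma fbm_increment_covariance:
  assumes B: "fractional_brownian_motion H B" and H: "0 < H" and n: "1 \<le> n"
  shows "expectation (\<lambda>\<omega>. grid_increment n i (\<lambda>t. B t \<omega>) * grid_increment n j (\<lambda>t. B t \<omega>)) =
    (\<bar>real i - real j + 1\<bar> powr (2 * H) + \<bar>real i - real j - 1\<bar> powr (2 * H) - 2 * \<bar>real i - real j\<bar> powr (2 * H))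
      / (2 * real n powr (2 * H))"
proof -
  let ?N = "real n powr (2 * H)"
  have fmB: "finite_moments (B t)" if "0 \<le> t" for t
    using gaussian_momentsD(1)[OF fbm_linear_combination[OF B, of "{t}" "\<lambda>_. 1"]] that by simp
  have cov: "expectation (\<lambda>\<omega>. B (real k / real n) \<omega> * B (real l / real n) \<omega>)
      = (real k powr (2 * H) + real l powr (2 * H) - \<bar>real k - real l\<bar> powr (2 * H)) / (2 * ?N)" for k l
  proof -
    have "\<bar>real k / real n - real l / real n\<bar> = \<bar>real k - real l\<bar> / real n"
      by (simp flip: diff_divide_distrib)
    then show ?thesis
      using B unfolding fractional_brownian_motion_def
      by (simp add: powr_divide add_divide_distrib diff_divide_distrib)
  qed
  have int: "integrable M (\<lambda>\<omega>. B (real k / real n) \<omega> * B (real l / real n) \<omega>)" for k l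
    using fmB by (intro finite_moments_integrable) auto
  have "(\<lambda>\<omega>. grid_increment n i (\<lambda>t. B t \<omega>) * grid_increment n j (\<lambda>t. B t \<omega>)) =
     (\<lambda>\<omega>. B (real (i + 1) / real n) \<omega> * B (real (j + 1) / real n) \<omega> - B (real (i + 1) / real n) \<omega> * B (real j / real n) \<omega>
        - B (real i / real n) \<omega> * B (real (j + 1) / real n) \<omega> + B (real i / real n) \<omega> * B (real j / real n) \<omega>)"
    unfolding grid_increment_def by (auto simp: algebra_simps)
  then have "expectation (\<lambda>\<omega>. grid_increment n i (\<lambda>t. B t \<omega>) * grid_increment n j (\<lambda>t. B t \<omega>)) =
      expectation (\<lambda>\<omega>. B (real (i + 1) / real n) \<omega> * B (real (j + 1) / real n) \<omega>)
      - expectation (\<lambda>\<omega>. B (real (i + 1) / real n) \<omega> * B (real j / real n) \<omega>)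
      - expectation (\<lambda>\<omega>. B (real i / real n) \<omega> * B (real (j + 1) / real n) \<omega>)
      + expectation (\<lambda>\<omega>. B (real i / real n) \<omega> * B (real j / real n) \<omega>)"
    using int by (simp del: of_nat_add of_nat_Suc)
  also have "\<dots> = (\<bar>real (i + 1) - real j\<bar> powr (2 * H) + \<bar>real i - real (j + 1)\<bar> powr (2 * H)
      - \<bar>real (i + 1) - real (j + 1)\<bar> powr (2 * H) - \<bar>real i - real j\<bar> powr (2 * H)) / (2 * ?N)"
    unfolding cov by (simp only: add_divide_distrib diff_divide_distrib)
  also have "\<dots> = (\<bar>real i - real j + 1\<bar> powr (2 * H) + \<bar>real i - real j - 1\<bar> powr (2 * H)
      - 2 * \<bar>real i - real j\<bar> powr (2 * H)) / (2 * ?N)"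
    by (simp add: algebra_simps)
  finally show ?thesis .
qed

end

section \<open>The mixed power variation\<close>

context prob_space
begin

text \<open>Distributes the power of \<open>n\<close> over the factors, so that every increment is
  normalised to unit variance.\<close>

lemma mixed_power_variation_eq:
  assumes n: "1 \<le> n"
  shows "mixed_power_variation H p r w b n =
    (\<Sum>i<n. (real n powr (1 / 2) * grid_increment n i w) ^ p * (real n powr H * grid_increment n i b) ^ r - mu p * mu r)"
proof -
  have "real n powr (real r * H + real p / 2) = (real n powr (1 / 2)) ^ p * (real n powr H) ^ r"
    using n by (simp add: powr_add powr_powr mult.commute flip: powr_realpow)
  then show ?thesis
    unfolding mixed_power_variation_def by (simp add: power_mult_distrib mult_ac)
qed

lemma expectation_scaled_mult:
  fixes u v :: "'a \<Rightarrow> real"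
  shows "expectation (\<lambda>\<omega>. (a * u \<omega>) * (b * v \<omega>)) = (a * b) * expectation (\<lambda>\<omega>. u \<omega> * v \<omega>)"
proof -
  have "(\<lambda>\<omega>. (a * u \<omega>) * (b * v \<omega>)) = (\<lambda>\<omega>. (a * b) * (u \<omega> * v \<omega>))" by (simp add: mult_ac)
  then show ?thesis by simp
qed

text \<open>By self-similarity \<open>n\<close> drops out of the correlations, which makes all
  covariance bounds uniform in the grid.\<close>

lemma scaled_increment_correlation:
  assumes B: "fractional_brownian_motion H B" and H: "0 < H" and n: "1 \<le> n"
  shows "expectation (\<lambda>\<omega>. (real n powr H * grid_increment n i (\<lambda>t. B t \<omega>)) * (real n powr H * grid_increment n j (\<lambda>t. B t \<omega>))) =
    (\<bar>real i - real j + 1\<bar> powr (2 * H) + \<bar>real i - real j - 1\<bar> powr (2 * H) - 2 * \<bar>real i - real j\<bar> powr (2 * H)) / 2"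
proof -
  have "real n powr H * real n powr H = real n powr (2 * H)" by (simp flip: powr_add)
  then show ?thesis
    unfolding expectation_scaled_mult using fbm_increment_covariance[OF B H n, of i j] n by simp
qed

lemma scaled_increment_correlation_bound:
  assumes B: "fractional_brownian_motion H B" and H: "0 < H" "H < 1" and n: "1 \<le> n" and ij: "i \<noteq> j"
  shows "\<bar>expectation (\<lambda>\<omega>. (real n powr H * grid_increment n i (\<lambda>t. B t \<omega>)) * (real n powr H * grid_increment n j (\<lambda>t. B t \<omega>)))\<bar>
    \<le> 4 * real (if i \<le> j then j - i else i - j) powr (2 * H - 2)"
proof -
  define k where "k = (if i \<le> j then j - i else i - j)"
  have k: "1 \<le> k" using ij by (auto simp: k_def)
  have "\<bar>real i - real j + 1\<bar> powr (2 * H) + \<bar>real i - real j - 1\<bar> powr (2 * H) - 2 * \<bar>real i - real j\<bar> powr (2 * H)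
      = (real k + 1) powr (2 * H) + (real k - 1) powr (2 * H) - 2 * real k powr (2 * H)"
  proof (cases "i \<le> j")
    case True
    then have e: "\<bar>real i - real j + 1\<bar> = real k - 1" "\<bar>real i - real j - 1\<bar> = real k + 1" "\<bar>real i - real j\<bar> = real k"
      using ij by (auto simp: k_def of_nat_diff)
    show ?thesis unfolding e by simp
  next
    case False
    then have e: "\<bar>real i - real j + 1\<bar> = real k + 1" "\<bar>real i - real j - 1\<bar> = real k - 1" "\<bar>real i - real j\<bar> = real k"
      by (auto simp: k_def of_nat_diff)
    show ?thesis unfolding e by simp
  qed
  then show ?thesis
    unfolding scaled_increment_correlation[OF B H(1) n] k_def[symmetric]
    \<comment> \<open>The factor \<open>4\<close> in the claim is half of the \<open>8\<close> of
      this bound.\<close>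
    using powr_second_difference_bound[of "2 * H" k] H k by simp
qed

text \<open>The premise \<open>bound\<close> is the interface for the case distinction of the
  theorem: it turns decay of the correlation into decay \<open>k powr - \<alpha>\<close> of the
  covariance, so the cases differ in \<open>C\<close> and \<open>\<alpha>\<close> only.\<close>

lemma mixed_power_variation_second_moment:
  assumes W: "standard_wiener_process W" and B: "fractional_brownian_motion H B"
    and indep: "indep_processes {0..} W B" and H: "0 < H" "H < 1" and n: "1 \<le> n"
    and C: "0 \<le> C" and bound: "\<And>k \<rho>. 1 \<le> k \<Longrightarrow> \<bar>\<rho>\<bar> \<le> 4 * real k powr (2 * H - 2) \<Longrightarrow>
      (mu p)\<^sup>2 * (corr_const r * corr_size r \<rho>) \<le> C * real k powr - \<alpha>"
  shows "expectation (\<lambda>\<omega>. (mixed_power_variation H p r (\<lambda>t. W t \<omega>) (\<lambda>t. B t \<omega>) n)\<^sup>2)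
    \<le> mu (2 * p) * mu (2 * r) * real n + 2 * C * (real n * (\<Sum>k\<in>{1..n}. real k powr - \<alpha>))"
proof -
  define X where "X i = (\<lambda>\<omega>. real n powr (1 / 2) * grid_increment n i (\<lambda>t. W t \<omega>))" for i
  define Y where "Y i = (\<lambda>\<omega>. real n powr H * grid_increment n i (\<lambda>t. B t \<omega>))" for i
  let ?G = "increment_space W B n"
  let ?T = "\<lambda>i \<omega>. X i \<omega> ^ p * Y i \<omega> ^ r - mu p * mu r"
  let ?d = "\<lambda>i j::nat. if i \<le> j then j - i else i - j"
  have G: "gaussian_space ?G" by (rule gaussian_space_increments[OF W B indep n])
  have mem: "X i \<in> ?G" "Y i \<in> ?G" if "i < n" for i
    unfolding X_def Y_def by (rule increment_space_members[OF that])+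
  have varX: "expectation (\<lambda>\<omega>. (X i \<omega>)\<^sup>2) = 1" for i
    using n wiener_increments(3)[OF W n, of i]
    by (simp add: X_def power_mult_distrib powr_half_sqrt)
  have varY: "expectation (\<lambda>\<omega>. (Y i \<omega>)\<^sup>2) = 1" for i
    using scaled_increment_correlation[OF B H(1) n, of i i] by (simp add: Y_def power2_eq_square)
  have orthX: "expectation (\<lambda>\<omega>. X i \<omega> * X j \<omega>) = 0" if "i < n" "j < n" "i \<noteq> j" for i j
    unfolding X_def expectation_scaled_mult using wiener_increment_covariance[OF W n that] by simp
  have orthXY: "expectation (\<lambda>\<omega>. X i \<omega> * Y j \<omega>) = 0" if "i < n" "j < n" for i j
    unfolding X_def Y_def expectation_scaled_mult using mixed_increment_covariance[OF W B indep n that] by simp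
  have fmT: "finite_moments (?T i)" if "i < n" for i
    using gaussian_space_finite_moments[OF G] mem[OF that] by auto
  have diag: "expectation (\<lambda>\<omega>. ?T i \<omega> * ?T i \<omega>) \<le> mu (2 * p) * mu (2 * r)" if "i < n" for i
    using that by (intro mixed_power_variance[OF G] mem varX varY orthXY)
  have off: "expectation (\<lambda>\<omega>. ?T i \<omega> * ?T j \<omega>) \<le> C * real (?d i j) powr - \<alpha>"
    if i: "i < n" and j: "j < n" and ij: "i \<noteq> j" for i j
  proof -
    have "\<bar>expectation (\<lambda>\<omega>. ?T i \<omega> * ?T j \<omega>)\<bar> \<le> (mu p)\<^sup>2 * (corr_const r * corr_size r (expectation (\<lambda>\<omega>. Y i \<omega> * Y j \<omega>)))"
      by (rule mixed_power_covariance[OF G mem(1)[OF i] mem(1)[OF j] mem(2)[OF i] mem(2)[OF j]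
          varX varX varY varY orthX[OF that] orthXY[OF i i] orthXY[OF i j] orthXY[OF j i] orthXY[OF j j] refl])
    also have "\<dots> \<le> C * real (?d i j) powr - \<alpha>"
    proof (rule bound)
      show "1 \<le> ?d i j" using ij by auto
      show "\<bar>expectation (\<lambda>\<omega>. Y i \<omega> * Y j \<omega>)\<bar> \<le> 4 * real (?d i j) powr (2 * H - 2)"
        unfolding Y_def by (rule scaled_increment_correlation_bound[OF B H n ij])
    qed
    finally show ?thesis by linarith
  qed
  have S: "mixed_power_variation H p r (\<lambda>t. W t \<omega>) (\<lambda>t. B t \<omega>) n = (\<Sum>i<n. ?T i \<omega>)" for \<omega>
    by (simp only: mixed_power_variation_eq[OF n] X_def Y_def)
  have "expectation (\<lambda>\<omega>. (mixed_power_variation H p r (\<lambda>t. W t \<omega>) (\<lambda>t. B t \<omega>) n)\<^sup>2)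
      = (\<Sum>i<n. \<Sum>j<n. expectation (\<lambda>\<omega>. ?T i \<omega> * ?T j \<omega>))"
    unfolding S by (rule expectation_square_sum[OF fmT])
  also have "\<dots> \<le> (\<Sum>i<n. mu (2 * p) * mu (2 * r) + 2 * C * (\<Sum>k\<in>{1..n}. real k powr - \<alpha>))"
  proof (intro sum_mono)
    fix i assume "i \<in> {..<n}"
    then have i: "i < n" by simp
    have "(\<Sum>j<n. expectation (\<lambda>\<omega>. ?T i \<omega> * ?T j \<omega>))
        = expectation (\<lambda>\<omega>. ?T i \<omega> * ?T i \<omega>) + (\<Sum>j\<in>{..<n} - {i}. expectation (\<lambda>\<omega>. ?T i \<omega> * ?T j \<omega>))"
      using i by (intro sum.remove) auto
    also have "\<dots> \<le> mu (2 * p) * mu (2 * r) + (\<Sum>j\<in>{..<n} - {i}. C * real (?d i j) powr - \<alpha>)"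
      using i by (intro add_mono sum_mono diag off) auto
    also have "(\<Sum>j\<in>{..<n} - {i}. C * real (?d i j) powr - \<alpha>) \<le> 2 * (\<Sum>k\<in>{1..n}. C * real k powr - \<alpha>)"
      using C i by (intro sum_distance_bound) auto
    finally show "(\<Sum>j<n. expectation (\<lambda>\<omega>. ?T i \<omega> * ?T j \<omega>))
        \<le> mu (2 * p) * mu (2 * r) + 2 * C * (\<Sum>k\<in>{1..n}. real k powr - \<alpha>)"
      by (simp add: sum_distrib_left mult.assoc)
  qed
  also have "\<dots> = mu (2 * p) * mu (2 * r) * real n + 2 * C * (real n * (\<Sum>k\<in>{1..n}. real k powr - \<alpha>))"
    by (simp add: algebra_simps)
  finally show ?thesis .
qed

text \<open>The condition \<open>1 \<le> 2 * \<gamma>\<close> pays for the \<open>n\<close> diagonal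
  terms, and both conditions together pay for the off-diagonal sum.\<close>

lemma mixed_power_variation_smallo:
  assumes W: "standard_wiener_process W" and B: "fractional_brownian_motion H B"
    and indep: "indep_processes {0..} W B" and H: "0 < H" "H < 1" and \<epsilon>: "0 < \<epsilon>"
    and C: "0 \<le> C" and bound: "\<And>k \<rho>. 1 \<le> k \<Longrightarrow> \<bar>\<rho>\<bar> \<le> 4 * real k powr (2 * H - 2) \<Longrightarrow>
      (mu p)\<^sup>2 * (corr_const r * corr_size r \<rho>) \<le> C * real k powr - \<alpha>"
    and \<gamma>: "1 \<le> 2 * \<gamma>" "2 - \<alpha> \<le> 2 * \<gamma>"
  shows "AE \<omega> in M. mixed_power_variation H p r (\<lambda>t. W t \<omega>) (\<lambda>t. B t \<omega>) \<in> o(\<lambda>n. real n powr (\<gamma> + \<epsilon>))"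
proof -
  let ?S = "\<lambda>n \<omega>. mixed_power_variation H p r (\<lambda>t. W t \<omega>) (\<lambda>t. B t \<omega>) n"
  let ?V = "mu (2 * p) * mu (2 * r)" and ?s = "\<Sum>k. real k powr (- 1 - \<epsilon>)"
  have V: "0 \<le> ?V" by (simp add: mu_nonneg)
  have s: "0 \<le> ?s" using \<epsilon> by (intro suminf_nonneg) (auto simp: summable_real_powr_iff)
  have "AE \<omega> in M. (\<lambda>n. ?S n \<omega>) \<in> o(\<lambda>n. real n powr (\<gamma> + \<epsilon>))"
  proof (rule AE_smallo_of_variance[OF gaussian_space_increments[OF W B indep] _ _ _ \<epsilon>])
    show "0 \<le> ?V + 2 * C * ?s" using V C s by simp
    fix n :: nat assume n: "1 \<le> n"
    \<comment> \<open>The degree \<open>p + r\<close> is the same for all \<open>n\<close>, so a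
      single moment constant serves the whole sequence.\<close>
    show "poly_rv (increment_space W B n) (1 * p + 1 * r) (?S n)"
      unfolding mixed_power_variation_eq[OF n] diff_conv_add_uminus
      by (intro poly_rv_sum poly_rv.add poly_rv_mult poly_rv_power poly_rv_var poly_rv.const increment_space_members) auto
    have "expectation (\<lambda>\<omega>. (?S n \<omega>)\<^sup>2) \<le> ?V * real n + 2 * C * (real n * (\<Sum>k\<in>{1..n}. real k powr - \<alpha>))"
      by (rule mixed_power_variation_second_moment[OF W B indep H n C bound])
    also have "\<dots> \<le> ?V * real n powr (2 * \<gamma> + \<epsilon>) + 2 * C * (?s * real n powr (2 * \<gamma> + \<epsilon>))"
    proof (intro add_mono mult_left_mono sum_powr_bound \<epsilon> n \<gamma> V)
      have "real n powr 1 \<le> real n powr (2 * \<gamma> + \<epsilon>)" using n \<gamma> \<epsilon> by (intro powr_mono) auto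
      then show "real n \<le> real n powr (2 * \<gamma> + \<epsilon>)" using n by simp
    qed (use C in simp)
    also have "\<dots> = (?V + 2 * C * ?s) * real n powr (2 * \<gamma> + \<epsilon>)" by (simp add: algebra_simps)
    finally show "expectation (\<lambda>\<omega>. (?S n \<omega>)\<^sup>2) \<le> (?V + 2 * C * ?s) * real n powr (2 * \<gamma> + \<epsilon>)" .
  qed
  then show ?thesis by simp
qed

text \<open>Squaring \<open>4 * k powr (2 * H - 2)\<close> produces the constant \<open>16\<close>
  and the exponent \<open>4 - 4 * H\<close>.\<close>

lemma corr_size_even_bound:
  assumes "even r" "\<bar>\<rho>\<bar> \<le> 4 * real k powr (2 * H - 2)" "1 \<le> k"
  shows "(mu p)\<^sup>2 * (corr_const r * corr_size r \<rho>) \<le> ((mu p)\<^sup>2 * (corr_const r * 16)) * real k powr - (4 - 4 * H)"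
proof -
  have "\<bar>\<rho>\<bar>\<^sup>2 \<le> (4 * real k powr (2 * H - 2))\<^sup>2" using assms by (intro power_mono) auto
  also have "\<dots> = 16 * real k powr - (4 - 4 * H)"
    using assms(3) by (simp add: power_mult_distrib power2_eq_square flip: powr_add)
  finally have "(mu p)\<^sup>2 * (corr_const r * corr_size r \<rho>) \<le> (mu p)\<^sup>2 * (corr_const r * (16 * real k powr - (4 - 4 * H)))"
    using assms(1) by (intro mult_left_mono corr_const_nonneg) (auto simp: corr_size_def)
  then show ?thesis by (simp only: mult.assoc)
qed

lemma corr_size_odd_bound:
  assumes "odd r" "\<bar>\<rho>\<bar> \<le> 4 * real k powr (2 * H - 2)"
  shows "(mu p)\<^sup>2 * (corr_const r * corr_size r \<rho>) \<le> ((mu p)\<^sup>2 * (corr_const r * 4)) * real k powr - (2 - 2 * H)"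
proof -
  have "(mu p)\<^sup>2 * (corr_const r * corr_size r \<rho>) \<le> (mu p)\<^sup>2 * (corr_const r * (4 * real k powr (2 * H - 2)))"
    using assms by (intro mult_left_mono corr_const_nonneg) (auto simp: corr_size_def)
  then show ?thesis by (simp only: mult.assoc minus_diff_eq)
qed

end

theorem proposition2p1:
  fixes M :: "'a measure"
    and W B :: "real \<Rightarrow> 'a \<Rightarrow> real"
    and H \<epsilon> :: real
    and p r :: nat
  assumes "prob_space M" and "complete_measure M"
    and "0 < H" and "H < 1"
    and "prob_space.standard_wiener_process M W"
    and "prob_space.fractional_brownian_motion M H B"
    and "prob_space.indep_processes M {0..} W B"
    and "\<epsilon> > 0"
  shows
    "(r = 0 \<longrightarrow>
        (AE \<omega> in M.
          mixed_power_variation H p r (\<lambda>t. W t \<omega>) (\<lambda>t. B t \<omega>)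
            \<in> o(\<lambda>n. real n powr (1/2 + \<epsilon>)))) \<and>
     (even p \<and> even r \<and> r \<ge> 2 \<longrightarrow>
        (H \<le> 3/4 \<longrightarrow> (AE \<omega> in M.
          mixed_power_variation H p r (\<lambda>t. W t \<omega>) (\<lambda>t. B t \<omega>)
            \<in> o(\<lambda>n. real n powr (1/2 + \<epsilon>)))) \<and>
        (H > 3/4 \<longrightarrow> (AE \<omega> in M.
          mixed_power_variation H p r (\<lambda>t. W t \<omega>) (\<lambda>t. B t \<omega>)
            \<in> o(\<lambda>n. real n powr (2 * H - 1 + \<epsilon>))))) \<and>
     (odd p \<longrightarrow>
        (AE \<omega> in M.
          mixed_power_variation H p r (\<lambda>t. W t \<omega>) (\<lambda>t. B t \<omega>)
            \<in> o(\<lambda>n. real n powr (1/2 + \<epsilon>)))) \<and>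
     (even p \<and> odd r \<longrightarrow>
        (H \<le> 1/2 \<longrightarrow> (AE \<omega> in M.
          mixed_power_variation H p r (\<lambda>t. W t \<omega>) (\<lambda>t. B t \<omega>)
            \<in> o(\<lambda>n. real n powr (1/2 + \<epsilon>)))) \<and>
        (H > 1/2 \<longrightarrow> (AE \<omega> in M.
          mixed_power_variation H p r (\<lambda>t. W t \<omega>) (\<lambda>t. B t \<omega>)
            \<in> o(\<lambda>n. real n powr (H + \<epsilon>)))))"
proof -
  interpret prob_space M by fact
  note smallo = mixed_power_variation_smallo[OF assms(5,6,7,3,4,8)]
  have C: "0 \<le> (mu p)\<^sup>2 * (corr_const r * c)" if "0 \<le> c" for c
    using that corr_const_nonneg[of r] by simp
  \<comment> \<open>The off-diagonal covariances vanish: \<open>corr_const 0 = 0\<close>, and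
    \<open>mu p = 0\<close> for odd \<open>p\<close>. So \<open>C = 0\<close>, and
    \<open>\<alpha> = 1\<close> is the least exponent compatible with
    \<open>\<gamma> = 1/2\<close>.\<close>
  have trivial: "AE \<omega> in M. mixed_power_variation H p r (\<lambda>t. W t \<omega>) (\<lambda>t. B t \<omega>) \<in> o(\<lambda>n. real n powr (1/2 + \<epsilon>))"
    if "r = 0 \<or> odd p"
    using that by (intro smallo[where C = 0 and \<alpha> = 1]) (auto simp: corr_const_def std_normal_moment_odd)
  \<comment> \<open>The conditions read \<open>1 \<le> 2 * \<gamma>\<close> and
    \<open>2 * H - 1 \<le> \<gamma>\<close>; the two lower bounds for \<open>\<gamma>\<close> cross
    at \<open>H = 3/4\<close>.\<close>
  have even: "AE \<omega> in M. mixed_power_variation H p r (\<lambda>t. W t \<omega>) (\<lambda>t. B t \<omega>) \<in> o(\<lambda>n. real n powr (\<gamma> + \<epsilon>))"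
    if "even r" "1 \<le> 2 * \<gamma>" "2 - (4 - 4 * H) \<le> 2 * \<gamma>" for \<gamma>
    using that C[of 16]
    by (intro smallo[where C = "(mu p)\<^sup>2 * (corr_const r * 16)" and \<alpha> = "4 - 4 * H"] corr_size_even_bound) auto
  \<comment> \<open>Here they read \<open>1 \<le> 2 * \<gamma>\<close> and
    \<open>H \<le> \<gamma>\<close>, so the threshold is \<open>H = 1/2\<close>.\<close>
  have odd: "AE \<omega> in M. mixed_power_variation H p r (\<lambda>t. W t \<omega>) (\<lambda>t. B t \<omega>) \<in> o(\<lambda>n. real n powr (\<gamma> + \<epsilon>))"
    if "odd r" "1 \<le> 2 * \<gamma>" "2 - (2 - 2 * H) \<le> 2 * \<gamma>" for \<gamma>
    using that C[of 4]
    by (intro smallo[where C = "(mu p)\<^sup>2 * (corr_const r * 4)" and \<alpha> = "2 - 2 * H"] corr_size_odd_bound) auto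
  show ?thesis
    using trivial even[of "1/2"] even[of "2 * H - 1"] odd[of "1/2"] odd[of H] by auto
qed

end
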